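(* There is an absolute constant $C>0$ such that the following holds for every ring of cliques $\mathcal{R}_{b,q}$, with $n=bq$. Let $\mathbf{x}\in\mathbb{R}^n$ be a unit vector with $\mathbf{x}^t\mathbf{1}=0$, put $\mu=\mathbf{x}^t\hat{A}\mathbf{x}$, and suppose $\mu\ge\lambda_q(\hat{A})$, the $q$-th largest eigenvalue of $\hat{A}$. If $$\|\hat{A}\mathbf{x}-\mu\mathbf{x}\|_2<\frac{C}{q\sqrt{n}},$$ then $$\phi(D^{-1/2}\mathbf{x})\le 2\binom{b}{2}^{-1}.$$
   Context: For integers $b\ge 2$, $q\ge 3$, the ring of cliques $\mathcal{R}_{b,q}$ is the graph on $n=bq$ vertices with adjacency matrix $A=(a_{i,j})=I_q\otimes(\mathbf{1}_b\mathbf{1}_b^t-I_b)+C_q\otimes(\mathbf{e}_1\mathbf{e}_1^t)$, i.e. $q$ cliques of size $b$ in which the first vertex of each clique (its corner) is joined to the corners of the two cyclically adjacent cliques; $C_q$ is the adjacency matrix of the $q$-cycle. $D$ is the diagonal degree matrix, $\hat{A}=D^{-1/2}AD^{-1/2}$, and $\mathbf{1}$ is the all-ones vector. Eigenvalues are counted with multiplicity in decreasing order. For a nonempty proper vertex subset $S$ with complement $\bar S$, $\mathrm{Vol}(S)=\sum_{i,j\in S}a_{i,j}$, $E(S,\bar S)=\sum_{i\in S,j\notin S}a_{i,j}$, and $\phi(S)=E(S,\bar S)/\min(\mathrm{Vol}(S),\mathrm{Vol}(\bar S))$ ($+\infty$ if the denominator is $0$). For $\mathbf{y}\in\mathbb{R}^n$,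 $\phi(\mathbf{y})=\min_t\phi(S_{\mathbf{y}}(t))$ over those $t$ for which the sweep cut $S_{\mathbf{y}}(t)=\{i:y_i>t\}$ is nonempty and proper. *)

theory Defs
  imports
    "Jordan_Normal_Form.Char_Poly"
    "HOL-Library.Extended_Real"
begin

section \<open>Vectors and matrices\<close>

definition ones_vec :: "nat \<Rightarrow> real vec" where
  "ones_vec n = vec n (\<lambda>_. 1)"

definition norm_2 :: "real vec \<Rightarrow> real" where
  "norm_2 x = sqrt (x \<bullet> x)"

definition outer_product :: "real vec \<Rightarrow> real vec \<Rightarrow> real mat" where
  "outer_product u v = mat (dim_vec u) (dim_vec v) (\<lambda>(i, j). u $ i * v $ j)"

definition kronecker :: "real mat \<Rightarrow> real mat \<Rightarrow> real mat" where
  "kronecker A B = mat (dim_row A * dim_row B) (dim_col A * dim_col B)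
     (\<lambda>(i, j). A $$ (i div dim_row B, j div dim_col B) * B $$ (i mod dim_row B, j mod dim_col B))"

text \<open>The real eigenvalues with algebraic multiplicity, in decreasing order, numbered from 1.
  Only meant for matrices whose characteristic polynomial splits over the reals
  (such as symmetric ones) and for \<open>1 \<le> k \<le> dim_row A\<close>.\<close>

definition nth_largest_eigenvalue :: "real mat \<Rightarrow> nat \<Rightarrow> real" where
  "nth_largest_eigenvalue A k = rev (sorted_list_of_multiset (proots (char_poly A))) ! (k - 1)"

section \<open>Degree normalization\<close>

definition degree_of :: "real mat \<Rightarrow> nat \<Rightarrow> real" where
  "degree_of A i = (\<Sum>j<dim_col A. A $$ (i, j))"

text \<open>The diagonal matrix \<open>D\<^sup>-\<^sup>1\<^sup>/\<^sup>2\<close>.\<close>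

definition inv_sqrt_degree_mat :: "real mat \<Rightarrow> real mat" where
  "inv_sqrt_degree_mat A = mat_diag (dim_row A) (\<lambda>i. 1 / sqrt (degree_of A i))"

definition normalized_adjacency :: "real mat \<Rightarrow> real mat" where
  "normalized_adjacency A = inv_sqrt_degree_mat A * A * inv_sqrt_degree_mat A"

section \<open>Conductance and sweep cuts\<close>

text \<open>The vertices are \<open>{..<dim_row A}\<close>. The volume counts only edges inside \<open>S\<close>
  (each of them twice); it is not the sum of the degrees over \<open>S\<close>.\<close>

definition volume :: "real mat \<Rightarrow> nat set \<Rightarrow> real" where
  "volume A S = (\<Sum>i\<in>S. \<Sum>j\<in>S. A $$ (i, j))"

definition cut_weight :: "real mat \<Rightarrow> nat set \<Rightarrow> real" where
  "cut_weight A S = (\<Sum>i\<in>S. \<Sum>j\<in>{..<dim_row A} - S. A $$ (i, j))"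

definition conductance :: "real mat \<Rightarrow> nat set \<Rightarrow> ereal" where
  "conductance A S =
     (let m = min (volume A S) (volume A ({..<dim_row A} - S))
      in if m = 0 then \<infinity> else ereal (cut_weight A S / m))"

definition sweep_cut :: "real vec \<Rightarrow> real \<Rightarrow> nat set" where
  "sweep_cut y t = {i. i < dim_vec y \<and> y $ i > t}"

definition proper_thresholds :: "real vec \<Rightarrow> real set" where
  "proper_thresholds y = {t. sweep_cut y t \<noteq> {} \<and> sweep_cut y t \<noteq> {..<dim_vec y}}"

text \<open>The infimum runs over finitely many cuts, so it is a minimum; it is \<open>\<infinity>\<close> if \<open>y\<close> is
  constant and no threshold is admissible.\<close>

definition sweep_conductance :: "real mat \<Rightarrow> real vec \<Rightarrow> ereal" where
  "sweep_conductance A y = (INF t\<in>proper_thresholds y. conductance A (sweep_cut y t))"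

lemma sweep_conductance_attained:
  assumes "proper_thresholds y \<noteq> {}"
  shows "\<exists>t\<in>proper_thresholds y. sweep_conductance A y = conductance A (sweep_cut y t)"
proof -
  let ?V = "(\<lambda>t. conductance A (sweep_cut y t)) ` proper_thresholds y"
  have "?V \<subseteq> conductance A ` Pow {..<dim_vec y}"
    by (auto simp: sweep_cut_def)
  then have "finite ?V"
    by (rule finite_subset) simp
  with assms have "Inf ?V \<in> ?V"
    by (metis Min_Inf Min_in image_is_empty)
  then show ?thesis
    unfolding sweep_conductance_def by auto
qed

section \<open>The ring of cliques\<close>

definition cycle_mat :: "nat \<Rightarrow> real mat" where
  "cycle_mat q = mat q q (\<lambda>(i, j). if j = (i + 1) mod q \<or> i = (j + 1) mod q then 1 else 0)"

text \<open>Vertex \<open>i\<close> is the \<open>(i mod b)\<close>-th vertex of the \<open>(i div b)\<close>-th clique; the corner of a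
  clique is its vertex number 0.\<close>

definition ring_of_cliques :: "nat \<Rightarrow> nat \<Rightarrow> real mat" where
  "ring_of_cliques b q =
     kronecker (1\<^sub>m q) (outer_product (ones_vec b) (ones_vec b) - 1\<^sub>m b) +
     kronecker (cycle_mat q) (outer_product (unit_vec b 0) (unit_vec b 0))"

end

theory Submission
  imports "HOL-Analysis.Analysis" "Jordan_Normal_Form.Schur_Decomposition" Defs
begin

text \<open>Write \<open>y = D\<^sup>-\<^sup>1\<^sup>/\<^sup>2 x\<close>, and for each clique \<open>k\<close> let \<open>w k\<close> be the sum of \<open>y\<close> over the clique divided
  by \<open>\<gamma> = 1 + \<mu> (b - 1)\<close>. The eigenvector equation at the vertices that are not corners says that
  they have value \<open>w k\<close> up to the residual, and hence that the corner has value \<open>\<kappa> w k\<close> with the same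
  ratio \<open>\<kappa> = 1 - (1 - \<mu>) (b - 1)\<close> in all cliques. The hypothesis on \<open>\<lambda>\<^sub>q\<close> yields
  \<open>\<kappa> \<ge> (b - 1) / (b + 3)\<close>.

  If \<open>b\<close> is large compared to \<open>q\<close>, or if \<open>y\<close> has an entry much larger than \<open>b\<^sup>-\<^sup>3\<^sup>/\<^sup>2\<close>, then
  the few cliques with large values span intervals that are too short to cover all thresholds near the maximum
  of \<open>\<bar>y\<bar>\<close>, so some sweep cut splits no clique; such a cut has conductance at most half of the bound.

  Otherwise the cut weight and the volume of the sweep cuts of \<open>y\<close> or \<open>- y\<close> at positive thresholds
  are averaged against a density proportional to \<open>p / sqrt (t + \<tau>\<^sup>2) - 1\<close>. If all these cuts violated the bound,
  the average would bound the sum of the positive parts of \<open>w\<close> by the total residual, which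
  contradicts the normalization and \<open>\<Sum> x = 0\<close>.\<close>

text \<open>The averaging over thresholds has almost no slack, and this dictates its density. For a
  clique with inner value \<open>w\<close> and corner value \<open>\<kappa> * w\<close>, averaging
  with a potential \<open>F\<close> compares the gain \<open>2 * F w\<close> with the cost
  \<open>E * (F w - F (\<kappa> * w))\<close>, where \<open>E = b - 3 + 8 / b\<close>. If
  \<open>F u\<close> is a power \<open>u^s\<close> and \<kappa> takes its extreme value
  \<open>(b - 1) / (b + 3)\<close>, then \<open>E * (1 - \<kappa>^s)\<close> tends to
  \<open>4 * s\<close> as \<open>b\<close> grows. Uniform thresholds (\<open>s = 1\<close>) thus
  lose by a factor of 2, and \<open>s = 1/2\<close> is the largest power for which the limit does
  not exceed 2.

  The square root is infinitely steep at 0 and would amplify the residual without bound. Shifting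
  its argument by the square of \<tau> caps the slope at the price of a loss
  \<open>4 * p * \<tau>\<close> per clique, while the residual enters with the factor
  \<open>p / \<tau>\<close>; \<tau> balances the two.

  The density must stay nonnegative up to the largest value, so the square of \<open>p\<close> has
  to exceed it, and \<tau> must not exceed \<open>p\<close>. Large entries and large
  \<open>b\<close> violate this, which is why they need the covering argument.\<close>

unbundle no vec_syntax
unbundle no inner_syntax

section \<open>Eigenvalues of real symmetric matrices\<close>

lemma symmetric_scalar_prod_swap:
  fixes A :: "'a::comm_semiring_0 mat"
  assumes "A \<in> carrier_mat n n" "transpose_mat A = A" "u \<in> carrier_vec n" "v \<in> carrier_vec n"
  shows "(A *\<^sub>v u) \<bullet> v = u \<bullet> (A *\<^sub>v v)"
  using transpose_vec_mult_scalar[OF assms(1) assms(4) assms(3)] assms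
  by simp

lemma real_symmetric_eigenvalue_real:
  fixes A :: "real mat"
  assumes A: "A \<in> carrier_mat n n" and sym: "transpose_mat A = A"
    and ev: "eigenvalue (map_mat complex_of_real A) l"
  shows "l \<in> \<real>"
proof -
  let ?M = "map_mat complex_of_real A"
  have M: "?M \<in> carrier_mat n n" using A by simp
  have symM: "transpose_mat ?M = ?M"
    using arg_cong[OF sym, of "map_mat complex_of_real"] by (simp only: map_mat_transpose)
  obtain v where v: "v \<in> carrier_vec n" "v \<noteq> 0\<^sub>v n" "?M *\<^sub>v v = l \<cdot>\<^sub>v v"
    using ev M unfolding eigenvalue_def eigenvector_def by auto
  have conjM: "?M *\<^sub>v conjugate v = conjugate (?M *\<^sub>v v)"
    using A v(1) by (intro eq_vecI) (auto simp: scalar_prod_def)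
  have "l * (v \<bullet> conjugate v) = (?M *\<^sub>v v) \<bullet> conjugate v"
    using v by simp
  also have "\<dots> = v \<bullet> (?M *\<^sub>v conjugate v)"
    using v by (intro symmetric_scalar_prod_swap[OF M symM]) auto
  also have "\<dots> = cnj l * (v \<bullet> conjugate v)"
    using v by (simp add: conjM conjugate_smult_vec)
  finally have "l = cnj l"
    using v conjugate_square_eq_0_vec[OF v(1)] by auto
  then show ?thesis
    using Reals_cnj_iff by metis
qed

text \<open>\<open>nth_largest_eigenvalue\<close> collects only real roots, so its list has
  \<open>n\<close> entries only because the polynomial splits over the reals. The roots of the
  complex factorization are real, and embedding real polynomials into complex ones is
  injective.\<close>

lemma real_symmetric_char_poly_splits:
  fixes A :: "real mat"
  assumes A: "A \<in> carrier_mat n n" and sym: "transpose_mat A = A"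
  shows "\<exists>es. char_poly A = (\<Prod>e\<leftarrow>es. [:- e, 1:])"
proof -
  interpret re: map_poly_inj_idom_hom complex_of_real ..
  let ?M = "map_mat complex_of_real A"
  have M: "?M \<in> carrier_mat n n" using A by simp
  obtain as where as: "char_poly ?M = (\<Prod>a\<leftarrow>as. [:- a, 1:])"
    using char_poly_factorized[OF M] by auto
  have "a \<in> \<real>" if "a \<in> set as" for a
  proof (rule real_symmetric_eigenvalue_real[OF A sym])
    have "poly (\<Prod>a\<leftarrow>as. [:- a, 1:]) a = 0"
      using that by (induction as) auto
    then have "poly (char_poly ?M) a = 0"
      by (simp only: as)
    then show "eigenvalue ?M a"
      using eigenvalue_root_char_poly[OF M] by simp
  qed
  then have re: "map (\<lambda>e. of_real (Re e)) as = as"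
    by (intro map_idI) (simp add: of_real_Re)
  have "map_poly complex_of_real (char_poly A) = char_poly ?M"
    by (rule of_real_hom.char_poly_hom[OF A, symmetric])
  also have "\<dots> = (\<Prod>a\<leftarrow>map (\<lambda>e. of_real (Re e)) as. [:- a, 1:])"
    by (simp only: re as)
  also have "\<dots> = map_poly complex_of_real (\<Prod>e\<leftarrow>map Re as. [:- e, 1:])"
    by (simp add: re.hom_prod_list comp_def)
  finally show ?thesis
    using re.injectivity by blast
qed

lemma orthogonal_matrix_with_first_column:
  fixes v :: "real vec"
  assumes v: "v \<in> carrier_vec n" "v \<bullet> v = 1"
  shows "\<exists>W \<in> carrier_mat n n. transpose_mat W * W = 1\<^sub>m n \<and> W *\<^sub>v unit_vec n 0 = v"
proof -
  interpret cof_vec_space n "TYPE(real)" .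
  have v0: "v \<noteq> 0\<^sub>v n" using v by auto
  have n: "n \<noteq> 0" using v by (cases n) (auto simp: scalar_prod_def)
  define b where "b = basis_completion v"
  define ws where "ws = gram_schmidt n b"
  note bc = basis_completion[OF v(1) v0, folded b_def]
  obtain vs where bv: "b = v # vs" using bc n by (cases b) auto
  have ws: "set ws \<subseteq> carrier_vec n" "corthogonal ws" "length ws = n"
    using gram_schmidt_result[of b ws] bc ws_def by auto
  have hdws: "hd ws = v"
    using gram_schmidt_hd[OF v(1), of vs] by (simp add: ws_def bv)
  have orth: "(ws ! i) \<bullet> (ws ! j) = 0 \<longleftrightarrow> i \<noteq> j" if "i < n" "j < n" for i j
    using corthogonalD[OF ws(2), of i j] that ws(3) by simp
  \<comment> \<open>Gram-Schmidt yields orthogonal vectors that need not have length one. The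
    division leaves the first column alone because \<open>v\<close> is a unit vector.\<close>
  define W where "W = mat n n (\<lambda>(i, j). (ws ! j) $ i / sqrt ((ws ! j) \<bullet> (ws ! j)))"
  have dimws: "dim_vec (ws ! j) = n" if "j < n" for j
    using ws(1,3) that by (meson carrier_vecD nth_mem subsetD)
  have W: "W \<in> carrier_mat n n" by (simp add: W_def)
  have colW: "col W j = (1 / sqrt ((ws ! j) \<bullet> (ws ! j))) \<cdot>\<^sub>v (ws ! j)" if "j < n" for j
    using that dimws by (intro eq_vecI) (auto simp: W_def)
  have "transpose_mat W * W = 1\<^sub>m n"
  proof (intro eq_matI)
    fix i j assume "i < dim_row (1\<^sub>m n)" "j < dim_col (1\<^sub>m n)"
    then have ij: "i < n" "j < n" by auto
    have car: "ws ! i \<in> carrier_vec n" "ws ! j \<in> carrier_vec n"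
      using dimws ij by (metis carrier_vec_dim_vec)+
    have pos: "(ws ! j) \<bullet> (ws ! j) > 0"
      using orth[OF ij(2) ij(2)] conjugate_square_ge_0_vec[of "ws ! j"] by simp
    have "(transpose_mat W * W) $$ (i, j) = col W i \<bullet> col W j"
      using ij W by simp
    also have "\<dots> = (1 / sqrt ((ws ! i) \<bullet> (ws ! i))) * (1 / sqrt ((ws ! j) \<bullet> (ws ! j))) * ((ws ! i) \<bullet> (ws ! j))"
      using car ij by (simp add: colW)
    also have "\<dots> = 1\<^sub>m n $$ (i, j)"
      using orth[of i j] ij pos by (cases "i = j") auto
    finally show "(transpose_mat W * W) $$ (i, j) = 1\<^sub>m n $$ (i, j)" .
  qed (use W in auto)
  moreover have "W *\<^sub>v unit_vec n 0 = col W 0"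
    using W n by (intro eq_vecI) auto
  moreover have "ws ! 0 = v"
    using hdws ws(3) n by (metis hd_conv_nth length_0_conv)
  then have "col W 0 = v"
    using colW[of 0] n v by simp
  ultimately show ?thesis using W by auto
qed

lemma eq_four_block_mat_if_zero:
  fixes B :: "'a::zero mat"
  assumes B: "B \<in> carrier_mat (Suc m) (Suc m)"
    and "\<And>i. i < m \<Longrightarrow> B $$ (Suc i, 0) = 0" "\<And>i. i < m \<Longrightarrow> B $$ (0, Suc i) = 0"
  shows "B = four_block_mat (mat 1 1 (\<lambda>_. B $$ (0, 0))) (0\<^sub>m 1 m) (0\<^sub>m m 1) (mat m m (\<lambda>(i, j). B $$ (Suc i, Suc j)))"
  (is "B = ?F")
proof (rule eq_matI)
  fix i j assume "i < dim_row ?F" "j < dim_col ?F"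
  then have "i < Suc m" "j < Suc m" by auto
  then show "B $$ (i, j) = ?F $$ (i, j)"
    using assms(2)[of "i - 1"] assms(3)[of "j - 1"]
    by (cases i; cases j) auto
qed (use B in auto)

text \<open>Deflation, by induction on the list of roots: the eigenvalues then appear in the order
  of the given list, which can be chosen descending. An orthogonal change of basis that starts with
  an eigenvector for the head of the list makes the first column diagonal, and symmetry does the
  same for the first row.\<close>

lemma real_symmetric_diagonalization:
  fixes A :: "real mat"
  assumes "A \<in> carrier_mat n n" "transpose_mat A = A" "char_poly A = (\<Prod>e\<leftarrow>es. [:- e, 1:])"
  shows "\<exists>P \<in> carrier_mat n n. transpose_mat P * P = 1\<^sub>m n \<and> A * P = P * mat_diag n (\<lambda>i. es ! i)"
  using assms
proof (induction es arbitrary: n A)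
  case Nil
  then have "n = 0"
    using degree_monic_char_poly[OF Nil(1)] by simp
  with Nil show ?case
    by (intro bexI[of _ "1\<^sub>m 0"]) (auto intro!: eq_matI simp: mat_diag_def)
next
  case (Cons e es)
  note A = Cons.prems(1) and sym = Cons.prems(2)
  have cp: "char_poly A = [:- e, 1:] * (\<Prod>e\<leftarrow>es. [:- e, 1:])"
    using Cons.prems(3) by simp
  have "degree (char_poly A) = Suc (degree (\<Prod>e\<leftarrow>es. [:- e, 1:]))"
    unfolding cp by (subst degree_mult_eq) (auto simp: prod_list_zero_iff)
  then obtain m where n: "n = Suc m"
    using degree_monic_char_poly[OF A] by simp
  have "eigenvalue A e"
    unfolding eigenvalue_root_char_poly[OF A] cp by simp
  then obtain v' where v': "v' \<in> carrier_vec n" "v' \<noteq> 0\<^sub>v n" "A *\<^sub>v v' = e \<cdot>\<^sub>v v'"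
    using A unfolding eigenvalue_def eigenvector_def by auto
  define v where "v = (1 / sqrt (v' \<bullet> v')) \<cdot>\<^sub>v v'"
  have "v' \<bullet> v' > 0"
    using conjugate_square_greater_0_vec[OF v'(1)] v'(2) by simp
  then have v: "v \<in> carrier_vec n" "v \<bullet> v = 1" "A *\<^sub>v v = e \<cdot>\<^sub>v v"
    using v' A by (auto simp: v_def mult_mat_vec[of _ n n] smult_smult_assoc mult.commute)
  obtain W where W: "W \<in> carrier_mat n n" "transpose_mat W * W = 1\<^sub>m n" "W *\<^sub>v unit_vec n 0 = v"
    using orthogonal_matrix_with_first_column[OF v(1,2)] by auto
  have WW: "W * transpose_mat W = 1\<^sub>m n"
    using mat_mult_left_right_inverse[OF _ W(1,2)] W(1) by simp
  define B where "B = transpose_mat W * A * W"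
  have B: "B \<in> carrier_mat n n" using W A by (simp add: B_def)
  have AW: "A * W = W * B"
  proof -
    have "W * B = (W * transpose_mat W) * (A * W)"
      unfolding B_def using W(1) A by (simp add: assoc_mult_mat[of _ n n _ n _ n])
    then show ?thesis using WW A W(1) by simp
  qed
  have symB: "transpose_mat B = B"
    unfolding B_def using W(1) A sym
    by (simp add: transpose_mult[of _ n n _ n] assoc_mult_mat[of _ n n _ n _ n])
  have "B *\<^sub>v unit_vec n 0 = transpose_mat W *\<^sub>v (A *\<^sub>v (W *\<^sub>v unit_vec n 0))"
    unfolding B_def using W(1) A by (simp add: assoc_mult_mat_vec[of _ n n _ n])
  also have "\<dots> = e \<cdot>\<^sub>v (transpose_mat W *\<^sub>v (W *\<^sub>v unit_vec n 0))"
    using W(1) v by (simp add: W(3) mult_mat_vec[of _ n n])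
  also have "transpose_mat W *\<^sub>v (W *\<^sub>v unit_vec n 0) = unit_vec n 0"
    using W(1) by (simp add: assoc_mult_mat_vec[of _ n n _ n, symmetric] W(2))
  finally have Be: "B *\<^sub>v unit_vec n 0 = e \<cdot>\<^sub>v unit_vec n 0" .
  have B0: "B $$ (i, 0) = (if i = 0 then e else 0)" if "i < n" for i
  proof -
    have "B $$ (i, 0) = (B *\<^sub>v unit_vec n 0) $ i"
      using that B n by simp
    then show ?thesis using that n unfolding Be by simp
  qed
  have B0': "B $$ (0, j) = (if j = 0 then e else 0)" if "j < n" for j
    using B0[OF that] that B n index_transpose_mat(1)[of j B 0] symB by simp
  define B3 where "B3 = mat m m (\<lambda>(i, j). B $$ (Suc i, Suc j))"
  have B3: "B3 \<in> carrier_mat m m" by (simp add: B3_def)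
  let ?E = "mat 1 1 (\<lambda>_. e)"
  have Bblock: "B = four_block_mat ?E (0\<^sub>m 1 m) (0\<^sub>m m 1) B3"
    using eq_four_block_mat_if_zero[of B m] B n B0[of 0] B0[of "Suc _"] B0'[of "Suc _"]
    unfolding B3_def by simp
  have symB3: "transpose_mat B3 = B3"
  proof -
    have "B $$ (Suc j, Suc i) = B $$ (Suc i, Suc j)" if "i < m" "j < m" for i j
      using arg_cong[OF symB, of "\<lambda>M. M $$ (Suc i, Suc j)"] that B n by simp
    then show ?thesis by (intro eq_matI) (auto simp: B3_def)
  qed
  have "similar_mat_wit B A (transpose_mat W) W"
    by (rule similar_mat_witI[of _ _ n]) (use W WW B A in \<open>auto simp: B_def\<close>)
  then have "char_poly B = char_poly A"
    using char_poly_similar unfolding similar_mat_def by blast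
  also have "char_poly B = char_poly ?E * char_poly B3"
    unfolding Bblock by (rule char_poly_four_block_zeros_col) (auto simp: B3)
  also have "char_poly ?E = [:- e, 1:]"
    by (simp add: char_poly_defs det_def sign_def)
  finally have "char_poly B3 = (\<Prod>e\<leftarrow>es. [:- e, 1:])"
    unfolding cp by (metis mult_cancel_left pCons_eq_0_iff zero_neq_one)
  from Cons.IH[OF B3 symB3 this] obtain P where P: "P \<in> carrier_mat m m"
    "transpose_mat P * P = 1\<^sub>m m" "B3 * P = P * mat_diag m (\<lambda>i. es ! i)" by auto
  let ?Q = "four_block_mat (1\<^sub>m 1) (0\<^sub>m 1 m) (0\<^sub>m m 1) P"
  let ?D = "mat_diag n (\<lambda>i. (e # es) ! i)"
  have Q: "?Q \<in> carrier_mat n n" using P n by auto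
  have D: "?D = four_block_mat ?E (0\<^sub>m 1 m) (0\<^sub>m m 1) (mat_diag m (\<lambda>i. es ! i))"
    using n by (intro eq_matI) (auto simp: mat_diag_def nth_Cons')
  have "transpose_mat ?Q * ?Q = four_block_mat (1\<^sub>m 1) (0\<^sub>m 1 m) (0\<^sub>m m 1) (transpose_mat P * P)"
    using P(1) by (subst transpose_four_block_mat[of _ 1 1 _ m _ m])
      (auto simp: mult_four_block_mat[of _ 1 1 _ m _ m _ _ 1 _ m])
  also have "\<dots> = 1\<^sub>m n"
    unfolding P(2) using n by (intro eq_matI) auto
  finally have QQ: "transpose_mat ?Q * ?Q = 1\<^sub>m n" .
  have "0\<^sub>m 1 m * mat_diag m (\<lambda>i. es ! i) = 0\<^sub>m 1 m"
    by (rule left_mult_zero_mat) simp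
  then have BQ: "B * ?Q = ?Q * ?D"
    unfolding Bblock D using P B3
    by (auto simp: mult_four_block_mat[of _ 1 1 _ m _ m _ _ 1 _ m])
  have "transpose_mat (W * ?Q) * (W * ?Q) = transpose_mat ?Q * ((transpose_mat W * W) * ?Q)"
    using W(1) Q by (simp add: transpose_mult[of _ n n _ n] assoc_mult_mat[of _ n n _ n _ n])
  then have 1: "transpose_mat (W * ?Q) * (W * ?Q) = 1\<^sub>m n"
    unfolding W(2) left_mult_one_mat[OF Q] QQ .
  have "A * (W * ?Q) = A * W * ?Q"
    by (rule assoc_mult_mat[symmetric]) (use A W Q in auto)
  also have "\<dots> = W * (B * ?Q)"
    unfolding AW by (rule assoc_mult_mat) (use B W Q in auto)
  also have "\<dots> = W * ?Q * ?D"
    unfolding BQ by (rule assoc_mult_mat[symmetric, of _ n n _ n _ n]) (use W(1) Q in auto)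
  finally have 2: "A * (W * ?Q) = W * ?Q * ?D" .
  have "W * ?Q \<in> carrier_mat n n" using W(1) Q by auto
  with 1 2 show ?case by blast
qed

text \<open>One half of the Courant-Fischer principle; the test space of dimension \<open>q\<close>
  is the range of the injective matrix \<open>Z\<close>. It meets the span of the eigenvectors from
  the \<open>q\<close>-th on, where the form is at most the \<open>q\<close>-th eigenvalue times the
  squared norm.\<close>

lemma nth_largest_eigenvalue_ge:
  fixes A :: "real mat"
  assumes A: "A \<in> carrier_mat n n" and sym: "transpose_mat A = A"
    and q: "1 \<le> q" "q \<le> n" and Z: "Z \<in> carrier_mat n q"
    and inj: "\<And>u. u \<in> carrier_vec q \<Longrightarrow> Z *\<^sub>v u = 0\<^sub>v n \<Longrightarrow> u = 0\<^sub>v q"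
    and form: "\<And>u. u \<in> carrier_vec q \<Longrightarrow> 
      c * ((Z *\<^sub>v u) \<bullet> (Z *\<^sub>v u)) \<le> (Z *\<^sub>v u) \<bullet> (A *\<^sub>v (Z *\<^sub>v u))"
  shows "c \<le> nth_largest_eigenvalue A q"
proof -
  obtain es' where es': "char_poly A = (\<Prod>e\<leftarrow>es'. [:- e, 1:])"
    using real_symmetric_char_poly_splits[OF A sym] by auto
  define es where "es = rev (sorted_list_of_multiset (proots (char_poly A)))"
  have "proots (char_poly A) = mset es'"
    unfolding es'
  proof (induction es')
    case (Cons e es)
    have "(\<Prod>e\<leftarrow>es. [:- e, 1:]) \<noteq> 0"
      by (auto simp: prod_list_zero_iff)
    then have "proots ([:- e, 1:] * (\<Prod>e\<leftarrow>es. [:- e, 1:])) = {#e#} + mset es"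
      using Cons by (subst proots_mult) auto
    then show ?case by (simp del: mult_pCons_left)
  qed simp
  then have mset: "mset es = mset es'"
    by (simp add: es_def)
  have "(\<Prod>e\<leftarrow>es. [:- e, 1:]) = (\<Prod>e\<leftarrow>es'. [:- e, 1:])"
    using arg_cong[OF mset, of "\<lambda>M. prod_mset (image_mset (\<lambda>e. [:- e, 1:]) M)"]
    by (simp only: mset_map[symmetric] prod_mset_prod_list)
  then have cp: "char_poly A = (\<Prod>e\<leftarrow>es. [:- e, 1:])"
    using es' by simp
  have len: "length es = n"
    using degree_monic_char_poly[OF A] unfolding cp
    by (simp add: degree_linear_factors)
  have desc: "es ! j \<le> es ! i" if "i \<le> j" "j < n" for i j
    using sorted_rev_nth_mono[of es i j] that len by (simp add: es_def)
  obtain P where P: "P \<in> carrier_mat n n" "transpose_mat P * P = 1\<^sub>m n"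
    "A * P = P * mat_diag n (\<lambda>i. es ! i)"
    using real_symmetric_diagonalization[OF A sym cp] by auto
  have PP: "P * transpose_mat P = 1\<^sub>m n"
    using mat_mult_left_right_inverse[OF _ P(1,2)] P(1) by simp
  \<comment> \<open>Orthogonality to the first \<open>q - 1\<close> eigenvectors amounts to
    \<open>q - 1\<close> equations in \<open>q\<close> unknowns. A zero row at index
    \<open>q - 1\<close> makes the system square and singular, so it has a nonzero solution
    \<open>u\<close>.\<close>
  define G where "G = mat q q (\<lambda>(i, j). if i < q - 1 then (transpose_mat P * Z) $$ (i, j) else 0)"
  have G: "G \<in> carrier_mat q q" by (simp add: G_def)
  have "G = mat\<^sub>r q q (\<lambda>i. if i = q - 1 then 0\<^sub>v q else row G i)"
    using q by (intro eq_matI) (auto simp: G_def)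
  then have "det G = 0"
    using det_row_0[of "q - 1" q "row G"] G q by auto
  then obtain u where u: "u \<in> carrier_vec q" "u \<noteq> 0\<^sub>v q" "G *\<^sub>v u = 0\<^sub>v q"
    using det_0_iff_vec_prod_zero[OF G] by auto
  define z where "z = Z *\<^sub>v u"
  define d where "d = transpose_mat P *\<^sub>v z"
  have z: "z \<in> carrier_vec n" and d: "d \<in> carrier_vec n"
    using Z u P by (auto simp: z_def d_def)
  have z0: "z \<noteq> 0\<^sub>v n"
    using inj u by (auto simp: z_def)
  have zd: "z = P *\<^sub>v d"
    unfolding d_def using P(1) z PP by (simp add: assoc_mult_mat_vec[of _ n n _ n, symmetric])
  have d0: "d $ i = 0" if "i < q - 1" for i
  proof -
    have PZ: "transpose_mat P * Z \<in> carrier_mat n q" using P Z by simp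
    have "d $ i = ((transpose_mat P * Z) *\<^sub>v u) $ i"
      unfolding d_def z_def using P Z u by (simp add: assoc_mult_mat_vec[of _ n n _ q])
    also have "\<dots> = row (transpose_mat P * Z) i \<bullet> u"
      using that q PZ P(1) by simp
    also have "row (transpose_mat P * Z) i = row G i"
      using that q PZ P(1) Z by (intro eq_vecI) (auto simp: G_def)
    also have "row G i \<bullet> u = (G *\<^sub>v u) $ i"
      using that q G by simp
    finally show ?thesis using that q u(3) by simp
  qed
  have ort: "(P *\<^sub>v a) \<bullet> (P *\<^sub>v a') = a \<bullet> a'" if "a \<in> carrier_vec n" "a' \<in> carrier_vec n" for a a'
  proof -
    have "(P *\<^sub>v a) \<bullet> (P *\<^sub>v a') = (transpose_mat P *\<^sub>v (P *\<^sub>v a)) \<bullet> a'"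
      using transpose_vec_mult_scalar[OF P(1), of a' "P *\<^sub>v a"] that P(1) by simp
    also have "transpose_mat P *\<^sub>v (P *\<^sub>v a) = a"
      using that P by (simp add: assoc_mult_mat_vec[of _ n n _ n, symmetric])
    finally show ?thesis .
  qed
  let ?D = "mat_diag n (\<lambda>i. es ! i)"
  have D: "?D \<in> carrier_mat n n" by simp
  have "A *\<^sub>v z = P *\<^sub>v (?D *\<^sub>v d)"
    unfolding zd using A P d D by (simp add: assoc_mult_mat_vec[of _ n n _ n, symmetric])
  then have "z \<bullet> (A *\<^sub>v z) = d \<bullet> (?D *\<^sub>v d)"
    using ort[of d "?D *\<^sub>v d"] d D zd by simp
  also have "\<dots> = (\<Sum>i<n. es ! i * (d $ i)\<^sup>2)"
  proof -
    have "(?D *\<^sub>v d) $ i = es ! i * d $ i" if "i < n" for i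
      using that d unfolding mat_diag_def
      by (simp add: scalar_prod_def if_distrib[of "\<lambda>x. x * _"] sum.delta cong: if_cong)
    moreover have "dim_vec (?D *\<^sub>v d) = n" by (simp add: mat_diag_def)
    ultimately show ?thesis
      unfolding scalar_prod_def lessThan_atLeast0 power2_eq_square
      by (intro sum.cong) (auto simp: mult_ac)
  qed
  also have "\<dots> \<le> (\<Sum>i<n. es ! (q - 1) * (d $ i)\<^sup>2)"
  proof (intro sum_mono)
    fix i assume "i \<in> {..<n}"
    then show "es ! i * (d $ i)\<^sup>2 \<le> es ! (q - 1) * (d $ i)\<^sup>2"
      using d0[of i] desc[of "q - 1" i] by (cases "i < q - 1") (auto intro!: mult_right_mono)
  qed
  also have "\<dots> = es ! (q - 1) * (d \<bullet> d)"
    using d by (simp add: scalar_prod_def lessThan_atLeast0 power2_eq_square sum_distrib_left)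
  also have "d \<bullet> d = z \<bullet> z"
    using ort[OF d d] zd by simp
  finally have "c * (z \<bullet> z) \<le> es ! (q - 1) * (z \<bullet> z)"
    using form[OF u(1)] unfolding z_def by linarith
  moreover have "z \<bullet> z > 0"
    using conjugate_square_greater_0_vec[OF z] z0 by simp
  ultimately show ?thesis
    unfolding nth_largest_eigenvalue_def es_def by simp
qed

section \<open>Sums, cuts and sweeps on the ring of cliques\<close>

lemma sum_lessThan_first:
  fixes f :: "nat \<Rightarrow> 'a::comm_monoid_add"
  assumes "0 < b"
  shows "(\<Sum>j<b. f j) = f 0 + (\<Sum>j=1..<b. f j)"
  using assms by (simp add: lessThan_atLeast0 sum.atLeast_Suc_lessThan)

lemma sum_blocks:
  fixes f :: "nat \<Rightarrow> 'a::comm_monoid_add"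
  shows "sum f {..<b * q} = (\<Sum>k<q. \<Sum>i<b. f (k * b + i))"
proof -
  have "(\<Sum>k<q. sum f {k * b..<k * b + b}) = sum f {..<q * b}"
    by (rule sum.nat_group)
  moreover have "sum f {k * b..<k * b + b} = (\<Sum>i<b. f (k * b + i))" for k
    using sum.shift_bounds_nat_ivl[of f 0 "k * b" b]
    by (simp add: lessThan_atLeast0 add.commute)
  ultimately show ?thesis by (simp add: mult.commute)
qed

lemma block_index: "i < b \<Longrightarrow> (k * b + i) div b = k" "i < b \<Longrightarrow> (k * b + i) mod b = (i::nat)"
  by auto

lemma block_index_less: "k < q \<Longrightarrow> i < b \<Longrightarrow> k * b + i < b * (q::nat)"
proof -
  assume "k < q" "i < b"
  then have "k * b + i < Suc k * b" by simp
  also have "\<dots> \<le> q * b" using \<open>k < q\<close> by (intro mult_le_mono1) simp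
  finally show ?thesis by (simp add: mult.commute)
qed

lemma bij_betw_cyclic_Suc:
  assumes "0 < q"
  shows "bij_betw (\<lambda>k. Suc k mod q) {..<q} {..<q}"
proof (rule bij_betwI[where g = "\<lambda>k. (k + (q - 1)) mod q"])
  show "(\<lambda>k. Suc k mod q) \<in> {..<q} \<rightarrow> {..<q}" "(\<lambda>k. (k + (q - 1)) mod q) \<in> {..<q} \<rightarrow> {..<q}"
    using assms by auto
  show "(Suc x mod q + (q - 1)) mod q = x" if "x \<in> {..<q}" for x
  proof -
    have "(Suc x mod q + (q - 1)) mod q = (Suc x + (q - 1)) mod q"
      by (simp add: mod_add_left_eq)
    also have "Suc x + (q - 1) = x + q" using assms by simp
    finally show ?thesis using that by simp
  qed
  show "Suc ((x + (q - 1)) mod q) mod q = x" if "x \<in> {..<q}" for x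
  proof -
    have "Suc ((x + (q - 1)) mod q) mod q = Suc (x + (q - 1)) mod q"
      by (simp add: mod_Suc_eq)
    also have "Suc (x + (q - 1)) = x + q" using assms by simp
    finally show ?thesis using that by simp
  qed
qed

lemma sum_cyclic_Suc:
  "0 < q \<Longrightarrow> (\<Sum>k<q. f (Suc k mod q)) = (\<Sum>k<q. f k)"
  by (rule sum.reindex_bij_betw[OF bij_betw_cyclic_Suc])

lemma sum_cycle_edges:
  fixes h :: "nat \<Rightarrow> nat \<Rightarrow> real"
  assumes q: "q \<ge> 3"
  shows "(\<Sum>k<q. \<Sum>l<q. (if l = Suc k mod q \<or> k = Suc l mod q then h k l else 0))
    = (\<Sum>k<q. h k (Suc k mod q) + h (Suc k mod q) k)"
proof -
  \<comment> \<open>This needs three cliques: with two, the forward and the backward neighbour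
    coincide and the right-hand side would count the edge twice.\<close>
  have disj: "\<not> (l = Suc k mod q \<and> k = Suc l mod q)" if "k < q" "l < q" for k l
    using that q by (auto simp: mod_Suc split: if_splits)
  have "(\<Sum>k<q. \<Sum>l<q. (if l = Suc k mod q \<or> k = Suc l mod q then h k l else 0))
    = (\<Sum>k<q. \<Sum>l<q. (if l = Suc k mod q then h k l else 0) + (if k = Suc l mod q then h k l else 0))"
    using disj by (intro sum.cong refl) auto
  also have "\<dots> = (\<Sum>k<q. \<Sum>l<q. (if l = Suc k mod q then h k l else 0))
      + (\<Sum>l<q. \<Sum>k<q. (if k = Suc l mod q then h k l else 0))"
    unfolding sum.distrib by (subst (2) sum.swap) simp
  also have "\<dots> = (\<Sum>k<q. h k (Suc k mod q) + h (Suc k mod q) k)"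
    using q by (simp add: sum.delta' sum.distrib)
  finally show ?thesis .
qed

lemma ring_of_cliques_dim [simp]:
  "dim_row (ring_of_cliques b q) = b * q" "dim_col (ring_of_cliques b q) = b * q"
  by (simp_all add: ring_of_cliques_def kronecker_def outer_product_def cycle_mat_def)

lemma ring_of_cliques_carrier: "ring_of_cliques b q \<in> carrier_mat (b * q) (b * q)"
  by (simp add: carrier_matI)

lemma ring_of_cliques_entry:
  assumes "k < q" "i < b" "l < q" "j < b"
  shows "ring_of_cliques b q $$ (k * b + i, l * b + j)
    = (if k = l \<and> i \<noteq> j then 1 else 0)
      + (if i = 0 \<and> j = 0 \<and> (l = Suc k mod q \<or> k = Suc l mod q) then 1 else 0)"
proof -
  have "k * b + i < q * b" "l * b + j < q * b"
    using block_index_less[of k q i b] block_index_less[of l q j b] assms by (simp_all add: mult.commute)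
  then show ?thesis
    using assms
    by (simp add: ring_of_cliques_def kronecker_def outer_product_def ones_vec_def cycle_mat_def
        unit_vec_def block_index)
qed

text \<open>Cut weights, volumes, threshold averages and the quadratic form are all sums of this
  shape, so the adjacency matrix is evaluated here once for all of them.\<close>

lemma ring_of_cliques_sum:
  fixes h :: "nat \<Rightarrow> nat \<Rightarrow> real"
  assumes q: "q \<ge> 3" and b: "b \<ge> 1"
  shows "(\<Sum>u<b * q. \<Sum>v<b * q. ring_of_cliques b q $$ (u, v) * h u v)
    = (\<Sum>k<q. \<Sum>i<b. \<Sum>j<b. if i = j then 0 else h (k * b + i) (k * b + j))
      + (\<Sum>k<q. h (k * b) (Suc k mod q * b) + h (Suc k mod q * b) (k * b))"
proof -
  let ?c = "\<lambda>k l. l = Suc k mod q \<or> k = Suc l mod q"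
  have *: "(\<Sum>i<b. \<Sum>l<q. \<Sum>j<b. ring_of_cliques b q $$ (k * b + i, l * b + j) * h (k * b + i) (l * b + j))
    = (\<Sum>i<b. \<Sum>j<b. if i = j then 0 else h (k * b + i) (k * b + j))
      + (\<Sum>l<q. if ?c k l then h (k * b) (l * b) else 0)" if k: "k < q" for k
  proof -
    have "(\<Sum>l<q. \<Sum>j<b. ring_of_cliques b q $$ (k * b + i, l * b + j) * h (k * b + i) (l * b + j))
      = (\<Sum>j<b. if i = j then 0 else h (k * b + i) (k * b + j))
        + (if i = 0 then (\<Sum>l<q. if ?c k l then h (k * b) (l * b) else 0) else 0)" if i: "i < b" for i
    proof -
      have "(\<Sum>j<b. ring_of_cliques b q $$ (k * b + i, l * b + j) * h (k * b + i) (l * b + j))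
        = (if l = k then (\<Sum>j<b. if i = j then 0 else h (k * b + i) (k * b + j)) else 0)
          + (if i = 0 \<and> ?c k l then h (k * b) (l * b) else 0)" if l: "l < q" for l
      proof -
        have "(\<Sum>j<b. ring_of_cliques b q $$ (k * b + i, l * b + j) * h (k * b + i) (l * b + j))
          = (\<Sum>j<b. (if l = k then (if i = j then 0 else h (k * b + i) (k * b + j)) else 0)
            + (if j = 0 then (if i = 0 \<and> ?c k l then h (k * b) (l * b) else 0) else 0))"
          using k i l by (intro sum.cong refl) (auto simp: ring_of_cliques_entry)
        also have "\<dots> = (if l = k then (\<Sum>j<b. if i = j then 0 else h (k * b + i) (k * b + j)) else 0)
          + (if i = 0 \<and> ?c k l then h (k * b) (l * b) else 0)"
          using b by (simp add: sum.distrib sum.delta)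
        finally show ?thesis .
      qed
      then have "(\<Sum>l<q. \<Sum>j<b. ring_of_cliques b q $$ (k * b + i, l * b + j) * h (k * b + i) (l * b + j))
        = (\<Sum>l<q. (if l = k then (\<Sum>j<b. if i = j then 0 else h (k * b + i) (k * b + j)) else 0)
          + (if i = 0 \<and> ?c k l then h (k * b) (l * b) else 0))"
        by (intro sum.cong refl) blast
      then show ?thesis using k by (simp add: sum.distrib sum.delta)
    qed
    then have "(\<Sum>i<b. \<Sum>l<q. \<Sum>j<b. ring_of_cliques b q $$ (k * b + i, l * b + j) * h (k * b + i) (l * b + j))
      = (\<Sum>i<b. (\<Sum>j<b. if i = j then 0 else h (k * b + i) (k * b + j))
        + (if i = 0 then (\<Sum>l<q. if ?c k l then h (k * b) (l * b) else 0) else 0))"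
      by (intro sum.cong refl) blast
    then show ?thesis using b by (simp add: sum.distrib sum.delta)
  qed
  have "(\<Sum>u<b * q. \<Sum>v<b * q. ring_of_cliques b q $$ (u, v) * h u v)
    = (\<Sum>k<q. (\<Sum>i<b. \<Sum>j<b. if i = j then 0 else h (k * b + i) (k * b + j))
      + (\<Sum>l<q. if ?c k l then h (k * b) (l * b) else 0))"
    unfolding sum_blocks using * by (intro sum.cong refl) auto
  then show ?thesis
    using sum_cycle_edges[OF q, of "\<lambda>k l. h (k * b) (l * b)"] by (simp add: sum.distrib)
qed

section \<open>Cut weight, volume and conductance as double sums\<close>

lemma sum_subset_eq:
  assumes "finite T" "S \<subseteq> T"
  shows "sum f S = (\<Sum>v\<in>T. if v \<in> S then f v else 0)"
  using assms by (simp add: sum.inter_restrict[symmetric] Int_absorb1)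

lemma cut_weight_eq:
  assumes "A \<in> carrier_mat n n" "S \<subseteq> {..<n}"
  shows "cut_weight A S = (\<Sum>u<n. \<Sum>v<n. A $$ (u, v) * (if u \<in> S \<and> v \<notin> S then 1 else 0))"
proof -
  have "dim_row A = n" using assms by simp
  then have "cut_weight A S = (\<Sum>u<n. if u \<in> S then \<Sum>v<n. if v \<in> {..<n} - S then A $$ (u, v) else 0 else 0)"
    unfolding cut_weight_def using assms(2)
    by (simp only: sum_subset_eq[OF finite_lessThan assms(2)] sum_subset_eq[OF finite_lessThan Diff_subset])
  also have "\<dots> = (\<Sum>u<n. \<Sum>v<n. A $$ (u, v) * (if u \<in> S \<and> v \<notin> S then 1 else 0))"
    by (intro sum.cong refl) (auto intro!: sum.cong)
  finally show ?thesis .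
qed

lemma volume_eq:
  assumes "S \<subseteq> {..<n}"
  shows "volume A S = (\<Sum>u<n. \<Sum>v<n. A $$ (u, v) * (if u \<in> S \<and> v \<in> S then 1 else 0))"
proof -
  have "volume A S = (\<Sum>u<n. if u \<in> S then \<Sum>v<n. if v \<in> S then A $$ (u, v) else 0 else 0)"
    unfolding volume_def by (simp only: sum_subset_eq[OF finite_lessThan assms])
  also have "\<dots> = (\<Sum>u<n. \<Sum>v<n. A $$ (u, v) * (if u \<in> S \<and> v \<in> S then 1 else 0))"
    by (intro sum.cong refl) (auto intro!: sum.cong)
  finally show ?thesis .
qed

lemma ring_of_cliques_symmetric:
  assumes "u < b * q" "v < b * q"
  shows "ring_of_cliques b q $$ (u, v) = ring_of_cliques b q $$ (v, u)"
proof -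
  have b: "0 < b" using assms by (cases b) auto
  have "u div b < q" "v div b < q" using assms by (simp_all add: less_mult_imp_div_less mult.commute)
  moreover have "u mod b < b" "v mod b < b" using b by auto
  ultimately show ?thesis
    using ring_of_cliques_entry[of "u div b" q "u mod b" b "v div b" "v mod b"]
      ring_of_cliques_entry[of "v div b" q "v mod b" b "u div b" "u mod b"] by auto
qed

lemma ring_of_cliques_nonneg:
  assumes "u < b * q" "v < b * q"
  shows "0 \<le> ring_of_cliques b q $$ (u, v)"
proof -
  have b: "0 < b" using assms by (cases b) auto
  have "u div b < q" "v div b < q" using assms by (simp_all add: less_mult_imp_div_less mult.commute)
  moreover have "u mod b < b" "v mod b < b" using b by auto
  ultimately show ?thesis
    using ring_of_cliques_entry[of "u div b" q "u mod b" b "v div b" "v mod b"] by auto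
qed

text \<open>Upper sets of \<open>- y\<close> are complements of upper sets of \<open>y\<close>; this
  is what makes the problem symmetric under negation.\<close>

lemma conductance_complement:
  assumes A: "A \<in> carrier_mat n n" and sym: "\<And>u v. u < n \<Longrightarrow> v < n \<Longrightarrow> A $$ (u, v) = A $$ (v, u)"
    and S: "S \<subseteq> {..<n}"
  shows "conductance A ({..<n} - S) = conductance A S"
proof -
  have "cut_weight A ({..<n} - S) = (\<Sum>u<n. \<Sum>v<n. A $$ (u, v) * (if u \<notin> S \<and> v \<in> S then 1 else 0))"
    unfolding cut_weight_eq[OF A Diff_subset] by (intro sum.cong refl) auto
  also have "\<dots> = (\<Sum>u<n. \<Sum>v<n. A $$ (v, u) * (if v \<notin> S \<and> u \<in> S then 1 else 0))"
    by (rule sum.swap)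
  also have "\<dots> = cut_weight A S"
    unfolding cut_weight_eq[OF A S] using sym by (intro sum.cong refl) auto
  finally have "cut_weight A ({..<n} - S) = cut_weight A S" .
  moreover have "{..<n} - ({..<n} - S) = S" using S by auto
  moreover have "dim_row A = n" using A by simp
  ultimately show ?thesis
    unfolding conductance_def Let_def by (simp add: min.commute)
qed

text \<open>A set strictly above its complement is the sweep cut at the largest value attained
  outside of it, since sweep cuts are defined by a strict inequality.\<close>

lemma sweep_conductance_le_upper_set:
  assumes A: "dim_row A = n" and y: "dim_vec y = n"
    and S: "S \<subseteq> {..<n}" "S \<noteq> {}" "S \<noteq> {..<n}"
    and upper: "\<And>u v. u \<in> S \<Longrightarrow> v < n \<Longrightarrow> v \<notin> S \<Longrightarrow> y $ v < y $ u"
  shows "sweep_conductance A y \<le> conductance A S"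
proof -
  let ?Y = "(\<lambda>v. y $ v) ` ({..<n} - S)"
  define t where "t = Max ?Y"
  have "?Y \<noteq> {}" "finite ?Y" using S by auto
  then have "t \<in> ?Y" and max: "\<And>v. v < n \<Longrightarrow> v \<notin> S \<Longrightarrow> y $ v \<le> t"
    unfolding t_def by (auto intro!: Max_in Max_ge)
  then have "sweep_cut y t = S"
    using S(1) y upper unfolding sweep_cut_def by (force simp: not_less)
  then show ?thesis
    unfolding sweep_conductance_def using S y
    by (intro INF_lower2[of t]) (auto simp: proper_thresholds_def)
qed

lemma conductance_le:
  assumes "volume A S > 0" "volume A ({..<dim_row A} - S) > 0"
    and "cut_weight A S \<le> c * volume A S" "cut_weight A S \<le> c * volume A ({..<dim_row A} - S)"
  shows "conductance A S \<le> ereal c"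
  using assms by (auto simp: conductance_def Let_def min_def divide_le_eq)

text \<open>Layer-cake integration of the assumption over all thresholds: an edge lies inside the
  level set for a set of thresholds of length \<open>min (g u) (g v)\<close>, and it is cut, in the
  direction from \<open>u\<close> to \<open>v\<close>, for a set of length
  \<open>max 0 (g u - g v)\<close>.\<close>

lemma threshold_averaging:
  fixes g :: "nat \<Rightarrow> real"
  assumes A: "A \<in> carrier_mat n n" and g: "\<And>u. u < n \<Longrightarrow> 0 \<le> g u"
    and cut: "\<And>t. 0 \<le> t \<Longrightarrow> c * volume A {u. u < n \<and> t < g u} \<le> cut_weight A {u. u < n \<and> t < g u}"
  shows "c * (\<Sum>u<n. \<Sum>v<n. A $$ (u, v) * min (g u) (g v))
    \<le> (\<Sum>u<n. \<Sum>v<n. A $$ (u, v) * max 0 (g u - g v))"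
proof -
  let ?V = "\<lambda>t. c * (\<Sum>u<n. \<Sum>v<n. A $$ (u, v) * indicator {0..<min (g u) (g v)} t)"
  let ?C = "\<lambda>t. \<Sum>u<n. \<Sum>v<n. A $$ (u, v) * indicator {g v..<g u} t :: real"
  have "?V t \<le> ?C t" for t
  proof (cases "0 \<le> t")
    case True
    have sub: "{u. u < n \<and> t < g u} \<subseteq> {..<n}" by auto
    have "?V t = c * volume A {u. u < n \<and> t < g u}"
      unfolding volume_eq[OF sub] using True by (intro arg_cong[of _ _ "\<lambda>x. c * x"] sum.cong refl) (auto simp: indicator_def)
    moreover have "?C t = cut_weight A {u. u < n \<and> t < g u}"
      unfolding cut_weight_eq[OF A sub] by (intro sum.cong refl) (auto simp: indicator_def)
    ultimately show ?thesis using cut[OF True] by linarith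
  \<comment> \<open>At negative thresholds both integrands vanish, because \<open>g\<close> is
    nonnegative.\<close>
  next
    case False
    then have "indicator {g v..<g u} t = (0::real)" if "u < n" "v < n" for u v
      using g[OF that(2)] by (auto simp: indicator_def)
    with False show ?thesis by simp
  qed
  moreover have ind: "has_bochner_integral lborel (indicator {l..<h} :: real \<Rightarrow> real) (max 0 (h - l))" for l h
    using has_bochner_integral_real_indicator[of "{l..<h}" lborel] by (cases "l \<le> h") auto
  then have V: "has_bochner_integral lborel ?V (c * (\<Sum>u<n. \<Sum>v<n. A $$ (u, v) * max 0 (min (g u) (g v) - 0)))"
    by (intro has_bochner_integral_mult_right has_bochner_integral_sum)
  from ind have C: "has_bochner_integral lborel ?C (\<Sum>u<n. \<Sum>v<n. A $$ (u, v) * max 0 (g u - g v))"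
    by (intro has_bochner_integral_mult_right has_bochner_integral_sum)
  ultimately have "c * (\<Sum>u<n. \<Sum>v<n. A $$ (u, v) * max 0 (min (g u) (g v) - 0))
    \<le> (\<Sum>u<n. \<Sum>v<n. A $$ (u, v) * max 0 (g u - g v))"
    using integral_mono[of lborel ?V ?C] V C unfolding has_bochner_integral_iff by metis
  moreover have "max 0 (min (g u) (g v) - 0) = min (g u) (g v)" if "u < n" "v < n" for u v
    using g[OF that(1)] g[OF that(2)] by (simp add: max_def)
  ultimately show ?thesis by simp
qed

text \<open>Subadditivity of Lebesgue measure. It is applied in the contrapositive: intervals of
  small total length leave some threshold uncovered.\<close>

lemma interval_cover_length:
  fixes w L :: "'a \<Rightarrow> real"
  assumes "finite I" and L: "\<And>k. k \<in> I \<Longrightarrow> 0 \<le> L k" and "l \<le> h"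
    and cov: "\<And>t. l \<le> t \<Longrightarrow> t < h \<Longrightarrow> \<exists>k\<in>I. \<bar>t - w k\<bar> \<le> L k"
  shows "h - l \<le> (\<Sum>k\<in>I. 2 * L k)"
proof -
  have "h - l = measure lborel {l..<h}" using assms by simp
  also have "\<dots> \<le> measure lborel (\<Union>k\<in>I. {w k - L k..w k + L k})"
  proof (rule measure_mono_fmeasurable)
    show "{l..<h} \<subseteq> (\<Union>k\<in>I. {w k - L k..w k + L k})"
      using cov by (fastforce simp: abs_le_iff)
    show "(\<Union>k\<in>I. {w k - L k..w k + L k}) \<in> fmeasurable lborel"
      using \<open>finite I\<close> by (intro fmeasurable.finite_UN fmeasurableI) (auto simp: emeasure_lborel_Icc_eq)
  qed auto
  also have "\<dots> \<le> (\<Sum>k\<in>I. measure lborel {w k - L k..w k + L k})"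
    using \<open>finite I\<close> by (intro measure_UNION_le) auto
  also have "\<dots> = (\<Sum>k\<in>I. 2 * L k)"
    using L by (intro sum.cong refl) simp
  finally show ?thesis .
qed

section \<open>Unions of whole cliques\<close>

lemma real_choose_two: "real (b choose 2) = real b * (real b - 1) / 2"
  by (cases b) (auto simp: choose_two real_of_nat_div field_simps)

text \<open>Every cut edge is a ring edge with exactly one end in \<open>K\<close>, and each clique
  meets two ring edges; so the cut is at most twice the number of cliques on either side, while each
  clique contributes volume \<open>b * (b - 1)\<close> to its own side.\<close>

lemma conductance_clique_union_le:
  assumes b: "b \<ge> 2" and q: "q \<ge> 3" and K: "K \<subseteq> {..<q}" "K \<noteq> {}" "K \<noteq> {..<q}"
  shows "conductance (ring_of_cliques b q) {u. u < b * q \<and> u div b \<in> K} \<le> ereal (2 / (real b * (real b - 1)))"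
proof -
  let ?A = "ring_of_cliques b q" and ?\<beta> = "real b * (real b - 1)"
  define s where "s K = {u. u < b * q \<and> u div b \<in> K}" for K
  have sub: "s K \<subseteq> {..<b * q}" for K by (auto simp: s_def)
  have mem: "k * b + i \<in> s K \<longleftrightarrow> k \<in> K" if "k < q" "i < b" for k i K
    using block_index_less[OF that] that by (auto simp: block_index s_def)
  have mem0: "k * b \<in> s K \<longleftrightarrow> k \<in> K" if "k < q" for k K
    using mem[OF that, of 0] b by simp
  have Sq: "Suc k mod q < q" for k using q by simp
  have \<beta>: "(\<Sum>i<b. \<Sum>j<b. if i = j then 0 else (1::real)) = ?\<beta>"
  proof -
    have "(\<Sum>j<b. if i = j then 0 else (1::real)) = real b - 1" if "i < b" for i
    proof -
      have "(\<Sum>j<b. if i = j then 0 else (1::real)) = (\<Sum>j<b. 1 - (if i = j then 1 else 0))"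
        by (intro sum.cong) auto
      then show ?thesis using that by (simp add: sum_subtractf)
    qed
    then show ?thesis by simp
  qed
  have count: "(\<Sum>k<q. if k \<in> K then c else 0) = c * real (card K)" if "K \<subseteq> {..<q}" for K and c :: real
  proof -
    have "(\<Sum>k<q. if k \<in> K then c else 0) = (\<Sum>k\<in>K. c)"
      by (rule sum_subset_eq[symmetric]) (use that in auto)
    then show ?thesis by simp
  qed
  \<comment> \<open>Only an inequality: ring edges between neighbouring cliques of \<open>K\<close>
    add further volume.\<close>
  have vol: "?\<beta> * real (card K) \<le> volume ?A (s K)" if K: "K \<subseteq> {..<q}" for K
  proof -
    have "(\<Sum>i<b. \<Sum>j<b. if i = j then 0 else (if k * b + i \<in> s K \<and> k * b + j \<in> s K then 1 else 0))
      = (if k \<in> K then ?\<beta> else 0)" if k: "k < q" for k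
    proof -
      have "(\<Sum>i<b. \<Sum>j<b. if i = j then 0 else (if k * b + i \<in> s K \<and> k * b + j \<in> s K then 1 else 0))
        = (\<Sum>i<b. \<Sum>j<b. if i = j then 0 else (if k \<in> K then (1::real) else 0))"
        using mem[OF k] by (intro sum.cong refl) simp
      then show ?thesis using \<beta> by (simp cong: if_cong)
    qed
    then have "(\<Sum>k<q. if k \<in> K then ?\<beta> else 0) \<le> volume ?A (s K)"
      unfolding volume_eq[OF sub] using b
      by (subst ring_of_cliques_sum[OF q]) (auto intro!: sum_nonneg add_nonneg_nonneg)
    then show ?thesis
      unfolding count[OF K] .
  qed
  have cut: "cut_weight ?A (s K) = (\<Sum>k<q. (if k \<in> K \<and> Suc k mod q \<notin> K then 1 else 0)
      + (if Suc k mod q \<in> K \<and> k \<notin> K then 1 else 0))"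
    unfolding cut_weight_eq[OF ring_of_cliques_carrier sub] using b q
    by (subst ring_of_cliques_sum[OF q]) (auto simp: mem mem0 Sq intro!: sum.neutral sum.cong)
  have twice: "(\<Sum>k<q. (if k \<in> K then 1 else 0) + (if Suc k mod q \<in> K then 1 else 0)) = 2 * real (card K)"
    if "K \<subseteq> {..<q}" for K
    using sum_cyclic_Suc[of q "\<lambda>k. if k \<in> K then 1 else 0 :: real"] q count[OF that, of 1]
    by (simp add: sum.distrib)
  have cut1: "cut_weight ?A (s K) \<le> 2 * real (card K)"
    unfolding cut twice[OF K(1), symmetric] by (intro sum_mono) auto
  have cut2: "cut_weight ?A (s K) \<le> 2 * real (card ({..<q} - K))"
    unfolding cut twice[OF Diff_subset, symmetric] using Sq by (intro sum_mono) auto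
  have compl: "{..<dim_row ?A} - s K = s ({..<q} - K)"
    by (auto simp: s_def less_mult_imp_div_less mult.commute)
  have pos: "?\<beta> > 0" using b by simp
  have "finite K" using K(1) finite_subset by blast
  then have cardpos: "card K > 0" "card ({..<q} - K) > 0"
    using K by (auto simp: card_gt_0_iff)
  have fin: "x \<le> 2 / ?\<beta> * V" if "x \<le> 2 * real m" "?\<beta> * real m \<le> V" for x V m
  proof -
    have "2 * real m = 2 / ?\<beta> * (?\<beta> * real m)" using pos by auto
    also have "\<dots> \<le> 2 / ?\<beta> * V" using that(2) pos by (intro mult_left_mono) auto
    finally show ?thesis using that(1) by linarith
  qed
  have volpos: "0 < volume ?A (s K)" if "K \<subseteq> {..<q}" "card K > 0" for K
    using vol[OF that(1)] mult_pos_pos[OF pos, of "real (card K)"] that(2) by linarith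
  have "conductance ?A (s K) \<le> ereal (2 / ?\<beta>)"
  proof (rule conductance_le; (unfold compl)?)
    show "0 < volume ?A (s K)" "0 < volume ?A (s ({..<q} - K))"
      using volpos K(1) cardpos by auto
    show "cut_weight ?A (s K) \<le> 2 / ?\<beta> * volume ?A (s K)"
      by (rule fin[OF cut1 vol[OF K(1)]])
    show "cut_weight ?A (s K) \<le> 2 / ?\<beta> * volume ?A (s ({..<q} - K))"
      by (rule fin[OF cut2 vol[OF Diff_subset]])
  qed
  then show ?thesis by (simp only: s_def)
qed

section \<open>The potential function\<close>

text \<open>For nonnegative \<open>u\<close> this is
  \<open>2 * p * (sqrt (u + \<tau>\<^sup>2) - \<tau>) - u\<close>, the integral from 0 to
  \<open>u\<close> of the density \<open>p / sqrt (t + \<tau>\<^sup>2) - 1\<close>. The density is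
  below \<open>p / \<tau>\<close> and changes sign at \<open>p\<^sup>2 - \<tau>\<^sup>2\<close>,
  whence the range conditions below. The completed square makes monotonicity on that range
  immediate.\<close>

definition potential :: "real \<Rightarrow> real \<Rightarrow> real \<Rightarrow> real" where
  "potential p \<tau> u = (p - \<tau>)\<^sup>2 - (p - sqrt (max 0 u + \<tau>\<^sup>2))\<^sup>2"

lemma potential_eq_0: "0 < \<tau> \<Longrightarrow> u \<le> 0 \<Longrightarrow> potential p \<tau> u = 0"
  by (simp add: potential_def)

lemma potential_mono:
  assumes \<tau>: "0 < \<tau>" "\<tau> \<le> p" and uv: "u \<le> v" "v \<le> p\<^sup>2 - \<tau>\<^sup>2"
  shows "potential p \<tau> u \<le> potential p \<tau> v"
proof -
  have "\<tau>\<^sup>2 \<le> p\<^sup>2" using \<tau> by (intro power_mono) auto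
  then have "sqrt (max 0 v + \<tau>\<^sup>2) \<le> sqrt (p\<^sup>2)" using uv by (intro real_sqrt_le_mono) auto
  then have 1: "sqrt (max 0 v + \<tau>\<^sup>2) \<le> p" using \<tau> by simp
  have 2: "sqrt (max 0 u + \<tau>\<^sup>2) \<le> sqrt (max 0 v + \<tau>\<^sup>2)" using uv by (intro real_sqrt_le_mono) auto
  have "(p - sqrt (max 0 v + \<tau>\<^sup>2))\<^sup>2 \<le> (p - sqrt (max 0 u + \<tau>\<^sup>2))\<^sup>2"
    using 1 2 by (intro power_mono) auto
  then show ?thesis by (simp add: potential_def)
qed

lemma potential_nonneg:
  assumes "0 < \<tau>" "\<tau> \<le> p" "u \<le> p\<^sup>2 - \<tau>\<^sup>2"
  shows "0 \<le> potential p \<tau> u"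
  using potential_mono[OF assms(1,2), of "min 0 u" u] assms potential_eq_0[of \<tau> "min 0 u" p] by simp

lemma potential_lipschitz:
  assumes \<tau>: "0 < \<tau>" "\<tau> \<le> p" and uv: "u \<le> p\<^sup>2 - \<tau>\<^sup>2" "v \<le> p\<^sup>2 - \<tau>\<^sup>2"
  shows "\<bar>potential p \<tau> u - potential p \<tau> v\<bar> \<le> p / \<tau> * \<bar>u - v\<bar>"
proof -
  have *: "potential p \<tau> v - potential p \<tau> u \<le> p / \<tau> * (v - u)" if "u \<le> v" for u v
  proof -
    define a a' where "a = sqrt (max 0 u + \<tau>\<^sup>2)" and "a' = sqrt (max 0 v + \<tau>\<^sup>2)"
    note a_def = this
    have a: "\<tau> \<le> a" "\<tau> \<le> a'" using \<tau> by (auto simp: a_def intro!: real_le_rsqrt)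
    have sq: "a\<^sup>2 = max 0 u + \<tau>\<^sup>2" "a'\<^sup>2 = max 0 v + \<tau>\<^sup>2" by (simp_all add: a_def)
    have le: "a \<le> a'" unfolding a_def using that by (intro real_sqrt_le_mono) auto
    have "(a' - a) * (2 * \<tau>) \<le> (a' - a) * (a' + a)"
      using a le by (intro mult_left_mono) auto
    also have "\<dots> = a'\<^sup>2 - a\<^sup>2" by (simp add: power2_eq_square power3_eq_cube algebra_simps)
    also have "\<dots> \<le> v - u" unfolding sq using that by auto
    finally have d: "a' - a \<le> (v - u) / (2 * \<tau>)" using \<tau> by (simp add: field_simps)
    have "potential p \<tau> v - potential p \<tau> u = (a' - a) * (2 * p - (a + a'))"
      unfolding potential_def a_def[symmetric] by (simp add: power2_eq_square power3_eq_cube algebra_simps)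
    also have "\<dots> \<le> (a' - a) * (2 * p)"
      using a le \<tau> by (intro mult_left_mono) auto
    also have "\<dots> \<le> (v - u) / (2 * \<tau>) * (2 * p)"
      using d \<tau> by (intro mult_right_mono) auto
    finally show ?thesis using \<tau> by (simp add: field_simps)
  qed
  show ?thesis
  proof (cases "u \<le> v")
    case True
    then show ?thesis using *[OF True] potential_mono[OF \<tau> True uv(2)] by simp
  next
    case False
    then show ?thesis using *[of v u] potential_mono[OF \<tau> _ uv(1), of v] by simp
  qed
qed

text \<open>The square root in the potential is tuned to the extreme case \<open>E * (1 - \<sigma>) = 2\<close>,
  in which the terms of order \<open>sqrt w\<close> cancel and the correction \<open>- w\<close> provides the gain.\<close>

lemma potential_gain:
  assumes \<tau>: "0 < \<tau>" "\<tau> \<le> p" and w: "w \<le> p\<^sup>2 - \<tau>\<^sup>2"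
    and \<sigma>: "0 \<le> \<sigma>" "\<sigma> \<le> 1" and E: "0 \<le> E" "E * (1 - \<sigma>) \<le> 2"
  shows "2 * \<sigma> * max 0 w - 4 * p * \<tau>
    \<le> 2 * potential p \<tau> w - E * (potential p \<tau> w - potential p \<tau> (\<sigma>\<^sup>2 * w))"
proof (cases "w \<le> 0")
  case True
  then show ?thesis using \<tau> by (simp add: potential_eq_0 mult_nonneg_nonpos)
next
  case False
  define v where "v = sqrt w"
  have v: "0 < v" "w = v\<^sup>2" using False by (auto simp: v_def)
  have vp: "v \<le> p" unfolding v_def using w \<tau> False zero_le_power2[of \<tau>] by (intro real_le_lsqrt) linarith+
  define a k where "a = sqrt (w + \<tau>\<^sup>2)" and "k = sqrt (\<sigma>\<^sup>2 * w + \<tau>\<^sup>2)"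
  note ak = this
  have sq: "a\<^sup>2 = w + \<tau>\<^sup>2" "k\<^sup>2 = \<sigma>\<^sup>2 * w + \<tau>\<^sup>2" using False by (simp_all add: ak)
  have av: "v \<le> a" using False by (simp add: v_def ak)
  have kv: "\<sigma> * v \<le> k"
    unfolding ak by (rule real_le_rsqrt) (simp add: v power_mult_distrib)
  have "\<sigma>\<^sup>2 * w \<le> 1 * w" using \<sigma> False by (intro mult_right_mono) (auto simp: power_le_one)
  then have ka: "k \<le> a" by (simp add: ak)
  \<comment> \<open>The shift by \<tau> can only shrink the drop of the square root: it keeps the
    difference of the squares and increases the sum \<open>a + k\<close>.\<close>
  have "(a - k) * (v + \<sigma> * v) \<le> (a - k) * (a + k)"
    using av kv ka by (intro mult_left_mono) auto
  also have "\<dots> = a\<^sup>2 - k\<^sup>2" by (simp add: power2_eq_square power3_eq_cube algebra_simps)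
  also have "\<dots> = (1 - \<sigma>) * v * (v + \<sigma> * v)" unfolding sq unfolding v(2) by (simp add: power2_eq_square power3_eq_cube algebra_simps)
  finally have d: "a - k \<le> (1 - \<sigma>) * v"
    using v(1) \<sigma> by (simp add: mult_le_cancel_right add_pos_nonneg)
  have F: "potential p \<tau> w = 2 * p * (a - \<tau>) - w"
    using False sq(1) unfolding potential_def ak by (simp add: power2_diff algebra_simps)
  have K: "potential p \<tau> (\<sigma>\<^sup>2 * w) = 2 * p * (k - \<tau>) - \<sigma>\<^sup>2 * w"
    using False sq(2) unfolding potential_def ak by (simp add: power2_diff algebra_simps)
  have p: "0 < p" using \<tau> by simp
  have "potential p \<tau> w - potential p \<tau> (\<sigma>\<^sup>2 * w) = 2 * p * (a - k) - (1 - \<sigma>\<^sup>2) * v\<^sup>2"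
    unfolding F K unfolding v(2) by (simp add: power2_eq_square power3_eq_cube algebra_simps)
  also have "\<dots> \<le> 2 * p * ((1 - \<sigma>) * v) - (1 - \<sigma>\<^sup>2) * v\<^sup>2"
    using d p by simp
  also have "\<dots> = (1 - \<sigma>) * (v * (2 * p - (1 + \<sigma>) * v))" by (simp add: power2_eq_square power3_eq_cube algebra_simps)
  finally have "E * (potential p \<tau> w - potential p \<tau> (\<sigma>\<^sup>2 * w)) \<le> E * ((1 - \<sigma>) * (v * (2 * p - (1 + \<sigma>) * v)))"
    using E by (intro mult_left_mono)
  also have "\<dots> = E * (1 - \<sigma>) * (v * (2 * p - (1 + \<sigma>) * v))" by simp
  also have "\<dots> \<le> 2 * (v * (2 * p - (1 + \<sigma>) * v))"
  proof (intro mult_right_mono E mult_nonneg_nonneg)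
    have "(1 + \<sigma>) * v \<le> 2 * p" using \<sigma> vp v by (intro mult_mono) auto
    then show "0 \<le> 2 * p - (1 + \<sigma>) * v" by simp
  qed (use v in auto)
  finally have 1: "E * (potential p \<tau> w - potential p \<tau> (\<sigma>\<^sup>2 * w)) \<le> 2 * (v * (2 * p - (1 + \<sigma>) * v))" .
  \<comment> \<open>The only place where the shift costs something: \<open>a - \<tau>\<close> is
    estimated by \<open>v - \<tau>\<close>, and twice the factor \<open>2 * p\<close> turns \<tau>
    into the loss \<open>4 * p * \<tau>\<close>.\<close>
  have "2 * p * v \<le> 2 * p * a" using av p by (intro mult_left_mono) auto
  then have "2 * potential p \<tau> w \<ge> 4 * p * (v - \<tau>) - 2 * v\<^sup>2"
    unfolding F unfolding v(2) by (simp add: algebra_simps)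
  with 1 have "2 * potential p \<tau> w - E * (potential p \<tau> w - potential p \<tau> (\<sigma>\<^sup>2 * w))
    \<ge> 4 * p * (v - \<tau>) - 2 * v\<^sup>2 - 2 * (v * (2 * p - (1 + \<sigma>) * v))" by linarith
  also have "4 * p * (v - \<tau>) - 2 * v\<^sup>2 - 2 * (v * (2 * p - (1 + \<sigma>) * v)) = 2 * \<sigma> * w - 4 * p * \<tau>"
    unfolding v(2) by (simp add: power2_eq_square power3_eq_cube algebra_simps)
  finally show ?thesis using False by simp
qed

text \<open>The coefficient \<open>b - 3 + 8 / b\<close> multiplies the drop of the potential from
  \<open>w\<close> to \<open>\<kappa> * w\<close>: the cut inside the clique contributes
  \<open>b - 1\<close>, the ring edges \<open>- 2\<close>, and the volume \<open>8 / b\<close>. The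
  claim amounts to comparing \<open>sqrt k\<close> with a rational function of \<open>b\<close>,
  hence, after squaring, to a polynomial inequality.\<close>

lemma corner_ratio_bound:
  fixes b :: real
  assumes b: "2 \<le> b" and k: "(b - 1) / (b + 3) \<le> k"
  shows "0 \<le> b - 3 + 8 / b" "(b - 3 + 8 / b) * (1 - sqrt k) \<le> 2"
proof -
  have D: "b\<^sup>2 - 3 * b + 8 > 0"
    using zero_le_power2[of "b - 3 / 2"] by (simp add: power2_eq_square algebra_simps)
  have N: "b\<^sup>2 - 5 * b + 8 > 0"
    using zero_le_power2[of "b - 5 / 2"] by (simp add: power2_eq_square algebra_simps)
  have E: "b - 3 + 8 / b = (b\<^sup>2 - 3 * b + 8) / b"
    using b by (simp add: field_simps power2_eq_square)
  show "0 \<le> b - 3 + 8 / b" unfolding E using b D by simp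
  \<comment> \<open>In this variable all coefficients of the difference polynomial are
    positive.\<close>
  define t where "t = b - 2"
  have t: "0 \<le> t" "b = t + 2" using b by (auto simp: t_def)
  have "(b - 1) * (b\<^sup>2 - 3 * b + 8)\<^sup>2 - (b\<^sup>2 - 5 * b + 8)\<^sup>2 * (b + 3) = 4 * (5 * t ^ 3 + t\<^sup>2 + 16 * t + 4)"
    unfolding t(2) by (simp add: power2_eq_square power3_eq_cube algebra_simps)
  then have "(b\<^sup>2 - 5 * b + 8)\<^sup>2 * (b + 3) \<le> (b - 1) * (b\<^sup>2 - 3 * b + 8)\<^sup>2"
    using t(1) by (smt (verit) zero_le_power mult_nonneg_nonneg)
  then have "((b\<^sup>2 - 5 * b + 8) / (b\<^sup>2 - 3 * b + 8))\<^sup>2 \<le> (b - 1) / (b + 3)"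
    using b D by (simp add: power_divide divide_le_eq le_divide_eq field_simps)
  then have "(b\<^sup>2 - 5 * b + 8) / (b\<^sup>2 - 3 * b + 8) \<le> sqrt k"
    using k by (intro real_le_rsqrt) auto
  then have "1 - sqrt k \<le> 1 - (b\<^sup>2 - 5 * b + 8) / (b\<^sup>2 - 3 * b + 8)" by simp
  also have "\<dots> = 2 * b / (b\<^sup>2 - 3 * b + 8)" using D by (simp add: field_simps)
  finally have "(b\<^sup>2 - 3 * b + 8) / b * (1 - sqrt k) \<le> (b\<^sup>2 - 3 * b + 8) / b * (2 * b / (b\<^sup>2 - 3 * b + 8))"
    using b D by (intro mult_left_mono) auto
  also have "\<dots> = 2"
  proof -
    have "X / b * (2 * b / X) = 2" if "X > 0" for X
      using that b by simp
    then show ?thesis using D .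
  qed
  finally show "(b - 3 + 8 / b) * (1 - sqrt k) \<le> 2" unfolding E .
qed

section \<open>Near eigenvectors\<close>

text \<open>Here \<open>y k i\<close> and \<open>r k i\<close> are the entries of the rescaled
  vector and of the residual at vertex \<open>i\<close> of clique \<open>k\<close>.
  \<open>inner\<close> and \<open>corner\<close> are the rows of the residual equation, multiplied
  by the root of the degree; \<open>mean\<close> and \<open>unit\<close> express \<open>x\<close>
  through \<open>y\<close>. The bound in \<open>resid\<close> is the square of
  \<open>C / (q * sqrt n)\<close> for \<open>n = b * q\<close>.\<close>

locale near_eigenvector =
  fixes b q :: nat and \<mu> :: real and y r :: "nat \<Rightarrow> nat \<Rightarrow> real"
  assumes b: "2 \<le> b" and q: "3 \<le> q"
    and mu_le: "\<mu> \<le> 1" and mu_ge: "(1 - \<mu>) * ((real b - 1) * (real b + 3)) \<le> 4"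
    and inner: "\<And>k i. k < q \<Longrightarrow> 1 \<le> i \<Longrightarrow> i < b \<Longrightarrow>
      (\<Sum>j<b. y k j) - (1 + \<mu> * (real b - 1)) * y k i = sqrt (real b - 1) * r k i"
    and corner: "\<And>k. k < q \<Longrightarrow>
      (\<Sum>j<b. y k j) + y (Suc k mod q) 0 + y ((k + (q - 1)) mod q) 0
        - (1 + \<mu> * (real b + 1)) * y k 0 = sqrt (real b + 1) * r k 0"
    and mean: "(\<Sum>k<q. sqrt (real b - 1) * (\<Sum>i=1..<b. y k i) + sqrt (real b + 1) * y k 0) = 0"
    and unit: "(\<Sum>k<q. (real b - 1) * (\<Sum>i=1..<b. (y k i)\<^sup>2) + (real b + 1) * (y k 0)\<^sup>2) = 1"
    and resid: "(\<Sum>k<q. \<Sum>i<b. (r k i)\<^sup>2) \<le> (1 / (18 * 10 ^ 12))\<^sup>2 / (real q ^ 3 * real b)"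
begin

lemma negated: "near_eigenvector b q \<mu> (\<lambda>k i. - y k i) (\<lambda>k i. - r k i)"
proof
  show "(\<Sum>j<b. - y k j) - (1 + \<mu> * (real b - 1)) * - y k i = sqrt (real b - 1) * - r k i"
    if "k < q" "1 \<le> i" "i < b" for k i
    using inner[OF that] by (simp add: sum_negf)
  show "(\<Sum>j<b. - y k j) + - y (Suc k mod q) 0 + - y ((k + (q - 1)) mod q) 0
        - (1 + \<mu> * (real b + 1)) * - y k 0 = sqrt (real b + 1) * - r k 0" if "k < q" for k
    using corner[OF that] by (simp add: sum_negf)
  have "(\<Sum>k<q. sqrt (real b - 1) * (\<Sum>i=1..<b. - y k i) + sqrt (real b + 1) * - y k 0)
    = - (\<Sum>k<q. sqrt (real b - 1) * (\<Sum>i=1..<b. y k i) + sqrt (real b + 1) * y k 0)"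
    by (simp add: sum_negf sum_subtractf sum.distrib)
  then show "(\<Sum>k<q. sqrt (real b - 1) * (\<Sum>i=1..<b. - y k i) + sqrt (real b + 1) * - y k 0) = 0"
    using mean by simp
qed (use b q mu_le mu_ge unit resid in auto)

section \<open>Clique values and deviations from them\<close>

definition "\<kappa> = 1 - (1 - \<mu>) * (real b - 1)"
definition "\<gamma> = real b - 1 + \<kappa>"
definition "w k = (\<Sum>j<b. y k j) / \<gamma>"
text \<open>Bounds for deviations: \<open>\<rho> k i\<close> for that of an inner vertex from
  \<open>w k\<close>, because \<gamma> is at least \<open>b - 1\<close>, and their sum
  \<open>P k\<close> for that of the corner from \<open>\<kappa> * w k\<close>.\<close>

definition "\<rho> k i = \<bar>r k i\<bar> / sqrt (real b - 1)"
definition "P k = (\<Sum>i=1..<b. \<rho> k i)"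

lemma real_b: "2 \<le> real b"
  using b by simp

lemma gamma_mu: "\<gamma> = 1 + \<mu> * (real b - 1)" "\<gamma> + 2 * \<mu> = 1 + \<mu> * (real b + 1)"
  by (simp_all add: \<gamma>_def \<kappa>_def algebra_simps)

lemma kappa_ge: "(real b - 1) / (real b + 3) \<le> \<kappa>"
proof -
  have "(1 - \<mu>) * (real b - 1) \<le> 4 / (real b + 3)"
    using mu_ge b by (simp add: field_simps)
  moreover have "(real b - 1) / (real b + 3) = 1 - 4 / (real b + 3)"
    using b by (simp add: field_simps)
  ultimately show ?thesis by (simp add: \<kappa>_def)
qed

lemma kappa_le: "\<kappa> \<le> 1"
  using mu_le b by (simp add: \<kappa>_def)

lemma kappa_fifth: "1 / 5 \<le> \<kappa>"
proof -
  have "1 / 5 \<le> (real b - 1) / (real b + 3)" using b by (simp add: field_simps)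
  then show ?thesis using kappa_ge by (rule order_trans)
qed

lemma mu_nonneg: "0 \<le> \<mu>"
proof (rule ccontr)
  assume "\<not> 0 \<le> \<mu>"
  then have "1 * 1 \<le> (1 - \<mu>) * (real b - 1)" using real_b by (intro mult_mono) auto
  also have "\<dots> \<le> 4 / 5" using kappa_fifth by (simp add: \<kappa>_def)
  finally show False by simp
qed

lemma gamma_ge: "real b - 1 \<le> \<gamma>" "real b / 2 \<le> \<gamma>" "0 < \<gamma>"
  using kappa_fifth b by (auto simp: \<gamma>_def)

lemma rho_nonneg: "0 \<le> \<rho> k i" and P_nonneg: "0 \<le> P k"
  using b by (auto simp: \<rho>_def P_def intro!: sum_nonneg)

lemma sum_split_corner: "(\<Sum>j<b. f j) = f 0 + (\<Sum>j=1..<b. f j :: real)"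
  using b by (simp add: sum_lessThan_first)

lemma inner_deviation:
  assumes "k < q" "1 \<le> i" "i < b"
  shows "\<bar>y k i - w k\<bar> \<le> \<rho> k i"
proof -
  have "y k i - w k = - (sqrt (real b - 1) * r k i / \<gamma>)"
  proof -
    have "(\<Sum>j<b. y k j) = \<gamma> * w k" using gamma_ge(3) by (simp add: w_def)
    then have "\<gamma> * (y k i - w k) = - (sqrt (real b - 1) * r k i)"
      using inner[OF assms, folded gamma_mu(1)] by (simp add: algebra_simps)
    then show ?thesis using gamma_ge(3) by (simp add: field_simps)
  qed
  then have "\<bar>y k i - w k\<bar> = sqrt (real b - 1) * \<bar>r k i\<bar> / \<gamma>"
    using gamma_ge(3) b by (simp add: abs_mult)
  also have "\<dots> \<le> sqrt (real b - 1) * \<bar>r k i\<bar> / (real b - 1)"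
    using gamma_ge b by (intro divide_left_mono) auto
  also have "\<dots> = \<rho> k i"
    using b by (simp add: \<rho>_def field_simps real_sqrt_mult_self flip: power2_eq_square)
  finally show ?thesis .
qed

text \<open>Bookkeeping: the clique sum is \<open>\<gamma> * w k\<close> and \<gamma> is
  \<open>b - 1 + \<kappa>\<close>, so what the inner vertices miss from \<open>w k\<close> reappears
  at the corner.\<close>

lemma corner_value: "y k 0 = \<kappa> * w k + (\<Sum>i=1..<b. w k - y k i)"
proof -
  have "(\<Sum>j<b. y k j) = \<gamma> * w k" using gamma_ge(3) by (simp add: w_def)
  then show ?thesis
    using b by (simp add: sum_split_corner sum_subtractf \<gamma>_def of_nat_diff algebra_simps)
qed

lemma deviation_sum: "k < q \<Longrightarrow> \<bar>\<Sum>i=1..<b. w k - y k i\<bar> \<le> P k"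
  unfolding P_def using inner_deviation
  by (intro order_trans[OF sum_abs] sum_mono) (auto simp: abs_minus_commute)

lemma corner_deviation: "k < q \<Longrightarrow> \<bar>y k 0 - \<kappa> * w k\<bar> \<le> P k"
  using deviation_sum[of k] corner_value[of k] by simp

lemma residual_le: "k < q \<Longrightarrow> (\<Sum>i<b. (r k i)\<^sup>2) \<le> (1 / (18 * 10 ^ 12))\<^sup>2 / (real q ^ 3 * real b)"
  using member_le_sum[of k "{..<q}" "\<lambda>k. \<Sum>i<b. (r k i)\<^sup>2"] resid by (simp add: sum_nonneg)

text \<open>Cauchy-Schwarz over the \<open>q * (b - 1)\<close> inner vertices; the factor
  \<open>b - 1\<close> cancels against the weight in \<rho>.\<close>

lemma P_sum_le: "(\<Sum>k<q. P k) \<le> 1 / (18 * 10 ^ 12) / (real q * sqrt (real b))"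
proof (rule power2_le_imp_le)
  have "(\<Sum>k<q. P k) = (\<Sum>(k, i)\<in>{..<q} \<times> {1..<b}. \<rho> k i)"
    unfolding P_def by (simp add: sum.cartesian_product)
  then have "(\<Sum>k<q. P k)\<^sup>2 \<le> (\<Sum>(k, i)\<in>{..<q} \<times> {1..<b}. (\<rho> k i)\<^sup>2) * real (card ({..<q} \<times> {1..<b}))"
    using sum_squared_le_sum_of_squares[of "\<lambda>(k, i). \<rho> k i" "{..<q} \<times> {1..<b}"]
    by (simp add: case_prod_unfold)
  also have "\<dots> = (\<Sum>k<q. \<Sum>i=1..<b. (\<rho> k i)\<^sup>2) * (real q * (real b - 1))"
    using b by (simp add: sum.cartesian_product of_nat_diff)
  also have "(\<Sum>k<q. \<Sum>i=1..<b. (\<rho> k i)\<^sup>2) = (\<Sum>k<q. \<Sum>i=1..<b. (r k i)\<^sup>2) / (real b - 1)"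
    using b by (simp add: \<rho>_def power_divide sum_divide_distrib)
  also have "(\<Sum>k<q. \<Sum>i=1..<b. (r k i)\<^sup>2) / (real b - 1) * (real q * (real b - 1))
    = real q * (\<Sum>k<q. \<Sum>i=1..<b. (r k i)\<^sup>2)"
    using b by simp
  also have "\<dots> \<le> real q * (\<Sum>k<q. \<Sum>i<b. (r k i)\<^sup>2)"
    by (intro mult_left_mono sum_mono) (auto simp: sum_split_corner)
  also have "\<dots> \<le> real q * ((1 / (18 * 10 ^ 12))\<^sup>2 / (real q ^ 3 * real b))"
    using resid by (intro mult_left_mono) auto
  also have "\<dots> = (1 / (18 * 10 ^ 12) / (real q * sqrt (real b)))\<^sup>2"
    using q by (simp add: power_divide power_mult_distrib power2_eq_square power3_eq_cube)
  finally show "(\<Sum>k<q. P k)\<^sup>2 \<le> (1 / (18 * 10 ^ 12) / (real q * sqrt (real b)))\<^sup>2" .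
qed simp

lemma w_le: 
  assumes "k < q" "\<And>i. i < b \<Longrightarrow> \<bar>y k i\<bar> \<le> Y"
  shows "\<bar>w k\<bar> \<le> 2 * Y"
proof -
  have "0 \<le> Y" using assms(2)[of 0] b by simp
  have "\<bar>\<Sum>j<b. y k j\<bar> \<le> (\<Sum>j<b. Y)"
    using assms(2) by (intro order_trans[OF sum_abs] sum_mono) auto
  then have "\<bar>\<Sum>j<b. y k j\<bar> \<le> real b * Y" by simp
  also have "\<dots> \<le> 2 * \<gamma> * Y" using gamma_ge(2) \<open>0 \<le> Y\<close> by (intro mult_right_mono) auto
  finally show ?thesis using gamma_ge(3) by (simp add: w_def field_simps)
qed

text \<open>Orthogonality to the all-ones vector is a relation with positive weights. A vertex with
  a nonpositive value keeps the cuts at nonnegative thresholds from containing everything.\<close>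

lemma exists_nonpos: "\<exists>k<q. \<exists>i<b. y k i \<le> 0"
proof (rule ccontr)
  assume "\<not> ?thesis"
  then have pos: "\<And>k i. k < q \<Longrightarrow> i < b \<Longrightarrow> 0 < y k i" by (meson not_le)
  have "0 < sqrt (real b - 1) * (\<Sum>i=1..<b. y k i) + sqrt (real b + 1) * y k 0" if "k < q" for k
  proof -
    have "0 \<le> (\<Sum>i=1..<b. y k i)"
      using pos[OF that] by (intro sum_nonneg) (simp add: less_imp_le)
    moreover have "0 < sqrt (real b + 1) * y k 0" using pos[OF that, of 0] b by simp
    ultimately show ?thesis using b by (simp add: add_nonneg_pos)
  qed
  then have "0 < (\<Sum>k<q. sqrt (real b - 1) * (\<Sum>i=1..<b. y k i) + sqrt (real b + 1) * y k 0)"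
    using q by (intro sum_pos) (auto simp: lessThan_empty_iff)
  then show False using mean by simp
qed

lemma max_lower:
  assumes Y: "\<And>k i. k < q \<Longrightarrow> i < b \<Longrightarrow> \<bar>y k i\<bar> \<le> Y"
  shows "1 \<le> Y\<^sup>2 * (real b)\<^sup>2 * real q"
proof -
  have sq: "(y k i)\<^sup>2 \<le> Y\<^sup>2" if "k < q" "i < b" for k i
    using Y[OF that] unfolding abs_le_square_iff[symmetric] by linarith
  have le: "(real b - 1) * (\<Sum>i=1..<b. (y k i)\<^sup>2) + (real b + 1) * (y k 0)\<^sup>2
    \<le> (real b - 1) * (\<Sum>i=1..<b. Y\<^sup>2) + (real b + 1) * Y\<^sup>2" if "k < q" for k
    using sq[OF that] real_b by (intro add_mono mult_left_mono sum_mono) auto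
  note unit[symmetric]
  also have "(\<Sum>k<q. (real b - 1) * (\<Sum>i=1..<b. (y k i)\<^sup>2) + (real b + 1) * (y k 0)\<^sup>2)
    \<le> (\<Sum>k<q. (real b - 1) * (\<Sum>i=1..<b. Y\<^sup>2) + (real b + 1) * Y\<^sup>2)"
    by (rule sum_mono) (use le in simp)
  also have "\<dots> = real q * Y\<^sup>2 * ((real b)\<^sup>2 - real b + 2)"
    using b by (simp add: of_nat_diff power2_eq_square algebra_simps)
  \<comment> \<open>The weights of a clique add up to \<open>b\<^sup>2 - b + 2\<close>, which is at
    most \<open>b\<^sup>2\<close> because \<open>b\<close> is at least 2.\<close>
  also have "\<dots> \<le> real q * Y\<^sup>2 * (real b)\<^sup>2"
    using real_b by (intro mult_left_mono) auto
  finally show ?thesis by (simp add: mult_ac)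
qed

end

section \<open>Localized vectors\<close>

definition flat :: "nat \<Rightarrow> (nat \<Rightarrow> nat \<Rightarrow> 'a) \<Rightarrow> nat \<Rightarrow> 'a" where
  "flat b y u = y (u div b) (u mod b)"

text \<open>Stated with upper sets instead of thresholds, because being strictly above the
  complement passes to the complement under negation of \<open>y\<close>. The bound is twice the
  reciprocal of \<open>b choose 2\<close>.\<close>

definition has_good_sweep :: "nat \<Rightarrow> nat \<Rightarrow> (nat \<Rightarrow> nat \<Rightarrow> real) \<Rightarrow> bool" where
  "has_good_sweep b q y \<longleftrightarrow> (\<exists>S. S \<subseteq> {..<b * q} \<and> S \<noteq> {} \<and> S \<noteq> {..<b * q}
    \<and> (\<forall>u\<in>S. \<forall>v<b * q. v \<notin> S \<longrightarrow> flat b y v < flat b y u)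
    \<and> conductance (ring_of_cliques b q) S \<le> ereal (4 / (real b * (real b - 1))))"

lemma has_good_sweep_negated:
  assumes "has_good_sweep b q (\<lambda>k i. - y k i)"
  shows "has_good_sweep b q y"
proof -
  from assms obtain S where S: "S \<subseteq> {..<b * q}" "S \<noteq> {}" "S \<noteq> {..<b * q}"
    and up: "\<And>u v. u \<in> S \<Longrightarrow> v < b * q \<Longrightarrow> v \<notin> S \<Longrightarrow> flat b y u < flat b y v"
    and c: "conductance (ring_of_cliques b q) S \<le> ereal (4 / (real b * (real b - 1)))"
    unfolding has_good_sweep_def flat_def by auto
  have "conductance (ring_of_cliques b q) ({..<b * q} - S) = conductance (ring_of_cliques b q) S"
    by (rule conductance_complement[OF ring_of_cliques_carrier ring_of_cliques_symmetric S(1)])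
  with S up c show ?thesis
    unfolding has_good_sweep_def by (intro exI[of _ "{..<b * q} - S"]) auto
qed

context near_eigenvector
begin

text \<open>Half the length of an interval around \<open>w k\<close> that contains all values of the
  clique, including the corner. The first summand accounts for the two ring neighbours and for the
  gap between \<open>\<kappa> * w k\<close> and \<open>w k\<close>, both of size at most a constant
  times \<open>Y / b\<close>.\<close>

definition "spread Y k = 12 * Y / real b + 3 * sqrt (\<Sum>i<b. (r k i)\<^sup>2) / sqrt (real b)"

lemma deviation_le_spread:
  assumes Y: "\<And>k i. k < q \<Longrightarrow> i < b \<Longrightarrow> \<bar>y k i\<bar> \<le> Y" and k: "k < q" and i: "i < b"
  shows "\<bar>y k i - w k\<bar> \<le> spread Y k"
proof -
  define \<eta> where "\<eta> = sqrt (\<Sum>i<b. (r k i)\<^sup>2)"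
  have \<eta>: "\<bar>r k i\<bar> \<le> \<eta>" if "i < b" for i
    unfolding \<eta>_def using member_le_sum[of i "{..<b}" "\<lambda>i. (r k i)\<^sup>2"] that
    by (intro real_le_rsqrt) auto
  have \<eta>0: "0 \<le> \<eta>" by (simp add: \<eta>_def sum_nonneg)
  have Y0: "0 \<le> Y" using Y[OF k i] by simp
  have sp: "spread Y k = 12 * Y / real b + 3 * \<eta> / sqrt (real b)"
    by (simp add: spread_def \<eta>_def)
  show ?thesis
  proof (cases "i = 0")
    case False
    have "\<bar>y k i - w k\<bar> \<le> \<bar>r k i\<bar> / sqrt (real b - 1)"
      using inner_deviation[OF k _ i] False by (simp add: \<rho>_def)
    also have "\<dots> \<le> \<eta> / sqrt (real b - 1)"
      using \<eta>[OF i] real_b by (intro divide_right_mono) auto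
    also have "\<dots> \<le> \<eta> / (sqrt (real b) / 3)"
    proof (intro divide_left_mono \<eta>0)
      have "sqrt (real b / 3\<^sup>2) \<le> sqrt (real b - 1)"
        using real_b by (intro real_sqrt_le_mono) simp
      then show "sqrt (real b) / 3 \<le> sqrt (real b - 1)" by (simp add: real_sqrt_divide)
    qed (use real_b in auto)
    also have "\<dots> \<le> spread Y k" unfolding sp using Y0 by (simp add: mult.commute[of \<eta>])
    finally show ?thesis .
  next
    case True
    define N where "N = y (Suc k mod q) 0 + y ((k + (q - 1)) mod q) 0"
    have "\<bar>N\<bar> \<le> Y + Y"
      unfolding N_def using Y[of "Suc k mod q" 0] Y[of "(k + (q - 1)) mod q" 0] q b by simp
    moreover have w: "\<bar>w k\<bar> \<le> 2 * Y" using w_le[OF k, of Y] Y[OF k] by simp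
    then have "\<mu> * \<bar>w k\<bar> \<le> 1 * (2 * Y)" using mu_le mu_nonneg by (intro mult_mono) auto
    then have "\<bar>2 * \<mu> * w k\<bar> \<le> 4 * Y" using mu_nonneg by (simp add: abs_mult)
    moreover have "\<bar>sqrt (real b + 1) * r k 0\<bar> \<le> 3 / 2 * sqrt (real b) * \<eta>"
    proof -
      have "sqrt (real b + 1) \<le> sqrt ((3 / 2)\<^sup>2 * real b)"
        using real_b by (intro real_sqrt_le_mono) (simp add: power2_eq_square)
      then have "sqrt (real b + 1) \<le> 3 / 2 * sqrt (real b)" by (simp add: real_sqrt_mult)
      then have "sqrt (real b + 1) * \<bar>r k 0\<bar> \<le> 3 / 2 * sqrt (real b) * \<eta>"
        using \<eta>[of 0] b by (intro mult_mono) auto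
      then show ?thesis by (simp add: abs_mult)
    qed
    \<comment> \<open>Comparing the corner with \<open>w k\<close> itself cancels the clique sum.
      The remaining terms are bounded by \<open>2 * Y\<close>, \<open>4 * Y\<close> and the
      residual, while the left factor is at least \<open>b / 2\<close>; this is the origin of 12 and
      3 in \<open>spread\<close>.\<close>
    moreover have "(\<gamma> + 2 * \<mu>) * (y k 0 - w k) = N - 2 * \<mu> * w k - sqrt (real b + 1) * r k 0"
    proof -
      have "(\<Sum>j<b. y k j) = \<gamma> * w k" using gamma_ge(3) by (simp add: w_def)
      then show ?thesis
        using corner[OF k, folded gamma_mu(2)] by (simp add: N_def algebra_simps)
    qed
    ultimately have "\<bar>(\<gamma> + 2 * \<mu>) * (y k 0 - w k)\<bar> \<le> 6 * Y + 3 / 2 * sqrt (real b) * \<eta>"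
      by linarith
    moreover have "real b / 2 * \<bar>y k 0 - w k\<bar> \<le> (\<gamma> + 2 * \<mu>) * \<bar>y k 0 - w k\<bar>"
      using gamma_ge(2) mu_nonneg by (intro mult_right_mono) auto
    moreover have "\<bar>(\<gamma> + 2 * \<mu>) * (y k 0 - w k)\<bar> = (\<gamma> + 2 * \<mu>) * \<bar>y k 0 - w k\<bar>"
      using gamma_ge(3) mu_nonneg by (simp add: abs_mult)
    ultimately have "real b / 2 * \<bar>y k 0 - w k\<bar> \<le> 6 * Y + 3 / 2 * sqrt (real b) * \<eta>"
      by linarith
    then have "\<bar>y k 0 - w k\<bar> \<le> (6 * Y + 3 / 2 * sqrt (real b) * \<eta>) / (real b / 2)"
      using real_b by (simp add: pos_le_divide_eq mult.commute)
    also have "\<dots> = 12 * Y / real b + 3 * \<eta> * (sqrt (real b) / real b)"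
      using real_b by (simp add: add_divide_distrib)
    also have "sqrt (real b) / real b = 1 / sqrt (real b)"
      using real_b by (simp add: field_simps)
    finally show ?thesis using True by (simp add: sp)
  qed
qed

text \<open>\<open>max_lower\<close> turns the absolute bound on the residual into one relative to
  \<open>Y\<close>.\<close>

lemma spread_le:
  assumes Y: "\<And>k i. k < q \<Longrightarrow> i < b \<Longrightarrow> \<bar>y k i\<bar> \<le> Y" and k: "k < q"
  shows "spread Y k \<le> 12 * Y / real b + Y / (24 * real q)"
proof -
  have Y0: "0 \<le> Y" using Y[OF k, of 0] b by simp
  have "sqrt (\<Sum>i<b. (r k i)\<^sup>2) / sqrt (real b) = sqrt ((\<Sum>i<b. (r k i)\<^sup>2) / real b)"
    by (simp add: real_sqrt_divide)
  also have "\<dots> \<le> Y / (72 * real q)"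
  proof (rule real_le_lsqrt)
    have "(\<Sum>i<b. (r k i)\<^sup>2) / real b \<le> (1 / (18 * 10 ^ 12))\<^sup>2 / (real q ^ 3 * real b) / real b"
      using residual_le[OF k] by (intro divide_right_mono) auto
    also have "\<dots> \<le> (1 / 72)\<^sup>2 / (real q ^ 3 * real b) / real b"
      by (intro divide_right_mono) (auto simp: power2_eq_square)
    also have "\<dots> = (1 / 72)\<^sup>2 / (real q ^ 3 * (real b)\<^sup>2) * 1"
      by (simp add: power2_eq_square)
    also have "\<dots> \<le> (1 / 72)\<^sup>2 / (real q ^ 3 * (real b)\<^sup>2) * (Y\<^sup>2 * (real b)\<^sup>2 * real q)"
      by (intro mult_left_mono max_lower Y) auto
    also have "\<dots> = (Y / (72 * real q))\<^sup>2"
      using real_b q by (simp add: power2_eq_square power3_eq_cube field_simps)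
    finally show "(\<Sum>i<b. (r k i)\<^sup>2) / real b \<le> (Y / (72 * real q))\<^sup>2" .
  qed (use Y0 in auto)
  finally show ?thesis by (simp add: spread_def)
qed

lemma clique_mass_le:
  assumes K: "K \<subseteq> {..<q}" and c: "0 \<le> c" "\<And>k i. k \<in> K \<Longrightarrow> i < b \<Longrightarrow> c \<le> y k i"
  shows "real (card K) * ((real b - 1) * real b * c\<^sup>2) \<le> 1"
proof -
  have "real (card K) * ((real b - 1) * real b * c\<^sup>2) = (\<Sum>k\<in>K. (real b - 1) * real b * c\<^sup>2)" by simp
  also have "\<dots> \<le> (\<Sum>k\<in>K. (real b - 1) * (\<Sum>i=1..<b. (y k i)\<^sup>2) + (real b + 1) * (y k 0)\<^sup>2)"
  proof (rule sum_mono)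
    fix k assume k: "k \<in> K"
    have sq: "c\<^sup>2 \<le> (y k i)\<^sup>2" if "i < b" for i
      using c k that by (intro power_mono) auto
    have "(real b - 1) * real b * c\<^sup>2 = (real b - 1) * (\<Sum>i=1..<b. c\<^sup>2) + (real b - 1) * c\<^sup>2"
      using b by (simp add: of_nat_diff algebra_simps)
    also have "\<dots> \<le> (real b - 1) * (\<Sum>i=1..<b. (y k i)\<^sup>2) + (real b + 1) * (y k 0)\<^sup>2"
      using sq real_b b by (intro add_mono mult_left_mono mult_mono sum_mono) auto
    finally show "(real b - 1) * real b * c\<^sup>2
      \<le> (real b - 1) * (\<Sum>i=1..<b. (y k i)\<^sup>2) + (real b + 1) * (y k 0)\<^sup>2" .
  qed
  also have "\<dots> \<le> (\<Sum>k<q. (real b - 1) * (\<Sum>i=1..<b. (y k i)\<^sup>2) + (real b + 1) * (y k 0)\<^sup>2)"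
    using K real_b by (intro sum_mono2 add_nonneg_nonneg mult_nonneg_nonneg sum_nonneg) auto
  finally show ?thesis using unit by simp
qed

lemma good_sweep_if_localized:
  assumes Y: "\<And>k i. k < q \<Longrightarrow> i < b \<Longrightarrow> \<bar>y k i\<bar> \<le> Y"
    and att: "k0 < q" "i0 < b" "y k0 i0 = Y"
    and big: "128 * real q < real b \<or> 360000 < real b ^ 3 * Y\<^sup>2"
  shows "has_good_sweep b q y"
proof -
  have Y0: "0 < Y"
  proof (rule ccontr)
    assume "\<not> 0 < Y"
    then have "Y = 0" using Y[OF att(1,2)] by simp
    then show False using max_lower[OF Y] by simp
  qed
  \<comment> \<open>The number 384 is \<open>3 * 128\<close>. In the second alternative, a single
    entry satisfies \<open>Y\<^sup>2 * (b - 1) \<le> 1\<close>, so that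
    \<open>b ^ 3 * Y\<^sup>2\<close> is at most \<open>2 * b\<^sup>2\<close>; as it exceeds 360000,
    \<open>b\<^sup>2\<close> exceeds 180000 and hence the square of 384.\<close>
  have b384: "384 \<le> real b"
  proof (cases "128 * real q < real b")
    case True
    then show ?thesis using q by simp
  next
    case False
    have "Y\<^sup>2 * (real b - 1) \<le> 1"
    proof -
      have "Y\<^sup>2 * (real b - 1) \<le> (real b - 1) * (\<Sum>i=1..<b. (y k0 i)\<^sup>2) + (real b + 1) * (y k0 0)\<^sup>2"
      proof (cases "i0 = 0")
        case True
        have "Y\<^sup>2 * (real b - 1) \<le> (real b + 1) * (y k0 0)\<^sup>2"
          using att True by (simp add: mult.commute mult_right_mono)
        moreover have "0 \<le> (real b - 1) * (\<Sum>i=1..<b. (y k0 i)\<^sup>2)"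
          using real_b by (intro mult_nonneg_nonneg sum_nonneg) auto
        ultimately show ?thesis by linarith
      next
        case False
        have "(y k0 i0)\<^sup>2 \<le> (\<Sum>i=1..<b. (y k0 i)\<^sup>2)"
          using member_le_sum[of i0 "{1..<b}" "\<lambda>i. (y k0 i)\<^sup>2"] att False by auto
        then have "(real b - 1) * Y\<^sup>2 \<le> (real b - 1) * (\<Sum>i=1..<b. (y k0 i)\<^sup>2)"
          using att real_b by (intro mult_left_mono) auto
        then show ?thesis by (simp add: mult.commute add_increasing2)
      qed
      also have "\<dots> \<le> (\<Sum>k<q. (real b - 1) * (\<Sum>i=1..<b. (y k i)\<^sup>2) + (real b + 1) * (y k 0)\<^sup>2)"
        using att(1) real_b
        by (intro member_le_sum[of k0 "{..<q}" "\<lambda>k. (real b - 1) * (\<Sum>i=1..<b. (y k i)\<^sup>2) + (real b + 1) * (y k 0)\<^sup>2"])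
          (auto intro!: add_nonneg_nonneg mult_nonneg_nonneg sum_nonneg)
      finally show ?thesis using unit by simp
    qed
    then have "Y\<^sup>2 * real b \<le> 2" 
      using real_b mult_left_mono[of "real b / 2" "real b - 1" "Y\<^sup>2"] by simp
    then have "real b ^ 3 * Y\<^sup>2 \<le> 2 * (real b)\<^sup>2"
      using mult_left_mono[of "Y\<^sup>2 * real b" 2 "(real b)\<^sup>2"] by (simp add: power2_eq_square power3_eq_cube mult_ac)
    then have "384\<^sup>2 \<le> (real b)\<^sup>2" using big False by simp
    then show ?thesis by (rule power2_le_imp_le) simp
  qed
  \<comment> \<open>Only these cliques can be split by a threshold between \<open>Y / 2\<close> and
    \<open>Y\<close>.\<close>
  define R where "R = {k. k < q \<and> (\<exists>i<b. Y / 2 < y k i)}"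
  have R: "R \<subseteq> {..<q}" "finite R" by (auto simp: R_def)
  have dev: "\<bar>y k i - w k\<bar> \<le> spread Y k" if "k < q" "i < b" for k i
    by (rule deviation_le_spread[OF Y that])
  have sp: "spread Y k \<le> 12 * Y / real b + Y / (24 * real q)" if "k < q" for k
    by (rule spread_le[OF Y that])
  have sp0: "0 \<le> spread Y k" if "k < q" for k
    using dev[OF that, of 0] b by simp
  have "12 * Y / real b \<le> 12 * Y / 384"
    using b384 Y0 by (intro divide_left_mono) auto
  moreover have "Y / (24 * real q) \<le> Y / (24 * 3)"
    using q Y0 by (intro divide_left_mono) auto
  ultimately have sp8: "spread Y k \<le> Y / 8" if "k < q" for k
    using sp[OF that] Y0 by simp
  have "Y / 4 \<le> y k i" if k: "k \<in> R" and i: "i < b" for k i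
  proof -
    obtain j where j: "j < b" "Y / 2 < y k j" "k < q" using k by (auto simp: R_def)
    show ?thesis using dev[OF j(3) i] dev[OF j(3,1)] sp8[OF j(3)] j(2) by linarith
  qed
  then have mass: "real (card R) * ((real b - 1) * real b * (Y / 4)\<^sup>2) \<le> 1"
    using Y0 by (intro clique_mass_le R) auto
  \<comment> \<open>Either there are few cliques at all, or each clique of \<open>R\<close>, having
    all its values above \<open>Y / 4\<close>, carries at least
    \<open>b\<^sup>2 * Y\<^sup>2 / 32\<close> of the total mass 1.\<close>
  have cardR: "real (card R) / real b \<le> 1 / 128"
  proof (cases "128 * real q < real b")
    case True
    have "card R \<le> q" using card_mono[OF _ R(1)] by simp
    then show ?thesis using True real_b by (simp add: field_simps)
  next
    case False
    then have Yb: "360000 < real b ^ 3 * Y\<^sup>2" using big by simp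
    have "(real b / 2) * real b * (Y / 4)\<^sup>2 \<le> (real b - 1) * real b * (Y / 4)\<^sup>2"
      using real_b by (intro mult_right_mono) auto
    from mult_left_mono[OF this, of "real (card R)"]
    have "real (card R) * ((real b / 2) * real b * (Y / 4)\<^sup>2) \<le> 1"
      using mass by linarith
    then have 1: "real (card R) / real b * (real b ^ 3 * Y\<^sup>2) \<le> 32"
      using real_b by (simp add: power2_eq_square power3_eq_cube field_simps)
    have "real (card R) / real b * 360000 \<le> real (card R) / real b * (real b ^ 3 * Y\<^sup>2)"
      using Yb real_b by (intro mult_left_mono) auto
    then show ?thesis using 1 by linarith
  qed
  have "\<exists>t. Y / 2 \<le> t \<and> t < Y \<and> (\<forall>k\<in>R. spread Y k < \<bar>t - w k\<bar>)"
  proof (rule ccontr)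
    assume "\<not> ?thesis"
    then have "\<And>t. Y / 2 \<le> t \<Longrightarrow> t < Y \<Longrightarrow> \<exists>k\<in>R. \<bar>t - w k\<bar> \<le> spread Y k"
      by (meson not_le)
    then have "Y - Y / 2 \<le> (\<Sum>k\<in>R. 2 * spread Y k)"
      using Y0 R sp0 by (intro interval_cover_length) auto
    also have "\<dots> \<le> (\<Sum>k\<in>R. 2 * (12 * Y / real b + Y / (24 * real q)))"
      using sp R by (intro sum_mono mult_left_mono) auto
    also have "\<dots> = 24 * Y * (real (card R) / real b) + real (card R) / real q * (Y / 12)"
      by (simp add: algebra_simps)
    \<comment> \<open>This is 13/48 of \<open>Y\<close>, less than the length \<open>Y / 2\<close>
      that would have to be covered.\<close>
    also have "\<dots> \<le> 24 * Y * (1 / 128) + 1 * (Y / 12)"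
    proof (intro add_mono mult_left_mono mult_right_mono cardR)
      show "real (card R) / real q \<le> 1" using card_mono[OF _ R(1)] q by simp
    qed (use Y0 in auto)
    finally show False using Y0 by simp
  qed
  then obtain t where t: "Y / 2 \<le> t" "t < Y" and gap: "\<And>k. k \<in> R \<Longrightarrow> spread Y k < \<bar>t - w k\<bar>"
    by blast
  have uncut: "t < y k i" if "k < q" "j < b" "t < y k j" "i < b" for k i j
  proof (rule ccontr)
    assume "\<not> t < y k i"
    moreover have "k \<in> R" using that t by (auto simp: R_def intro: le_less_trans)
    ultimately show False
      using gap[of k] dev[OF that(1,2)] dev[OF that(1,4)] that(3) by linarith
  qed
  \<comment> \<open>As no clique is split at \<open>t\<close>, the corner decides for its whole
    clique.\<close>
  define K where "K = {k. k < q \<and> t < y k 0}"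
  have Kiff: "k \<in> K \<longleftrightarrow> t < y k i" if "k < q" "i < b" for k i
    using uncut[OF that(1)] that b by (auto simp: K_def)
  obtain k' i' where neg: "k' < q" "i' < b" "y k' i' \<le> 0" using exists_nonpos by auto
  have K: "K \<subseteq> {..<q}" "K \<noteq> {}" "K \<noteq> {..<q}"
    using Kiff[OF att(1,2)] att(3) t Kiff[OF neg(1,2)] neg Y0 by (auto simp: K_def)
  let ?S = "{u. u < b * q \<and> u div b \<in> K}"
  have S: "u \<in> ?S \<longleftrightarrow> u < b * q \<and> t < flat b y u" for u
  proof (cases "u < b * q")
    case True
    then show ?thesis
      using Kiff[of "u div b" "u mod b"] b by (auto simp: flat_def less_mult_imp_div_less mult.commute)
  qed simp
  have ne: "k * b \<in> ?S \<longleftrightarrow> k \<in> K" "k * b < b * q" if "k < q" for k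
    using block_index_less[OF that, of 0 b] b that by auto
  have "?S \<noteq> {}" "?S \<noteq> {..<b * q}"
    using K ne by blast+
  moreover have "2 / (real b * (real b - 1)) \<le> 4 / (real b * (real b - 1))"
    using real_b by (intro divide_right_mono) auto
  then have "conductance (ring_of_cliques b q) ?S \<le> ereal (4 / (real b * (real b - 1)))"
    using conductance_clique_union_le[OF b q K] by (meson ereal_less_eq(3) order_trans)
  moreover have "\<forall>u\<in>?S. \<forall>v<b * q. v \<notin> ?S \<longrightarrow> flat b y v < flat b y u"
  proof (intro ballI allI impI)
    fix u v assume "u \<in> ?S" "v < b * q" "v \<notin> ?S"
    then have "t < flat b y u" "\<not> t < flat b y v" using S by blast+
    then show "flat b y v < flat b y u" by linarith
  qed
  ultimately show ?thesis
    unfolding has_good_sweep_def by (intro exI[of _ ?S]) auto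
qed

end

section \<open>Averaging over the sweep cuts\<close>

lemma flat_block: "i < b \<Longrightarrow> flat b y (k * b + i) = y k i" "0 < b \<Longrightarrow> flat b y (k * b) = y k 0"
  by (simp_all add: flat_def block_index)

lemma volume_mono:
  assumes "S \<subseteq> T" "T \<subseteq> {..<b * q}"
  shows "volume (ring_of_cliques b q) S \<le> volume (ring_of_cliques b q) T"
proof -
  have "S \<subseteq> {..<b * q}" using assms by simp
  with assms show ?thesis
    unfolding volume_eq[OF \<open>S \<subseteq> {..<b * q}\<close>] volume_eq[OF assms(2)]
    by (intro sum_mono mult_left_mono ring_of_cliques_nonneg) auto
qed

lemma volume_nonneg: "S \<subseteq> {..<b * q} \<Longrightarrow> 0 \<le> volume (ring_of_cliques b q) S"
  using volume_mono[of "{}" S b q] by (simp add: volume_def)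

lemma cut_weight_nonneg: "S \<subseteq> {..<b * q} \<Longrightarrow> 0 \<le> cut_weight (ring_of_cliques b q) S"
  unfolding cut_weight_eq[OF ring_of_cliques_carrier]
  by (intro sum_nonneg mult_nonneg_nonneg ring_of_cliques_nonneg) auto

lemma sum_off_diagonal_perturb:
  fixes f h :: "nat \<Rightarrow> nat \<Rightarrow> real" and e :: "nat \<Rightarrow> real"
  assumes fh: "\<And>i j. i < b \<Longrightarrow> j < b \<Longrightarrow> f i j \<le> h i j + (e i + e j)"
    and e: "\<And>i. i < b \<Longrightarrow> 0 \<le> e i"
  shows "(\<Sum>i<b. \<Sum>j<b. if i = j then 0 else f i j)
    \<le> (\<Sum>i<b. \<Sum>j<b. if i = j then 0 else h i j) + 2 * real b * (\<Sum>i<b. e i)"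
proof -
  have "(\<Sum>i<b. \<Sum>j<b. if i = j then 0 else f i j)
    \<le> (\<Sum>i<b. \<Sum>j<b. (if i = j then 0 else h i j) + (e i + e j))"
    using fh e by (intro sum_mono) auto
  also have "\<dots> = (\<Sum>i<b. \<Sum>j<b. if i = j then 0 else h i j) + 2 * real b * (\<Sum>i<b. e i)"
    by (simp add: sum.distrib sum_distrib_left algebra_simps)
  finally show ?thesis .
qed

lemma sum_off_diagonal_corner:
  fixes h :: "real \<Rightarrow> real \<Rightarrow> real"
  assumes b: "2 \<le> b"
  shows "(\<Sum>i<b. \<Sum>j<b. if i = j then 0 else h (if i = 0 then \<alpha> else \<beta>) (if j = 0 then \<alpha> else \<beta>))
    = (real b - 1) * (h \<alpha> \<beta> + h \<beta> \<alpha> + (real b - 2) * h \<beta> \<beta>)"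
proof -
  have split: "(\<Sum>j<b. f j) = f 0 + (\<Sum>j=1..<b. f j :: real)" for f
    using b by (simp add: sum_lessThan_first)
  have "(\<Sum>j=1..<b. if i = j then 0 else h \<beta> (if j = 0 then \<alpha> else \<beta>)) = (real b - 2) * h \<beta> \<beta>"
    if "i \<in> {1..<b}" for i
  proof -
    have "(\<Sum>j=1..<b. if i = j then 0 else h \<beta> (if j = 0 then \<alpha> else \<beta>)) = (\<Sum>j=1..<b. h \<beta> \<beta> - (if i = j then h \<beta> \<beta> else 0))"
      by (intro sum.cong) auto
    also have "\<dots> = (real b - 2) * h \<beta> \<beta>"
      using that b by (simp add: sum_subtractf of_nat_diff algebra_simps)
    finally show ?thesis .
  qed
  then have "(\<Sum>i=1..<b. \<Sum>j<b. if i = j then 0 else h (if i = 0 then \<alpha> else \<beta>) (if j = 0 then \<alpha> else \<beta>))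
    = (\<Sum>i=1..<b. h \<beta> \<alpha> + (real b - 2) * h \<beta> \<beta>)"
    unfolding split by (intro sum.cong refl) auto
  moreover have "(\<Sum>j<b. if 0 = j then 0 else h \<alpha> (if j = 0 then \<alpha> else \<beta>)) = (real b - 1) * h \<alpha> \<beta>"
    unfolding split using b by (simp add: of_nat_diff)
  ultimately show ?thesis
    unfolding split[of "\<lambda>i. \<Sum>j<b. _ i j"] using b by (simp add: of_nat_diff algebra_simps)
qed

context near_eigenvector
begin

text \<open>Level sets of a monotone function of \<open>y\<close> are upper sets of
  \<open>y\<close>, and \<open>minority\<close> makes them the side of smaller volume, so that their
  own volume is the denominator of the conductance.\<close>

lemma cut_ge_if_no_good_sweep:
  fixes g :: "nat \<Rightarrow> real"
  assumes no: "\<not> has_good_sweep b q y"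
    and minority: "volume (ring_of_cliques b q) {u. u < b * q \<and> 0 < flat b y u}
      \<le> volume (ring_of_cliques b q) {u. u < b * q \<and> flat b y u \<le> 0}"
    and mono: "\<And>u v. u < b * q \<Longrightarrow> v < b * q \<Longrightarrow> flat b y u \<le> flat b y v \<Longrightarrow> g u \<le> g v"
    and g0: "\<And>u. u < b * q \<Longrightarrow> flat b y u \<le> 0 \<Longrightarrow> g u \<le> t"
  shows "4 / (real b * (real b - 1)) * volume (ring_of_cliques b q) {u. u < b * q \<and> t < g u}
    \<le> cut_weight (ring_of_cliques b q) {u. u < b * q \<and> t < g u}"
proof -
  let ?A = "ring_of_cliques b q"
  define S where "S = {u. u < b * q \<and> t < g u}"
  have S: "S \<subseteq> {..<b * q}" by (auto simp: S_def)
  show ?thesis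
  \<comment> \<open>A level set without inner edges has conductance \<infinity>, but the inequality
    between cut and volume is then trivial.\<close>
  proof (cases "volume ?A S = 0")
    case True
    then show ?thesis using cut_weight_nonneg[OF S] by (simp add: S_def)
  next
    case False
    then have vpos: "0 < volume ?A S" using volume_nonneg[OF S] by simp
    have "volume ?A S \<le> volume ?A {u. u < b * q \<and> 0 < flat b y u}"
      using g0 by (intro volume_mono) (auto simp: S_def not_le[symmetric])
    also have "\<dots> \<le> volume ?A {u. u < b * q \<and> flat b y u \<le> 0}" by (rule minority)
    also have "\<dots> \<le> volume ?A ({..<b * q} - S)"
      using g0[THEN leD] by (intro volume_mono) (auto simp: S_def)
    finally have vle: "volume ?A S \<le> volume ?A ({..<dim_row ?A} - S)" by simp
    have "S \<noteq> {}" using False by (auto simp: volume_def)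
    moreover have "S \<noteq> {..<b * q}"
    proof -
      obtain k i where ki: "k < q" "i < b" "y k i \<le> 0" using exists_nonpos by auto
      then have "k * b + i \<notin> S" using g0[of "k * b + i"] block_index_less[of k q i b]
        by (auto simp: S_def flat_block)
      then show ?thesis using ki block_index_less[of k q i b] by auto
    qed
    moreover have "flat b y v < flat b y u" if "u \<in> S" "v < b * q" "v \<notin> S" for u v
      using that mono[of u v] by (force simp: S_def not_less)
    ultimately have "\<not> conductance ?A S \<le> ereal (4 / (real b * (real b - 1)))"
      using no S unfolding has_good_sweep_def by blast
    then have "4 / (real b * (real b - 1)) < cut_weight ?A S / volume ?A S"
      using vpos vle by (simp add: conductance_def Let_def min_def)
    then show ?thesis
      using vpos by (simp add: S_def[symmetric] pos_less_divide_eq)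
  qed
qed

text \<open>The clique is replaced by an ideal one with value \<open>\<kappa> * w k\<close> at the
  corner and \<open>w k\<close> elsewhere, for which \<open>potential_gain\<close> applies with
  \<open>\<sigma> = sqrt \<kappa>\<close>. The Lipschitz constant \<open>p / \<tau>\<close> controls
  the replacement. The term \<open>2 * G 0\<close> is the share of the clique in the ring
  edges.\<close>

lemma clique_potential_le:
  assumes \<tau>: "0 < \<tau>" "\<tau> \<le> p" and k: "k < q"
    and Y: "\<And>i. i < b \<Longrightarrow> y k i \<le> p\<^sup>2 - \<tau>\<^sup>2" and w: "w k \<le> p\<^sup>2 - \<tau>\<^sup>2"
  defines "G \<equiv> \<lambda>i. potential p \<tau> (y k i)"
  shows "(\<Sum>i<b. \<Sum>j<b. if i = j then 0 else max 0 (G i - G j)) + 2 * G 0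
      - 4 / (real b * (real b - 1)) * (\<Sum>i<b. \<Sum>j<b. if i = j then 0 else min (G i) (G j))
    \<le> 13 * real b * (p / \<tau>) * P k - (2 * sqrt \<kappa> * max 0 (w k) - 4 * p * \<tau>)"
proof -
  let ?F = "potential p \<tau>" and ?c = "4 / (real b * (real b - 1))"
  define f f\<kappa> \<Lambda> where "f = ?F (w k)" and "f\<kappa> = ?F (\<kappa> * w k)" and "\<Lambda> = p / \<tau>"
  define m where "m i = (if i = 0 then f\<kappa> else f)" for i :: nat
  define e where "e i = \<Lambda> * (if i = 0 then P k else \<rho> k i)" for i :: nat
  have \<Lambda>: "0 \<le> \<Lambda>" using \<tau> by (simp add: \<Lambda>_def)
  have \<kappa>: "0 \<le> \<kappa>" "\<kappa> \<le> 1" using kappa_fifth kappa_le by auto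
  have p2: "0 \<le> p\<^sup>2 - \<tau>\<^sup>2" using \<tau> by (simp add: power_mono)
  have \<kappa>w: "\<kappa> * w k \<le> p\<^sup>2 - \<tau>\<^sup>2"
  proof (cases "0 \<le> w k")
    case True
    then have "\<kappa> * w k \<le> 1 * w k" using \<kappa> by (intro mult_right_mono) auto
    then show ?thesis using w by simp
  next
    case False
    then have "\<kappa> * w k \<le> 0" using \<kappa> by (simp add: mult_nonneg_nonpos)
    then show ?thesis using p2 by simp
  qed
  have f\<kappa>f: "f\<kappa> \<le> f"
  proof (cases "0 \<le> w k")
    case True
    then have "\<kappa> * w k \<le> 1 * w k" using \<kappa> by (intro mult_right_mono) auto
    then show ?thesis unfolding f_def f\<kappa>_def using potential_mono[OF \<tau> _ w] by simp
  next
    case False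
    then have "\<kappa> * w k \<le> 0" using \<kappa> by (simp add: mult_nonneg_nonpos)
    then show ?thesis using False \<tau> by (simp add: f_def f\<kappa>_def potential_eq_0)
  qed
  have e0: "0 \<le> e i" for i using \<Lambda> rho_nonneg P_nonneg by (simp add: e_def)
  have Gm: "\<bar>G i - m i\<bar> \<le> e i" if i: "i < b" for i
  proof (cases "i = 0")
    case True
    have "\<bar>G 0 - f\<kappa>\<bar> \<le> \<Lambda> * \<bar>y k 0 - \<kappa> * w k\<bar>"
      unfolding G_def f\<kappa>_def \<Lambda>_def using i True by (intro potential_lipschitz \<tau> Y \<kappa>w) auto
    also have "\<dots> \<le> \<Lambda> * P k" using corner_deviation[OF k] \<Lambda> by (rule mult_left_mono)
    finally show ?thesis using True by (simp add: m_def e_def)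
  next
    case False
    have "\<bar>G i - f\<bar> \<le> \<Lambda> * \<bar>y k i - w k\<bar>"
      unfolding G_def f_def \<Lambda>_def using i by (intro potential_lipschitz \<tau> Y w) auto
    also have "\<dots> \<le> \<Lambda> * \<rho> k i" using inner_deviation[OF k _ i] False \<Lambda> by (intro mult_left_mono) auto
    finally show ?thesis using False by (simp add: m_def e_def)
  qed
  \<comment> \<open>The corner error is as large as all inner errors together, hence the factor
    2.\<close>
  have esum: "(\<Sum>i<b. e i) = 2 * \<Lambda> * P k"
    unfolding sum_split_corner by (simp add: e_def P_def sum_distrib_left mult.assoc)
  have "(\<Sum>i<b. \<Sum>j<b. if i = j then 0 else max 0 (G i - G j))
    \<le> (\<Sum>i<b. \<Sum>j<b. if i = j then 0 else max 0 (m i - m j)) + 2 * real b * (\<Sum>i<b. e i)"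
  proof (rule sum_off_diagonal_perturb)
    fix i j assume "i < b" "j < b"
    then show "max 0 (G i - G j) \<le> max 0 (m i - m j) + (e i + e j)"
      using Gm[of i] Gm[of j] by (simp add: max_def abs_le_iff split: if_splits) 
  qed (rule e0)
  also have "(\<Sum>i<b. \<Sum>j<b. if i = j then 0 else max 0 (m i - m j)) = (real b - 1) * (f - f\<kappa>)"
    unfolding m_def using f\<kappa>f by (subst sum_off_diagonal_corner[OF b, of "\<lambda>x y. max 0 (x - y)"]) simp
  finally have 1: "(\<Sum>i<b. \<Sum>j<b. if i = j then 0 else max 0 (G i - G j))
    \<le> (real b - 1) * (f - f\<kappa>) + 4 * real b * (\<Lambda> * P k)"
    unfolding esum by (simp add: mult_ac)
  have "(\<Sum>i<b. \<Sum>j<b. if i = j then 0 else min (m i) (m j))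
    \<le> (\<Sum>i<b. \<Sum>j<b. if i = j then 0 else min (G i) (G j)) + 2 * real b * (\<Sum>i<b. e i)"
  proof (rule sum_off_diagonal_perturb)
    fix i j assume "i < b" "j < b"
    then show "min (m i) (m j) \<le> min (G i) (G j) + (e i + e j)"
      using Gm[of i] Gm[of j] e0[of i] e0[of j] by (simp add: min_def abs_le_iff split: if_splits)
  qed (rule e0)
  moreover have "(\<Sum>i<b. \<Sum>j<b. if i = j then 0 else min (m i) (m j)) = (real b - 1) * (2 * f\<kappa> + (real b - 2) * f)"
    unfolding m_def using f\<kappa>f by (subst sum_off_diagonal_corner[OF b, of min]) simp
  ultimately have "?c * ((real b - 1) * (2 * f\<kappa> + (real b - 2) * f))
    \<le> ?c * ((\<Sum>i<b. \<Sum>j<b. if i = j then 0 else min (G i) (G j)) + 4 * real b * (\<Lambda> * P k))"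
    unfolding esum using real_b by (intro mult_left_mono) (auto simp: mult_ac)
  moreover have "?c * ((real b - 1) * (2 * f\<kappa> + (real b - 2) * f)) = 4 / real b * (2 * f\<kappa> + (real b - 2) * f)"
    using real_b by simp
  moreover have "?c * (4 * real b * (\<Lambda> * P k)) \<le> 16 * (\<Lambda> * P k)"
  proof -
    have "?c * (4 * real b) = 16 / (real b - 1)" using real_b by simp
    also have "\<dots> \<le> 16" using real_b by (simp add: divide_le_eq)
    finally have "?c * (4 * real b) * (\<Lambda> * P k) \<le> 16 * (\<Lambda> * P k)"
      using \<Lambda> P_nonneg by (intro mult_right_mono) auto
    then show ?thesis by (simp only: mult.assoc)
  qed
  ultimately have 2: "4 / real b * (2 * f\<kappa> + (real b - 2) * f) - 16 * (\<Lambda> * P k)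
    \<le> ?c * (\<Sum>i<b. \<Sum>j<b. if i = j then 0 else min (G i) (G j))"
    unfolding distrib_left by linarith
  have 3: "G 0 \<le> f\<kappa> + \<Lambda> * P k"
    using Gm[of 0] b by (simp add: m_def e_def)
  have E: "0 \<le> real b - 3 + 8 / real b" "(real b - 3 + 8 / real b) * (1 - sqrt \<kappa>) \<le> 2"
    using corner_ratio_bound[OF real_b kappa_ge] by auto
  have "2 * sqrt \<kappa> * max 0 (w k) - 4 * p * \<tau> \<le> 2 * f - (real b - 3 + 8 / real b) * (f - f\<kappa>)"
    using potential_gain[OF \<tau> w _ _ E] \<kappa> by (simp add: f_def f\<kappa>_def)
  moreover have "2 * f - (real b - 3 + 8 / real b) * (f - f\<kappa>)
    = 4 / real b * (2 * f\<kappa> + (real b - 2) * f) - (real b - 1) * (f - f\<kappa>) - 2 * f\<kappa>"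
    using real_b by (simp add: field_simps)
  \<comment> \<open>Collected errors: \<open>4 * b\<close> from the cut, 2 from the ring edges and
    16 from the volume; \<open>4 * b + 18\<close> is at most \<open>13 * b\<close> because
    \<open>b\<close> is at least 2.\<close>
  moreover have "(4 * real b + 18) * (\<Lambda> * P k) \<le> 13 * real b * (\<Lambda> * P k)"
    using real_b \<Lambda> P_nonneg by (intro mult_right_mono) auto
  ultimately show ?thesis
    using 1 2 3 unfolding \<Lambda>_def[symmetric] distrib_right by (simp only: mult.assoc)
qed

lemma positive_part_le_if_no_good_sweep:
  assumes no: "\<not> has_good_sweep b q y"
    and minority: "volume (ring_of_cliques b q) {u. u < b * q \<and> 0 < flat b y u}
      \<le> volume (ring_of_cliques b q) {u. u < b * q \<and> flat b y u \<le> 0}"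
    and \<tau>: "0 < \<tau>" "\<tau> \<le> p"
    and Y: "\<And>k i. k < q \<Longrightarrow> i < b \<Longrightarrow> y k i \<le> p\<^sup>2 - \<tau>\<^sup>2" and w: "\<And>k. k < q \<Longrightarrow> w k \<le> p\<^sup>2 - \<tau>\<^sup>2"
  shows "2 * sqrt \<kappa> * (\<Sum>k<q. max 0 (w k)) \<le> 4 * real q * (p * \<tau>) + 13 * real b * (p / \<tau>) * (\<Sum>k<q. P k)"
proof -
  let ?A = "ring_of_cliques b q" and ?c = "4 / (real b * (real b - 1))"
  define G where "G k i = potential p \<tau> (y k i)" for k i
  define g where "g = flat b G"
  have flatY: "flat b y u \<le> p\<^sup>2 - \<tau>\<^sup>2" if "u < b * q" for u
    unfolding flat_def using that b by (intro Y) (auto simp: less_mult_imp_div_less mult.commute)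
  have gp: "g u = potential p \<tau> (flat b y u)" for u by (simp add: g_def G_def flat_def)
  have g0: "0 \<le> g u" if "u < b * q" for u
    unfolding gp by (rule potential_nonneg[OF \<tau> flatY[OF that]])
  have G0: "0 \<le> G k i" if "k < q" "i < b" for k i
    unfolding G_def by (rule potential_nonneg[OF \<tau> Y[OF that]])
  have "?c * (\<Sum>u<b * q. \<Sum>v<b * q. ?A $$ (u, v) * min (g u) (g v))
    \<le> (\<Sum>u<b * q. \<Sum>v<b * q. ?A $$ (u, v) * max 0 (g u - g v))"
  proof (rule threshold_averaging[OF ring_of_cliques_carrier g0])
    fix t :: real assume "0 \<le> t"
    then show "?c * volume ?A {u. u < b * q \<and> t < g u} \<le> cut_weight ?A {u. u < b * q \<and> t < g u}"
      using potential_mono[OF \<tau>] flatY potential_eq_0[OF \<tau>(1)]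
      by (intro cut_ge_if_no_good_sweep no minority) (auto simp: gp)
  qed
  moreover have "(\<Sum>u<b * q. \<Sum>v<b * q. ?A $$ (u, v) * min (g u) (g v))
    \<ge> (\<Sum>k<q. \<Sum>i<b. \<Sum>j<b. if i = j then 0 else min (G k i) (G k j))"
  proof -
    \<comment> \<open>For the volume, the contribution of the ring edges is nonnegative and is
      dropped.\<close>
    have "0 \<le> (\<Sum>k<q. min (g (k * b)) (g (Suc k mod q * b)) + min (g (Suc k mod q * b)) (g (k * b)))"
      using b q G0 by (intro sum_nonneg) (auto simp: g_def flat_block)
    moreover have "(\<Sum>k<q. \<Sum>i<b. \<Sum>j<b. if i = j then 0 else min (g (k * b + i)) (g (k * b + j)))
      = (\<Sum>k<q. \<Sum>i<b. \<Sum>j<b. if i = j then 0 else min (G k i) (G k j))"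
      by (intro sum.cong refl) (simp add: g_def flat_block)
    ultimately show ?thesis
      using b by (subst ring_of_cliques_sum[OF q]) simp_all
  qed
  moreover have "(\<Sum>u<b * q. \<Sum>v<b * q. ?A $$ (u, v) * max 0 (g u - g v))
    \<le> (\<Sum>k<q. \<Sum>i<b. \<Sum>j<b. if i = j then 0 else max 0 (G k i - G k j)) + (\<Sum>k<q. 2 * G k 0)"
  proof -
    \<comment> \<open>For the cut, a ring edge is charged to both of its corners, so every corner
      pays twice.\<close>
    have "max 0 (g (k * b) - g (Suc k mod q * b)) + max 0 (g (Suc k mod q * b) - g (k * b))
      \<le> G k 0 + G (Suc k mod q) 0" if "k < q" for k
      using that b q G0[of k 0] G0[of "Suc k mod q" 0] by (auto simp: g_def flat_block max_def)
    then have "(\<Sum>k<q. max 0 (g (k * b) - g (Suc k mod q * b)) + max 0 (g (Suc k mod q * b) - g (k * b)))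
      \<le> (\<Sum>k<q. G k 0 + G (Suc k mod q) 0)"
      by (intro sum_mono) simp
    also have "\<dots> = (\<Sum>k<q. 2 * G k 0)"
      using sum_cyclic_Suc[of q "\<lambda>k. G k 0"] q by (simp add: sum.distrib sum_distrib_left[symmetric])
    finally have "(\<Sum>k<q. max 0 (g (k * b) - g (Suc k mod q * b)) + max 0 (g (Suc k mod q * b) - g (k * b)))
      \<le> (\<Sum>k<q. 2 * G k 0)" .
    moreover have "(\<Sum>k<q. \<Sum>i<b. \<Sum>j<b. if i = j then 0 else max 0 (g (k * b + i) - g (k * b + j)))
      = (\<Sum>k<q. \<Sum>i<b. \<Sum>j<b. if i = j then 0 else max 0 (G k i - G k j))"
      by (intro sum.cong refl) (simp add: g_def flat_block)
    ultimately show ?thesis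
      using b by (subst ring_of_cliques_sum[OF q]) simp_all
  qed
  moreover have "0 \<le> ?c" using real_b by simp
  ultimately have "0 \<le> (\<Sum>k<q. \<Sum>i<b. \<Sum>j<b. if i = j then 0 else max 0 (G k i - G k j)) + (\<Sum>k<q. 2 * G k 0)
      - ?c * (\<Sum>k<q. \<Sum>i<b. \<Sum>j<b. if i = j then 0 else min (G k i) (G k j))"
    by (smt (verit) mult_left_mono)
  also have "\<dots> = (\<Sum>k<q. (\<Sum>i<b. \<Sum>j<b. if i = j then 0 else max 0 (G k i - G k j)) + 2 * G k 0
      - ?c * (\<Sum>i<b. \<Sum>j<b. if i = j then 0 else min (G k i) (G k j)))"
    by (simp only: sum.distrib sum_subtractf sum_distrib_left)
  also have "\<dots> \<le> (\<Sum>k<q. 13 * real b * (p / \<tau>) * P k - (2 * sqrt \<kappa> * max 0 (w k) - 4 * p * \<tau>))"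
    unfolding G_def using Y w by (intro sum_mono clique_potential_le[OF \<tau>]) auto
  also have "\<dots> = 13 * real b * (p / \<tau>) * (\<Sum>k<q. P k) - (2 * sqrt \<kappa> * (\<Sum>k<q. max 0 (w k)) - real q * (4 * p * \<tau>))"
    by (simp only: sum_subtractf sum_distrib_left[symmetric] sum_constant card_lessThan) (simp add: mult_ac)
  finally show ?thesis by (simp add: mult_ac)
qed

text \<open>As \<kappa> is the same in all cliques, the orthogonality relation becomes
  \<open>c\<close> times the sum of \<open>w\<close> up to deviations. These are weighted by the
  difference of the roots of the two degrees, which is at most 1, while \<open>c\<close> is at least
  1.\<close>

lemma abs_sum_w_le: "\<bar>\<Sum>k<q. w k\<bar> \<le> (\<Sum>k<q. P k)"
proof -
  define s\<^sub>1 s\<^sub>2 E where "s\<^sub>1 = sqrt (real b - 1)" and "s\<^sub>2 = sqrt (real b + 1)"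
    and "E k = (\<Sum>i=1..<b. w k - y k i)" for k
  note s_def = this
  have s1: "1 \<le> s\<^sub>1" and s2: "1 \<le> s\<^sub>2" and s12: "s\<^sub>1 \<le> s\<^sub>2"
    unfolding s_def using real_b by simp_all
  have "(s\<^sub>2 - s\<^sub>1) * 2 \<le> (s\<^sub>2 - s\<^sub>1) * (s\<^sub>2 + s\<^sub>1)"
    using s1 s2 s12 by (intro mult_left_mono) auto
  also have "\<dots> = s\<^sub>2\<^sup>2 - s\<^sub>1\<^sup>2" by (simp add: power2_eq_square algebra_simps)
  also have "\<dots> = 2" using real_b by (simp add: s_def)
  finally have sd: "\<bar>s\<^sub>1 - s\<^sub>2\<bar> \<le> 1" using s12 by simp
  define c where "c = s\<^sub>1 * (real b - 1) + s\<^sub>2 * \<kappa>"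
  have "1 * 1 \<le> s\<^sub>1 * (real b - 1)" using s1 real_b by (intro mult_mono) auto
  moreover have "0 \<le> s\<^sub>2 * \<kappa>" using s2 kappa_fifth by simp
  ultimately have c: "1 \<le> c" by (simp add: c_def)
  have "s\<^sub>1 * (\<Sum>i=1..<b. y k i) + s\<^sub>2 * y k 0 = c * w k - (s\<^sub>1 - s\<^sub>2) * E k" for k
  proof -
    have 1: "(\<Sum>i=1..<b. y k i) = (real b - 1) * w k - E k"
      using b by (simp add: s_def sum_subtractf of_nat_diff)
    have 2: "y k 0 = \<kappa> * w k + E k" using corner_value[of k] by (simp add: s_def)
    show ?thesis unfolding 1 2 c_def by (simp add: algebra_simps)
  qed
  then have "(\<Sum>k<q. c * w k - (s\<^sub>1 - s\<^sub>2) * E k) = 0"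
    using mean[folded s_def(1,2)] by simp
  then have "c * (\<Sum>k<q. w k) = (s\<^sub>1 - s\<^sub>2) * (\<Sum>k<q. E k)"
    by (simp only: sum_subtractf sum_distrib_left[symmetric])
  then have "\<bar>c\<bar> * \<bar>\<Sum>k<q. w k\<bar> = \<bar>s\<^sub>1 - s\<^sub>2\<bar> * \<bar>\<Sum>k<q. E k\<bar>"
    by (simp only: abs_mult[symmetric])
  then have "c * \<bar>\<Sum>k<q. w k\<bar> = \<bar>s\<^sub>1 - s\<^sub>2\<bar> * \<bar>\<Sum>k<q. E k\<bar>"
    using c by simp
  moreover have "\<bar>s\<^sub>1 - s\<^sub>2\<bar> * \<bar>\<Sum>k<q. E k\<bar> \<le> 1 * \<bar>\<Sum>k<q. E k\<bar>"
    using sd by (intro mult_right_mono) auto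
  moreover have "1 * \<bar>\<Sum>k<q. w k\<bar> \<le> c * \<bar>\<Sum>k<q. w k\<bar>"
    using c by (intro mult_right_mono) auto
  moreover have "\<bar>\<Sum>k<q. E k\<bar> \<le> (\<Sum>k<q. P k)"
    unfolding s_def using deviation_sum by (intro order_trans[OF sum_abs sum_mono]) simp
  ultimately show ?thesis by linarith
qed

text \<open>Estimating squares by \<open>Y\<close> times absolute values turns the normalization
  into a lower bound for the sum of \<open>\<bar>w k\<bar>\<close>.\<close>

lemma abs_w_mass:
  assumes Y: "\<And>k i. k < q \<Longrightarrow> i < b \<Longrightarrow> \<bar>y k i\<bar> \<le> Y"
  shows "1 \<le> Y * ((real b)\<^sup>2 * (\<Sum>k<q. \<bar>w k\<bar>) + 2 * real b * (\<Sum>k<q. P k))"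
proof -
  have Y0: "0 \<le> Y" using Y[of 0 0] b q by simp
  have sq: "(y k i)\<^sup>2 \<le> Y * \<bar>y k i\<bar>" if "k < q" "i < b" for k i
    using mult_right_mono[OF Y[OF that], of "\<bar>y k i\<bar>"] by (simp add: power2_eq_square)
  have le: "(real b - 1) * (\<Sum>i=1..<b. (y k i)\<^sup>2) + (real b + 1) * (y k 0)\<^sup>2
    \<le> Y * ((real b)\<^sup>2 * \<bar>w k\<bar> + 2 * real b * P k)" if k: "k < q" for k
  proof -
    have "(real b - 1) * (\<Sum>i=1..<b. (y k i)\<^sup>2) + (real b + 1) * (y k 0)\<^sup>2
      \<le> (real b - 1) * (\<Sum>i=1..<b. Y * \<bar>y k i\<bar>) + (real b + 1) * (Y * \<bar>y k 0\<bar>)"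
      using sq[OF k] real_b b by (intro add_mono mult_left_mono sum_mono) auto
    also have "\<dots> = Y * ((real b - 1) * (\<Sum>i=1..<b. \<bar>y k i\<bar>) + (real b + 1) * \<bar>y k 0\<bar>)"
      by (simp add: sum_distrib_left algebra_simps)
    also have "\<dots> \<le> Y * ((real b - 1) * ((real b - 1) * \<bar>w k\<bar> + P k) + (real b + 1) * (\<bar>w k\<bar> + P k))"
    proof (intro mult_left_mono add_mono Y0)
      have "(\<Sum>i=1..<b. \<bar>y k i\<bar>) \<le> (\<Sum>i=1..<b. \<bar>w k\<bar> + \<rho> k i)"
      proof (rule sum_mono)
        fix i assume "i \<in> {1..<b}"
        then show "\<bar>y k i\<bar> \<le> \<bar>w k\<bar> + \<rho> k i" using inner_deviation[OF k, of i] by simp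
      qed
      then show "(\<Sum>i=1..<b. \<bar>y k i\<bar>) \<le> (real b - 1) * \<bar>w k\<bar> + P k"
        using b by (simp add: sum.distrib P_def of_nat_diff)
      have "\<kappa> * \<bar>w k\<bar> \<le> 1 * \<bar>w k\<bar>" using kappa_le by (intro mult_right_mono) auto
      then have "\<bar>\<kappa> * w k\<bar> \<le> \<bar>w k\<bar>" using kappa_fifth by (simp add: abs_mult)
      then show "\<bar>y k 0\<bar> \<le> \<bar>w k\<bar> + P k" using corner_deviation[OF k] by linarith
    qed (use real_b in auto)
    also have "\<dots> = Y * (((real b)\<^sup>2 - real b + 2) * \<bar>w k\<bar> + 2 * real b * P k)"
      by (simp add: power2_eq_square algebra_simps)
    also have "\<dots> \<le> Y * ((real b)\<^sup>2 * \<bar>w k\<bar> + 2 * real b * P k)"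
      using real_b Y0 by (intro mult_left_mono add_mono mult_right_mono) auto
    finally show ?thesis .
  qed
  note unit[symmetric]
  also have "(\<Sum>k<q. (real b - 1) * (\<Sum>i=1..<b. (y k i)\<^sup>2) + (real b + 1) * (y k 0)\<^sup>2)
    \<le> (\<Sum>k<q. Y * ((real b)\<^sup>2 * \<bar>w k\<bar> + 2 * real b * P k))"
    by (rule sum_mono) (use le in simp)
  also have "\<dots> = Y * ((real b)\<^sup>2 * (\<Sum>k<q. \<bar>w k\<bar>) + 2 * real b * (\<Sum>k<q. P k))"
    by (simp only: sum_distrib_left[symmetric] sum.distrib)
  finally show ?thesis .
qed

lemma sqrt_b_powers: "real b = (sqrt (real b))\<^sup>2" "0 < sqrt (real b)"
  using b by simp_all

text \<open>The sum of \<open>w\<close> nearly vanishes, so the positive part carries about half of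
  the sum of absolute values, which is at least of order \<open>1 / (600 * sqrt b)\<close>.\<close>

lemma positive_part_ge:
  assumes Y: "\<And>k i. k < q \<Longrightarrow> i < b \<Longrightarrow> \<bar>y k i\<bar> \<le> Y"
    and Yb: "Y * sqrt (real b) ^ 3 \<le> 600"
  shows "1 / (2400 * sqrt (real b)) \<le> (\<Sum>k<q. max 0 (w k))"
proof -
  define B where "B = sqrt (real b)"
  have B: "0 < B" "real b = B\<^sup>2" using sqrt_b_powers by (simp_all add: B_def)
  define W Q where "W = (\<Sum>k<q. \<bar>w k\<bar>)" and "Q = (\<Sum>k<q. P k)"
  have W0: "0 \<le> W" and Q0: "0 \<le> Q" by (auto simp: W_def Q_def intro!: sum_nonneg P_nonneg)
  have "1 / (18 * 10 ^ 12) / (real q * B) \<le> 1 / (18 * 10 ^ 12) / (1 * B)"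
    using q B by (intro divide_left_mono mult_right_mono) auto
  then have "Q \<le> 1 / (18 * 10 ^ 12) / B"
    using P_sum_le by (simp add: Q_def B_def)
  also have "\<dots> \<le> 1 / 7200 / B" using B by (intro divide_right_mono) auto
  finally have QB: "Q * B \<le> 1 / 7200" using B by (simp add: field_simps)
  have "1 \<le> Y * (B ^ 4 * W + 2 * B\<^sup>2 * Q)"
    using abs_w_mass[OF Y] by (simp add: W_def Q_def B(2) power_mult[symmetric])
  also have "\<dots> = (Y * B ^ 3) * (B * W) + (Y * B ^ 3) * (2 * Q / B)"
    using B(1) by (simp add: distrib_left power2_eq_square power3_eq_cube power4_eq_xxxx)
  also have "\<dots> \<le> 600 * (B * W) + 600 * (2 * Q / B)"
    using Yb B(1) W0 Q0 by (intro add_mono mult_right_mono) (auto simp: B_def)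
  also have "2 * Q / B \<le> Q * B"
  proof -
    have "2 * Q \<le> B\<^sup>2 * Q" using real_b Q0 unfolding B(2) by (intro mult_right_mono)
    then show ?thesis using B(1) by (simp add: divide_le_eq power2_eq_square mult_ac)
  qed
  finally have BW: "1 \<le> 600 * (B * W) + 600 * (Q * B)" by simp
  have "2 * (\<Sum>k<q. max 0 (w k)) = W + (\<Sum>k<q. w k)"
  proof -
    have "(\<Sum>k<q. 2 * max 0 (w k)) = (\<Sum>k<q. \<bar>w k\<bar> + w k)" by (intro sum.cong) auto
    then show ?thesis by (simp only: W_def sum_distrib_left[symmetric] sum.distrib)
  qed
  then have "2 * (\<Sum>k<q. max 0 (w k)) \<ge> W - Q"
    using abs_sum_w_le by (simp add: Q_def)
  then have "2 * (\<Sum>k<q. max 0 (w k)) * B \<ge> (W - Q) * B"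
    using B by (intro mult_right_mono) auto
  then have "1 / 2400 \<le> (\<Sum>k<q. max 0 (w k)) * B"
    using BW QB by (simp add: algebra_simps)
  then show ?thesis using B by (simp add: B_def[symmetric] field_simps)
qed

lemma good_sweep_if_spread_out:
  assumes Y: "\<And>k i. k < q \<Longrightarrow> i < b \<Longrightarrow> \<bar>y k i\<bar> \<le> Y"
    and bq: "real b \<le> 128 * real q" and Yb: "real b ^ 3 * Y\<^sup>2 \<le> 360000"
    and minority: "volume (ring_of_cliques b q) {u. u < b * q \<and> 0 < flat b y u}
      \<le> volume (ring_of_cliques b q) {u. u < b * q \<and> flat b y u \<le> 0}"
  shows "has_good_sweep b q y"
proof (rule ccontr)
  assume no: "\<not> has_good_sweep b q y"
  define B where "B = sqrt (real b)"
  have B: "0 < B" "real b = B\<^sup>2" using sqrt_b_powers by (simp_all add: B_def)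
  have q0: "0 < real q" using q by simp
  have Y0: "0 \<le> Y" using Y[of 0 0] b q by simp
  have "(Y * B ^ 3)\<^sup>2 = real b ^ 3 * Y\<^sup>2"
    unfolding B(2) by (simp add: power_mult_distrib power_mult[symmetric])
  then have "(Y * B ^ 3)\<^sup>2 \<le> 600\<^sup>2" using Yb by simp
  then have YB: "Y * B ^ 3 \<le> 600" by (rule power2_le_imp_le) simp
  \<comment> \<open>The constant \<open>1 / (18 * 10 ^ 12)\<close> makes \<open>p * \<tau>\<close> free of radicals other than \<open>sqrt b\<close>.\<close>
  define p \<tau> where "p = sqrt (1800 / B ^ 3)" and "\<tau> = sqrt (1 / (18 * 10 ^ 12) * B) / real q"
  have p: "0 < p" "p\<^sup>2 = 1800 / B ^ 3" using B by (simp_all add: p_def)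
  have \<tau>: "0 < \<tau>" "\<tau>\<^sup>2 = 1 / (18 * 10 ^ 12) * B / (real q)\<^sup>2"
    using B q0 by (simp_all add: \<tau>_def power_divide)
  \<comment> \<open>The ratio of the squares of \<tau> and \<open>p\<close> is a multiple of
    \<open>b\<^sup>2 / q\<^sup>2\<close>; the restriction on \<open>b\<close> keeps it
    small.\<close>
  have "B ^ 4 \<le> (128 * real q)\<^sup>2"
    using bq power_mono[of "real b" "128 * real q" 2] by (simp add: B(2) power_mult[symmetric])
  then have "B ^ 4 / (real q)\<^sup>2 \<le> 128\<^sup>2"
    using q0 by (simp add: divide_le_eq power_mult_distrib)
  moreover have "\<tau>\<^sup>2 * B ^ 3 = 1 / (18 * 10 ^ 12) * (B ^ 4 / (real q)\<^sup>2)"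
    unfolding \<tau>(2) by (simp add: power4_eq_xxxx power3_eq_cube)
  ultimately have "\<tau>\<^sup>2 * B ^ 3 \<le> 1 / (18 * 10 ^ 12) * 128\<^sup>2"
    by simp
  \<comment> \<open>The range must reach \<open>2 * Y\<close>, since \<open>w_le\<close> bounds the
    clique values only by that. With \<open>Y * B ^ 3\<close> at most 600 this takes 1200 of the
    1800.\<close>
  then have "(2 * Y + \<tau>\<^sup>2) * B ^ 3 \<le> 1800"
    using YB by (simp add: distrib_right)
  then have "2 * Y + \<tau>\<^sup>2 \<le> p\<^sup>2" unfolding p(2) using B by (simp add: pos_le_divide_eq)
  then have range: "2 * Y \<le> p\<^sup>2 - \<tau>\<^sup>2" by simp
  then have "\<tau>\<^sup>2 \<le> p\<^sup>2" using Y0 by simp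
  then have \<tau>p: "\<tau> \<le> p" by (rule power2_le_imp_le) (use p(1) in simp)
  have "y k i \<le> p\<^sup>2 - \<tau>\<^sup>2" if "k < q" "i < b" for k i
    using Y[OF that] Y0 range by linarith
  moreover have "w k \<le> p\<^sup>2 - \<tau>\<^sup>2" if "k < q" for k
    using w_le[OF that Y[OF that]] range by linarith
  ultimately have main: "2 * sqrt \<kappa> * (\<Sum>k<q. max 0 (w k))
    \<le> 4 * real q * (p * \<tau>) + 13 * real b * (p / \<tau>) * (\<Sum>k<q. P k)"
    by (intro positive_part_le_if_no_good_sweep no minority \<tau> \<tau>p)
  have "p * \<tau> = 1 / (10 ^ 5 * B * real q)"
  proof (rule power2_eq_imp_eq)
    have "(p * \<tau>)\<^sup>2 = 1800 / B ^ 3 * (1 / (18 * 10 ^ 12) * B / (real q)\<^sup>2)"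
      by (simp only: power_mult_distrib p(2) \<tau>(2))
    also have "\<dots> = (1 / (10 ^ 5 * B * real q))\<^sup>2"
      using B(1) by (simp add: power_divide power_mult_distrib power2_eq_square power3_eq_cube)
    finally show "(p * \<tau>)\<^sup>2 = (1 / (10 ^ 5 * B * real q))\<^sup>2" .
  qed (use p(1) \<tau>(1) B(1) in simp_all)
  then have p\<tau>: "real q * (p * \<tau>) = 1 / (10 ^ 5 * B)" using q0 by simp
  \<comment> \<open>The shift \<tau> is chosen to balance the errors: with the bound on the sum of
    \<open>P\<close>, the residual term becomes equal to
    \<open>real q * (p * \<tau>)\<close>.\<close>
  have "real b * (p / \<tau>) * (\<Sum>k<q. P k) \<le> real b * (p / \<tau>) * (1 / (18 * 10 ^ 12) / (real q * B))"
    using P_sum_le[folded B_def] p(1) \<tau>(1) by (intro mult_left_mono) simp_all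
  also have "\<dots> = real q * (p * \<tau>)"
  proof -
    have "real b * (p / \<tau>) * (1 / (18 * 10 ^ 12) / (real q * B))
      = real q * (p / \<tau>) * (1 / (18 * 10 ^ 12) * B / (real q)\<^sup>2)"
      using B(1) q0 unfolding B(2) by (simp add: power2_eq_square)
    also have "\<dots> = real q * (p / \<tau>) * \<tau>\<^sup>2" by (simp only: \<tau>(2))
    also have "\<dots> = real q * (p * \<tau>)" using \<tau>(1) by (simp add: power2_eq_square)
    finally show ?thesis .
  qed
  finally have "2 * sqrt \<kappa> * (\<Sum>k<q. max 0 (w k)) \<le> 17 * (1 / (10 ^ 5 * B))"
    using main p\<tau> by simp
  moreover have "2 / 5 \<le> sqrt \<kappa>"
    using kappa_fifth by (intro real_le_rsqrt) (simp add: power2_eq_square)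
  then have "2 * (2 / 5) * (1 / (2400 * B)) \<le> 2 * sqrt \<kappa> * (\<Sum>k<q. max 0 (w k))"
    using positive_part_ge[OF Y YB[unfolded B_def], folded B_def] B(1) kappa_fifth by (intro mult_mono) simp_all
  \<comment> \<open>The gain is 1/3000 and the errors are 17/100000, in units of
    \<open>1 / B\<close>; 17 is 4 from the shift plus 13 from the residual.\<close>
  ultimately have "2 * (2 / 5) * (1 / (2400 * B)) \<le> 17 * (1 / (10 ^ 5 * B))" by linarith
  then have "2 * (2 / 5) * (1 / (2400 * B)) * B \<le> 17 * (1 / (10 ^ 5 * B)) * B"
    using B(1) by (intro mult_right_mono) auto
  then show False using B(1) by simp
qed

end

lemma (in near_eigenvector) good_sweep: "has_good_sweep b q y"
proof -
  let ?I = "{..<q} \<times> {..<b}"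
  define Y where "Y = Max ((\<lambda>(k, i). \<bar>y k i\<bar>) ` ?I)"
  have "(0, 0) \<in> ?I" using b q by simp
  then have ne: "?I \<noteq> {}" by blast
  have Y: "\<bar>y k i\<bar> \<le> Y" if "k < q" "i < b" for k i
    unfolding Y_def using that by (intro Max_ge) (auto intro!: image_eqI[of _ _ "(k, i)"])
  have "Y \<in> (\<lambda>(k, i). \<bar>y k i\<bar>) ` ?I"
    unfolding Y_def using ne by (intro Max_in) auto
  then obtain k0 i0 where att: "k0 < q" "i0 < b" "\<bar>y k0 i0\<bar> = Y" by auto
  interpret neg: near_eigenvector b q \<mu> "\<lambda>k i. - y k i" "\<lambda>k i. - r k i" by (rule negated)
  show ?thesis
  proof (cases "128 * real q < real b \<or> 360000 < real b ^ 3 * Y\<^sup>2")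
    case True
    show ?thesis
    proof (cases "0 \<le> y k0 i0")
      case nonneg: True
      show ?thesis by (rule good_sweep_if_localized[OF Y att(1,2) _ True]) (use att nonneg in auto)
    next
      case neg: False
      have "has_good_sweep b q (\<lambda>k i. - y k i)"
        by (rule neg.good_sweep_if_localized[OF _ att(1,2) _ True]) (use Y att neg in auto)
      then show ?thesis by (rule has_good_sweep_negated)
    qed
  next
    case False
    then have small: "real b \<le> 128 * real q" "real b ^ 3 * Y\<^sup>2 \<le> 360000" by auto
    let ?vol = "\<lambda>S. volume (ring_of_cliques b q) S"
    show ?thesis
    proof (cases "?vol {u. u < b * q \<and> 0 < flat b y u} \<le> ?vol {u. u < b * q \<and> flat b y u \<le> 0}")
      case True
      then show ?thesis by (intro good_sweep_if_spread_out[of Y] Y small)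
    next
      case False
      \<comment> \<open>If the positive side of \<open>y\<close> has the larger volume, the positive
        side of \<open>- y\<close> is a minority; vertices with value 0 belong to the complement in
        both cases.\<close>
      have "?vol {u. u < b * q \<and> flat b y u < 0} \<le> ?vol {u. u < b * q \<and> flat b y u \<le> 0}"
        by (intro volume_mono) auto
      moreover have "?vol {u. u < b * q \<and> 0 < flat b y u} \<le> ?vol {u. u < b * q \<and> 0 \<le> flat b y u}"
        by (intro volume_mono) auto
      ultimately have "?vol {u. u < b * q \<and> flat b y u < 0} \<le> ?vol {u. u < b * q \<and> 0 \<le> flat b y u}"
        using False by linarith
      then have "has_good_sweep b q (\<lambda>k i. - y k i)"
        using Y small by (intro neg.good_sweep_if_spread_out[of Y]) (auto simp: flat_def)
      then show ?thesis by (rule has_good_sweep_negated)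
    qed
  qed
qed

section \<open>The normalized adjacency matrix of the ring of cliques\<close>

lemma mod_pred_iff:
  assumes "k < q" "l < q"
  shows "k = Suc l mod q \<longleftrightarrow> l = (k + (q - 1)) mod q"
proof -
  have "Suc l mod q = k \<longleftrightarrow> l = (k + (q - 1)) mod q"
  proof
    assume k: "Suc l mod q = k"
    have "(k + (q - 1)) mod q = (Suc l + (q - 1)) mod q"
      unfolding k[symmetric] by (simp add: mod_add_left_eq)
    also have "Suc l + (q - 1) = l + q" using assms by simp
    finally show "l = (k + (q - 1)) mod q" using assms by simp
  next
    assume l: "l = (k + (q - 1)) mod q"
    have "Suc l mod q = Suc (k + (q - 1)) mod q" unfolding l by (simp add: mod_Suc_eq)
    also have "Suc (k + (q - 1)) = k + q" using assms by simp
    finally show "Suc l mod q = k" using assms by simp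
  qed
  then show ?thesis by auto
qed

lemma ring_of_cliques_row:
  fixes f :: "nat \<Rightarrow> real"
  assumes q: "q \<ge> 3" and k: "k < q" and i: "i < b"
  shows "(\<Sum>v<b * q. ring_of_cliques b q $$ (k * b + i, v) * f v)
    = (\<Sum>j<b. f (k * b + j)) - f (k * b + i)
      + (if i = 0 then f (Suc k mod q * b) + f ((k + (q - 1)) mod q * b) else 0)"
proof -
  let ?p = "(k + (q - 1)) mod q" and ?s = "Suc k mod q"
  have sp: "?s < q" "?p < q" using q by simp_all
  \<comment> \<open>The two ring neighbours differ because there are at least three cliques;
    otherwise the matrix entry 1 would be counted twice.\<close>
  have ne: "?s \<noteq> ?p"
  proof
    assume "?s = ?p"
    then have "Suc ?s mod q = k" using mod_pred_iff[OF k sp(1)] by simp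
    then show False using k q by (auto simp: mod_Suc split: if_splits)
  qed
  have "(\<Sum>j<b. ring_of_cliques b q $$ (k * b + i, l * b + j) * f (l * b + j))
    = (if l = k then (\<Sum>j<b. f (k * b + j)) - f (k * b + i) else 0)
      + (if l = ?s then (if i = 0 then f (l * b) else 0) else 0)
      + (if l = ?p then (if i = 0 then f (l * b) else 0) else 0)" if l: "l < q" for l
  proof -
    have "(\<Sum>j<b. ring_of_cliques b q $$ (k * b + i, l * b + j) * f (l * b + j))
      = (\<Sum>j<b. ((if l = k then f (k * b + j) else 0) - (if j = i then (if l = k then f (k * b + j) else 0) else 0))
        + (if j = 0 then (if l = ?s then (if i = 0 then f (l * b) else 0) else 0)
          + (if l = ?p then (if i = 0 then f (l * b) else 0) else 0) else 0))"
      using k i l ne by (intro sum.cong refl) (auto simp: ring_of_cliques_entry mod_pred_iff[OF k l])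
    also have "\<dots> = (if l = k then (\<Sum>j<b. f (k * b + j)) - f (k * b + i) else 0)
      + (if l = ?s then (if i = 0 then f (l * b) else 0) else 0)
      + (if l = ?p then (if i = 0 then f (l * b) else 0) else 0)"
      using i by (simp add: sum.distrib sum_subtractf)
    finally show ?thesis .
  qed
  then have "(\<Sum>v<b * q. ring_of_cliques b q $$ (k * b + i, v) * f v)
    = (\<Sum>l<q. (if l = k then (\<Sum>j<b. f (k * b + j)) - f (k * b + i) else 0)
      + (if l = ?s then (if i = 0 then f (l * b) else 0) else 0)
      + (if l = ?p then (if i = 0 then f (l * b) else 0) else 0))"
    unfolding sum_blocks by (intro sum.cong refl) simp
  then show ?thesis using k sp by (simp add: sum.distrib)
qed

lemma degree_of_ring_of_cliques:
  assumes "q \<ge> 3" "k < q" "i < b"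
  shows "degree_of (ring_of_cliques b q) (k * b + i) = (if i = 0 then real b + 1 else real b - 1)"
  using ring_of_cliques_row[OF assms, of "\<lambda>_. 1"] by (simp add: degree_of_def)

lemma vertex_decompose:
  assumes "u < b * (q::nat)"
  obtains k i where "k < q" "i < b" "u = k * b + i"
proof
  have "0 < b" using assms by (cases b) auto
  then show "u div b < q" "u mod b < b" "u = u div b * b + u mod b"
    using assms by (auto simp: less_mult_imp_div_less mult.commute)
qed

lemma degree_of_ring_of_cliques_pos:
  assumes "b \<ge> 2" "q \<ge> 3" "u < b * q"
  shows "0 < degree_of (ring_of_cliques b q) u"
  using assms by (elim vertex_decompose) (auto simp: degree_of_ring_of_cliques)

lemma normalized_adjacency_eq:
  assumes A: "A \<in> carrier_mat n n"
  shows "normalized_adjacency A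
    = mat n n (\<lambda>(u, v). A $$ (u, v) / (sqrt (degree_of A u) * sqrt (degree_of A v)))"
proof -
  have "dim_row A = n" using A by simp
  then have "normalized_adjacency A
    = mat n n (\<lambda>(i, j). 1 / sqrt (degree_of A i) * A $$ (i, j)) * mat_diag n (\<lambda>i. 1 / sqrt (degree_of A i))"
    unfolding normalized_adjacency_def inv_sqrt_degree_mat_def using mat_diag_mult_left[OF A] by simp
  also have "\<dots> = mat n n (\<lambda>(u, v). A $$ (u, v) / (sqrt (degree_of A u) * sqrt (degree_of A v)))"
    by (subst mat_diag_mult_right[of _ n n]) (auto intro!: eq_matI)
  finally show ?thesis .
qed

lemma inv_sqrt_degree_mat_mult:
  assumes "A \<in> carrier_mat n n" "x \<in> carrier_vec n" "u < n"
  shows "(inv_sqrt_degree_mat A *\<^sub>v x) $ u = x $ u / sqrt (degree_of A u)"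
  using assms
  by (simp add: inv_sqrt_degree_mat_def mat_diag_def scalar_prod_def if_distrib[of "\<lambda>c. c * _"] cong: if_cong)

lemma normalized_adjacency_mult:
  assumes A: "A \<in> carrier_mat n n" and x: "x \<in> carrier_vec n" and u: "u < n"
  shows "(normalized_adjacency A *\<^sub>v x) $ u
    = (\<Sum>v<n. A $$ (u, v) * (x $ v / sqrt (degree_of A v))) / sqrt (degree_of A u)"
  using x u unfolding normalized_adjacency_eq[OF A]
  by (auto simp: scalar_prod_def lessThan_atLeast0 sum_divide_distrib mult_ac intro!: sum.cong)

lemma normalized_adjacency_form:
  assumes A: "A \<in> carrier_mat n n" and x: "x \<in> carrier_vec n"
  shows "x \<bullet> (normalized_adjacency A *\<^sub>v x)
    = (\<Sum>u<n. \<Sum>v<n. A $$ (u, v) * (x $ u / sqrt (degree_of A u) * (x $ v / sqrt (degree_of A v))))"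
proof -
  have "normalized_adjacency A *\<^sub>v x \<in> carrier_vec n"
    by (intro carrier_vecI) (simp add: normalized_adjacency_eq[OF A])
  then have "x \<bullet> (normalized_adjacency A *\<^sub>v x) = (\<Sum>u<n. x $ u * (normalized_adjacency A *\<^sub>v x) $ u)"
    unfolding scalar_prod_def lessThan_atLeast0 by (simp only: carrier_vecD)
  also have "\<dots> = (\<Sum>u<n. \<Sum>v<n. A $$ (u, v) * (x $ u / sqrt (degree_of A u) * (x $ v / sqrt (degree_of A v))))"
    using normalized_adjacency_mult[OF A x]
    by (intro sum.cong refl) (simp add: sum_divide_distrib sum_distrib_left mult_ac)
  finally show ?thesis .
qed

text \<open>A product is at most the mean of the two squares, and row sums are degrees. For unit
  vectors this gives \<open>\<mu> \<le> 1\<close> and hence \<open>\<kappa> \<le> 1\<close>.\<close>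

lemma normalized_adjacency_form_le:
  assumes A: "A \<in> carrier_mat n n" and x: "x \<in> carrier_vec n"
    and sym: "\<And>u v. u < n \<Longrightarrow> v < n \<Longrightarrow> A $$ (u, v) = A $$ (v, u)"
    and nonneg: "\<And>u v. u < n \<Longrightarrow> v < n \<Longrightarrow> 0 \<le> A $$ (u, v)"
    and deg: "\<And>u. u < n \<Longrightarrow> 0 < degree_of A u"
  shows "x \<bullet> (normalized_adjacency A *\<^sub>v x) \<le> x \<bullet> x"
proof -
  define y where "y u = x $ u / sqrt (degree_of A u)" for u
  have "(\<Sum>u<n. \<Sum>v<n. A $$ (u, v) * (y u)\<^sup>2) = (\<Sum>u<n. degree_of A u * (y u)\<^sup>2)"
    using A by (simp only: degree_of_def sum_distrib_right carrier_matD)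
  also have "\<dots> = (\<Sum>u<n. x $ u * x $ u)"
  proof (intro sum.cong refl)
    fix u assume "u \<in> {..<n}"
    then show "degree_of A u * (y u)\<^sup>2 = x $ u * x $ u"
      using deg[of u] by (simp add: y_def power_divide power2_eq_square)
  qed
  also have "\<dots> = x \<bullet> x" using x by (simp add: scalar_prod_def lessThan_atLeast0)
  finally have 1: "(\<Sum>u<n. \<Sum>v<n. A $$ (u, v) * (y u)\<^sup>2) = x \<bullet> x" .
  have "(\<Sum>u<n. \<Sum>v<n. A $$ (u, v) * (y v)\<^sup>2) = (\<Sum>u<n. \<Sum>v<n. A $$ (u, v) * (y u)\<^sup>2)"
    by (subst sum.swap) (intro sum.cong refl; simp add: sym)
  with 1 have 2: "(\<Sum>u<n. \<Sum>v<n. A $$ (u, v) * (y v)\<^sup>2) = x \<bullet> x" by simp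
  have "x \<bullet> (normalized_adjacency A *\<^sub>v x) = (\<Sum>u<n. \<Sum>v<n. A $$ (u, v) * (y u * y v))"
    unfolding normalized_adjacency_form[OF A x] y_def ..
  also have "\<dots> \<le> (\<Sum>u<n. \<Sum>v<n. (A $$ (u, v) * (y u)\<^sup>2 + A $$ (u, v) * (y v)\<^sup>2) / 2)"
  proof (intro sum_mono)
    fix u v assume "u \<in> {..<n}" "v \<in> {..<n}"
    then have "A $$ (u, v) * (y u * y v) \<le> A $$ (u, v) * (((y u)\<^sup>2 + (y v)\<^sup>2) / 2)"
      using nonneg[of u v] sum_squares_bound[of "y u" "y v"] by (intro mult_left_mono) auto
    then show "A $$ (u, v) * (y u * y v) \<le> (A $$ (u, v) * (y u)\<^sup>2 + A $$ (u, v) * (y v)\<^sup>2) / 2"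
      by (simp only: distrib_left times_divide_eq_right)
  qed
  also have "\<dots> = x \<bullet> x"
    unfolding sum_divide_distrib[symmetric] sum.distrib 1 2 by simp
  finally show ?thesis .
qed

text \<open>The test vectors are constant on cliques up to the factor \<open>\<alpha>\<close> at the corners,
  which is the minimizer of \<open>m - 2 * m * \<alpha> + (m + 4) * \<alpha>\<^sup>2\<close> for \<open>m = b - 1\<close>.\<close>

lemma nth_largest_eigenvalue_ring_of_cliques_ge:
  assumes b: "b \<ge> 2" and q: "q \<ge> 3"
  shows "1 - 4 / ((real b - 1) * (real b + 3))
    \<le> nth_largest_eigenvalue (normalized_adjacency (ring_of_cliques b q)) q"
proof -
  let ?A = "ring_of_cliques b q" and ?n = "b * q"
  let ?N = "normalized_adjacency ?A" and ?d = "degree_of ?A"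
  note A = ring_of_cliques_carrier[of b q]
  define m \<alpha> where "m = real b - 1" and "\<alpha> = m / (m + 4)"
  have m: "1 \<le> m" "real b = m + 1" using b by (auto simp: m_def)
  have \<alpha>m: "\<alpha> * (m + 4) = m" using m by (simp add: \<alpha>_def)
  define a where "a i = (if i = 0 then \<alpha> else 1)" for i :: nat
  \<comment> \<open>The root of the degree is built in so that rescaling leaves
    \<open>a i * z $ k\<close> at vertex \<open>i\<close> of clique \<open>k\<close>.\<close>
  define Z where "Z = mat ?n q (\<lambda>(u, k). if u div b = k then sqrt (?d u) * a (u mod b) else 0)"
  have Z: "Z \<in> carrier_mat ?n q" by (simp add: Z_def)
  have Zc: "Z *\<^sub>v z \<in> carrier_vec ?n" if "z \<in> carrier_vec q" for z using Z that by simp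
  have Zz: "(Z *\<^sub>v z) $ (k * b + i) = sqrt (?d (k * b + i)) * a i * z $ k"
    if "z \<in> carrier_vec q" "k < q" "i < b" for z k i
    using that block_index_less[OF that(2,3)] block_index[OF that(3), of k]
    by (simp add: Z_def scalar_prod_def if_distrib[of "\<lambda>c. c * _"] cong: if_cong)
  have dpos: "0 < ?d u" if "u < ?n" for u by (rule degree_of_ring_of_cliques_pos[OF b q that])
  have Zy: "(Z *\<^sub>v z) $ (k * b + i) / sqrt (?d (k * b + i)) = a i * z $ k"
    if "z \<in> carrier_vec q" "k < q" "i < b" for z k i
    unfolding Zz[OF that] using dpos[OF block_index_less[OF that(2,3)]] by simp
  show ?thesis
  proof (rule nth_largest_eigenvalue_ge[OF _ _ _ _ Z])
    show "?N \<in> carrier_mat ?n ?n" unfolding normalized_adjacency_eq[OF A] by simp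
    show "transpose_mat ?N = ?N"
      unfolding normalized_adjacency_eq[OF A]
      by (intro eq_matI) (auto simp: ring_of_cliques_symmetric[of _ b q] mult.commute)
    show "1 \<le> q" "q \<le> ?n" using b q by simp_all
    fix z :: "real vec" assume z: "z \<in> carrier_vec q"
    show "z = 0\<^sub>v q" if zero: "Z *\<^sub>v z = 0\<^sub>v ?n"
    proof (intro eq_vecI)
      fix k assume "k < dim_vec (0\<^sub>v q :: real vec)"
      then have k: "k < q" by simp
      have "a 1 * z $ k = 0"
        using Zy[OF z k, of 1] zero b block_index_less[OF k, of 1 b] by simp
      then show "z $ k = 0\<^sub>v q $ k" using k by (simp add: a_def)
    qed (use z in simp)
    have split: "(\<Sum>j<b. f j) = f 0 + (\<Sum>j=1..<b. f j :: real)" for f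
      using b by (simp add: sum_lessThan_first)
    define T where "T = (\<Sum>k<q. (z $ k)\<^sup>2)"
    have "(Z *\<^sub>v z) \<bullet> (Z *\<^sub>v z) = (\<Sum>u<?n. (Z *\<^sub>v z) $ u * (Z *\<^sub>v z) $ u)"
      using Z by (simp add: scalar_prod_def lessThan_atLeast0)
    also have "\<dots> = (\<Sum>k<q. \<Sum>i<b. ?d (k * b + i) * (a i)\<^sup>2 * (z $ k)\<^sup>2)"
      unfolding sum_blocks
    proof (intro sum.cong refl)
      fix k i assume "k \<in> {..<q}" "i \<in> {..<b}"
      then have ki: "k < q" "i < b" by auto
      have "sqrt (?d (k * b + i)) * sqrt (?d (k * b + i)) = ?d (k * b + i)"
        using dpos[OF block_index_less[OF ki]] by simp
      then show "(Z *\<^sub>v z) $ (k * b + i) * (Z *\<^sub>v z) $ (k * b + i) = ?d (k * b + i) * (a i)\<^sup>2 * (z $ k)\<^sup>2"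
        unfolding Zz[OF z ki] by (simp add: power2_eq_square mult_ac)
    qed
    also have "\<dots> = (\<Sum>k<q. ((m + 2) * \<alpha>\<^sup>2 + m\<^sup>2) * (z $ k)\<^sup>2)"
    proof (intro sum.cong refl)
      fix k assume "k \<in> {..<q}"
      then have "(\<Sum>i<b. ?d (k * b + i) * (a i)\<^sup>2 * (z $ k)\<^sup>2)
        = (\<Sum>i<b. (if i = 0 then (m + 2) * \<alpha>\<^sup>2 else m) * (z $ k)\<^sup>2)"
        using q by (intro sum.cong refl) (auto simp: degree_of_ring_of_cliques a_def m)
      also have "\<dots> = ((m + 2) * \<alpha>\<^sup>2 + m\<^sup>2) * (z $ k)\<^sup>2"
        unfolding split using b by (simp add: m_def of_nat_diff power2_eq_square algebra_simps)
      finally show "(\<Sum>i<b. ?d (k * b + i) * (a i)\<^sup>2 * (z $ k)\<^sup>2) = ((m + 2) * \<alpha>\<^sup>2 + m\<^sup>2) * (z $ k)\<^sup>2" .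
    qed
    finally have norm: "(Z *\<^sub>v z) \<bullet> (Z *\<^sub>v z) = ((m + 2) * \<alpha>\<^sup>2 + m\<^sup>2) * T"
      by (simp add: T_def sum_distrib_left)
    define Y where "Y u = (Z *\<^sub>v z) $ u / sqrt (?d u)" for u
    have Yb: "Y (k * b + i) = a i * z $ k" if "k < q" "i < b" for k i
      unfolding Y_def by (rule Zy[OF z that])
    have Y0: "Y (k * b) = \<alpha> * z $ k" if "k < q" for k
      using Yb[OF that, of 0] b by (simp add: a_def)
    have "(Z *\<^sub>v z) \<bullet> (?N *\<^sub>v (Z *\<^sub>v z)) = (\<Sum>u<?n. \<Sum>v<?n. ?A $$ (u, v) * (Y u * Y v))"
      unfolding normalized_adjacency_form[OF A Zc[OF z]] Y_def ..
    also have "\<dots> = (\<Sum>k<q. \<Sum>i<b. \<Sum>j<b. if i = j then 0 else Y (k * b + i) * Y (k * b + j))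
      + (\<Sum>k<q. Y (k * b) * Y (Suc k mod q * b) + Y (Suc k mod q * b) * Y (k * b))"
      using b by (intro ring_of_cliques_sum[OF q]) simp
    also have "(\<Sum>k<q. \<Sum>i<b. \<Sum>j<b. if i = j then 0 else Y (k * b + i) * Y (k * b + j))
      = (\<Sum>k<q. m * (2 * \<alpha> + (m - 1)) * (z $ k)\<^sup>2)"
    proof (intro sum.cong refl)
      fix k assume "k \<in> {..<q}"
      then have "(\<Sum>i<b. \<Sum>j<b. if i = j then 0 else Y (k * b + i) * Y (k * b + j))
        = (\<Sum>i<b. \<Sum>j<b. if i = j then 0 else (if i = 0 then \<alpha> else 1) * (if j = 0 then \<alpha> else 1) * (z $ k)\<^sup>2)"
        by (intro sum.cong refl) (auto simp: Yb a_def power2_eq_square)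
      also have "\<dots> = m * (2 * \<alpha> + (m - 1)) * (z $ k)\<^sup>2"
        using sum_off_diagonal_corner[OF b, of "\<lambda>s t. s * t * (z $ k)\<^sup>2" \<alpha> 1]
        by (simp add: m_def algebra_simps)
      finally show "(\<Sum>i<b. \<Sum>j<b. if i = j then 0 else Y (k * b + i) * Y (k * b + j))
        = m * (2 * \<alpha> + (m - 1)) * (z $ k)\<^sup>2" .
    qed
    also have "(\<Sum>k<q. m * (2 * \<alpha> + (m - 1)) * (z $ k)\<^sup>2) = m * (2 * \<alpha> + (m - 1)) * T"
      by (simp only: T_def sum_distrib_left)
    finally have form: "(Z *\<^sub>v z) \<bullet> (?N *\<^sub>v (Z *\<^sub>v z)) = m * (2 * \<alpha> + (m - 1)) * T
      + (\<Sum>k<q. Y (k * b) * Y (Suc k mod q * b) + Y (Suc k mod q * b) * Y (k * b))" .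
    have cyc: "(\<Sum>k<q. Y (k * b) * Y (Suc k mod q * b) + Y (Suc k mod q * b) * Y (k * b)) \<ge> - 2 * \<alpha>\<^sup>2 * T"
    proof -
      have "- (\<alpha>\<^sup>2 * (z $ k)\<^sup>2 + \<alpha>\<^sup>2 * (z $ (Suc k mod q))\<^sup>2)
        \<le> Y (k * b) * Y (Suc k mod q * b) + Y (Suc k mod q * b) * Y (k * b)" if "k < q" for k
      proof -
        have "Y (k * b) * Y (Suc k mod q * b) + Y (Suc k mod q * b) * Y (k * b)
          = 2 * (\<alpha> * z $ k) * (\<alpha> * z $ (Suc k mod q))"
          using Y0[OF that] Y0[of "Suc k mod q"] q by simp
        \<comment> \<open>The worst case for the ring edges is neighbouring corners of opposite
          sign.\<close>
        moreover have "- ((\<alpha> * z $ k)\<^sup>2 + (\<alpha> * z $ (Suc k mod q))\<^sup>2) \<le> 2 * (\<alpha> * z $ k) * (\<alpha> * z $ (Suc k mod q))"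
          using zero_le_power2[of "\<alpha> * z $ k + \<alpha> * z $ (Suc k mod q)"] unfolding power2_sum by linarith
        ultimately show ?thesis by (simp only: power_mult_distrib)
      qed
      then have "(\<Sum>k<q. - (\<alpha>\<^sup>2 * (z $ k)\<^sup>2 + \<alpha>\<^sup>2 * (z $ (Suc k mod q))\<^sup>2))
        \<le> (\<Sum>k<q. Y (k * b) * Y (Suc k mod q * b) + Y (Suc k mod q * b) * Y (k * b))"
        by (intro sum_mono) simp
      moreover have "(\<Sum>k<q. - (\<alpha>\<^sup>2 * (z $ k)\<^sup>2 + \<alpha>\<^sup>2 * (z $ (Suc k mod q))\<^sup>2)) = - 2 * \<alpha>\<^sup>2 * T"
        using sum_cyclic_Suc[of q "\<lambda>k. \<alpha>\<^sup>2 * (z $ k)\<^sup>2"] q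
        by (simp add: sum.distrib sum_negf sum_subtractf T_def sum_distrib_left mult.assoc)
      ultimately show ?thesis by simp
    qed
    from form cyc have form: "(m * (2 * \<alpha> + (m - 1)) - 2 * \<alpha>\<^sup>2) * T \<le> (Z *\<^sub>v z) \<bullet> (?N *\<^sub>v (Z *\<^sub>v z))"
      by (simp add: left_diff_distrib)
    \<comment> \<open>For this \<alpha> the lower bound on the form is the squared norm minus
      \<open>4 * \<alpha>\<close> per clique. Multiplied by \<open>4 / (m * (m + 4))\<close>, the
      inner share \<open>m\<^sup>2\<close> of the norm alone gives
      \<open>4 * \<alpha>\<close>.\<close>
    have "(1 - 4 / (m * (m + 4))) * ((m + 2) * \<alpha>\<^sup>2 + m\<^sup>2) \<le> m * (2 * \<alpha> + (m - 1)) - 2 * \<alpha>\<^sup>2"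
    proof -
      have "0 \<le> 4 / (m * (m + 4)) * ((m + 2) * \<alpha>\<^sup>2)" using m by simp
      moreover have "4 / (m * (m + 4)) * m\<^sup>2 = 4 * \<alpha>" using m by (simp add: \<alpha>_def power2_eq_square)
      moreover have "m * (2 * \<alpha> + (m - 1)) - 2 * \<alpha>\<^sup>2 = (m + 2) * \<alpha>\<^sup>2 + m\<^sup>2 - 4 * \<alpha>"
      proof -
        have "(m + 4) * \<alpha>\<^sup>2 = m * \<alpha>" using \<alpha>m by (simp add: power2_eq_square mult_ac)
        then show ?thesis using \<alpha>m by (simp add: power2_eq_square algebra_simps)
      qed
      ultimately show ?thesis by (simp add: algebra_simps)
    qed
    moreover have "0 \<le> T" unfolding T_def by (intro sum_nonneg) simp
    moreover have eq: "(real b - 1) * (real b + 3) = m * (m + 4)" by (simp add: m(2))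
    ultimately have "(1 - 4 / (m * (m + 4))) * ((m + 2) * \<alpha>\<^sup>2 + m\<^sup>2) * T
      \<le> (m * (2 * \<alpha> + (m - 1)) - 2 * \<alpha>\<^sup>2) * T" by (intro mult_right_mono)
    then show "(1 - 4 / ((real b - 1) * (real b + 3))) * ((Z *\<^sub>v z) \<bullet> (Z *\<^sub>v z))
      \<le> (Z *\<^sub>v z) \<bullet> (?N *\<^sub>v (Z *\<^sub>v z))"
      using form unfolding norm eq mult.assoc[symmetric] by linarith
  qed
qed

section \<open>From the matrix hypotheses to the clique equations\<close>

lemma scalar_prod_blocks:
  assumes "x \<in> carrier_vec (b * q)" "z \<in> carrier_vec (b * q)"
  shows "x \<bullet> z = (\<Sum>k<q. \<Sum>i<b. x $ (k * b + i) * z $ (k * b + i))"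
  using assms unfolding scalar_prod_def lessThan_atLeast0[symmetric]
  by (simp add: sum_blocks)

lemma near_eigenvector_of_small_residual:
  fixes x :: "real vec"
  assumes b: "b \<ge> 2" and q: "q \<ge> 3"
    and x: "x \<in> carrier_vec (b * q)" "norm_2 x = 1" "x \<bullet> ones_vec (b * q) = 0"
  defines "A \<equiv> ring_of_cliques b q" and "N \<equiv> normalized_adjacency (ring_of_cliques b q)"
  assumes \<mu>: "\<mu> = x \<bullet> (N *\<^sub>v x)" "nth_largest_eigenvalue N q \<le> \<mu>"
    and res: "norm_2 (N *\<^sub>v x - \<mu> \<cdot>\<^sub>v x) < 1 / (18 * 10 ^ 12) / (real q * sqrt (real (b * q)))"
  shows "near_eigenvector b q \<mu> (\<lambda>k i. x $ (k * b + i) / sqrt (degree_of A (k * b + i)))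
    (\<lambda>k i. (N *\<^sub>v x - \<mu> \<cdot>\<^sub>v x) $ (k * b + i))"
proof -
  let ?n = "b * q"
  define y where "y k i = x $ (k * b + i) / sqrt (degree_of A (k * b + i))" for k i
  define r where "r k i = (N *\<^sub>v x - \<mu> \<cdot>\<^sub>v x) $ (k * b + i)" for k i
  note A = ring_of_cliques_carrier[of b q, folded A_def]
  have d: "degree_of A (k * b + i) = (if i = 0 then real b + 1 else real b - 1)" if "k < q" "i < b" for k i
    unfolding A_def by (rule degree_of_ring_of_cliques[OF q that])
  have dpos: "0 < degree_of A (k * b + i)" if "k < q" "i < b" for k i
    unfolding d[OF that] using b by simp
  have xy: "x $ (k * b + i) = sqrt (degree_of A (k * b + i)) * y k i" if "k < q" "i < b" for k i
    using dpos[OF that] by (simp add: y_def)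
  have d0: "degree_of A (k * b) = real b + 1" and x0: "x $ (k * b) = sqrt (real b + 1) * y k 0"
    if "k < q" for k
    using d[OF that, of 0] xy[OF that, of 0] b by auto
  have split: "(\<Sum>j<b. f j) = f 0 + (\<Sum>j=1..<b. f j :: real)" for f
    using b by (simp add: sum_lessThan_first)
  have Nx: "N *\<^sub>v x \<in> carrier_vec ?n"
    unfolding N_def A_def[symmetric] by (intro carrier_vecI) (simp add: normalized_adjacency_eq[OF A])
  \<comment> \<open>Multiplying a row by the root of its degree removes the outer normalization and
    leaves the plain adjacency matrix acting on \<open>y\<close>.\<close>
  have resid: "sqrt (degree_of A (k * b + i)) * r k i
    = (\<Sum>j<b. y k j) - y k i + (if i = 0 then y (Suc k mod q) 0 + y ((k + (q - 1)) mod q) 0 else 0)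
      - \<mu> * degree_of A (k * b + i) * y k i" if ki: "k < q" "i < b" for k i
  proof -
    let ?u = "k * b + i"
    have u: "?u < ?n" by (rule block_index_less[OF ki])
    have "r k i = (N *\<^sub>v x) $ ?u - \<mu> * x $ ?u"
      using u x(1) Nx by (simp add: r_def)
    moreover have "(N *\<^sub>v x) $ ?u = ((\<Sum>j<b. y k j) - y k i
        + (if i = 0 then y (Suc k mod q) 0 + y ((k + (q - 1)) mod q) 0 else 0)) / sqrt (degree_of A ?u)"
      unfolding N_def A_def[symmetric] normalized_adjacency_mult[OF A x(1) u]
      using ring_of_cliques_row[OF q ki, of "\<lambda>v. x $ v / sqrt (degree_of A v)"]
      by (simp add: A_def[symmetric] y_def)
    moreover have "sqrt (degree_of A ?u) * (\<mu> * x $ ?u) = \<mu> * degree_of A ?u * y k i"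
      using dpos[OF ki] unfolding xy[OF ki] by simp
    ultimately show ?thesis
      using dpos[OF ki] by (simp add: right_diff_distrib)
  qed
  have "near_eigenvector b q \<mu> y r"
  proof
    show "2 \<le> b" "3 \<le> q" by fact+
    have xx: "x \<bullet> x = 1" using x(2) by (simp add: norm_2_def)
    show "\<mu> \<le> 1"
      unfolding \<mu>(1) xx[symmetric] N_def
      by (rule normalized_adjacency_form_le[OF ring_of_cliques_carrier x(1)])
        (simp_all add: ring_of_cliques_symmetric ring_of_cliques_nonneg degree_of_ring_of_cliques_pos b q)
    have "1 - 4 / ((real b - 1) * (real b + 3)) \<le> \<mu>"
      using nth_largest_eigenvalue_ring_of_cliques_ge[OF b q] \<mu>(2) by (simp add: N_def)
    then have "1 - \<mu> \<le> 4 / ((real b - 1) * (real b + 3))" by linarith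
    moreover have "0 < (real b - 1) * (real b + 3)" using b by simp
    ultimately show "(1 - \<mu>) * ((real b - 1) * (real b + 3)) \<le> 4"
      by (simp only: pos_le_divide_eq)
    show "(\<Sum>j<b. y k j) - (1 + \<mu> * (real b - 1)) * y k i = sqrt (real b - 1) * r k i"
      if "k < q" "1 \<le> i" "i < b" for k i
      using resid[OF that(1,3), unfolded d[OF that(1,3)]] that by (simp add: algebra_simps)
    show "(\<Sum>j<b. y k j) + y (Suc k mod q) 0 + y ((k + (q - 1)) mod q) 0
        - (1 + \<mu> * (real b + 1)) * y k 0 = sqrt (real b + 1) * r k 0" if "k < q" for k
      using resid[OF that, of 0] d0[OF that] b by (simp add: algebra_simps)
    have ones: "ones_vec ?n \<in> carrier_vec ?n" by (simp add: ones_vec_def)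
    have "x \<bullet> ones_vec ?n = (\<Sum>k<q. \<Sum>i<b. x $ (k * b + i))"
      unfolding scalar_prod_blocks[OF x(1) ones]
      by (intro sum.cong refl) (simp add: ones_vec_def block_index_less)
    also have "\<dots> = (\<Sum>k<q. sqrt (real b - 1) * (\<Sum>i=1..<b. y k i) + sqrt (real b + 1) * y k 0)"
      unfolding split using b by (intro sum.cong refl) (simp add: x0 xy d sum_distrib_left)
    finally show "(\<Sum>k<q. sqrt (real b - 1) * (\<Sum>i=1..<b. y k i) + sqrt (real b + 1) * y k 0) = 0"
      using x(3) by simp
    have "x \<bullet> x = (\<Sum>k<q. \<Sum>i<b. degree_of A (k * b + i) * (y k i)\<^sup>2)"
      unfolding scalar_prod_blocks[OF x(1) x(1)]
    proof (intro sum.cong refl)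
      fix k i assume "k \<in> {..<q}" "i \<in> {..<b}"
      then have ki: "k < q" "i < b" by auto
      have "x $ (k * b + i) * x $ (k * b + i) = (sqrt (degree_of A (k * b + i)))\<^sup>2 * (y k i)\<^sup>2"
        unfolding xy[OF ki] by (simp only: power2_eq_square mult_ac)
      then show "x $ (k * b + i) * x $ (k * b + i) = degree_of A (k * b + i) * (y k i)\<^sup>2"
        using dpos[OF ki] by simp
    qed
    also have "\<dots> = (\<Sum>k<q. (real b - 1) * (\<Sum>i=1..<b. (y k i)\<^sup>2) + (real b + 1) * (y k 0)\<^sup>2)"
      unfolding split using b by (intro sum.cong refl) (simp add: d0 d sum_distrib_left)
    finally show "(\<Sum>k<q. (real b - 1) * (\<Sum>i=1..<b. (y k i)\<^sup>2) + (real b + 1) * (y k 0)\<^sup>2) = 1"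
      using xx by simp
    let ?r = "N *\<^sub>v x - \<mu> \<cdot>\<^sub>v x"
    have rc: "?r \<in> carrier_vec ?n" using Nx x(1) by simp
    have "(\<Sum>k<q. \<Sum>i<b. (r k i)\<^sup>2) = ?r \<bullet> ?r"
      unfolding scalar_prod_blocks[OF rc rc] by (simp only: r_def power2_eq_square)
    also have "\<dots> = (norm_2 ?r)\<^sup>2"
      using conjugate_square_ge_0_vec[of ?r] by (simp add: norm_2_def)
    also have "\<dots> \<le> (1 / (18 * 10 ^ 12) / (real q * sqrt (real ?n)))\<^sup>2"
    proof (rule power_mono)
      show "0 \<le> norm_2 ?r" using conjugate_square_ge_0_vec[of ?r] by (simp add: norm_2_def)
    qed (use res in simp)
    also have "\<dots> = (1 / (18 * 10 ^ 12))\<^sup>2 / (real q ^ 3 * real b)"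
      by (simp add: power_divide power_mult_distrib power2_eq_square power3_eq_cube)
    finally show "(\<Sum>k<q. \<Sum>i<b. (r k i)\<^sup>2) \<le> (1 / (18 * 10 ^ 12))\<^sup>2 / (real q ^ 3 * real b)" .
  qed
  then show ?thesis unfolding y_def r_def .
qed

theorem corollary2:
  shows "\<exists>C::real. C > 0 \<and>
    (\<forall>(b::nat) (q::nat) (n::nat) (A::real mat) (Ah::real mat) (x::real vec) (\<mu>::real).
      b \<ge> 2 \<longrightarrow> q \<ge> 3 \<longrightarrow> n = b * q \<longrightarrow>
      A = ring_of_cliques b q \<longrightarrow> Ah = normalized_adjacency A \<longrightarrow>
      x \<in> carrier_vec n \<longrightarrow> norm_2 x = 1 \<longrightarrow> x \<bullet> ones_vec n = 0 \<longrightarrow>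
      \<mu> = x \<bullet> (Ah *\<^sub>v x) \<longrightarrow>
      \<mu> \<ge> nth_largest_eigenvalue Ah q \<longrightarrow>
      norm_2 (Ah *\<^sub>v x - \<mu> \<cdot>\<^sub>v x) < C / (real q * sqrt (real n)) \<longrightarrow>
      sweep_conductance A (inv_sqrt_degree_mat A *\<^sub>v x)
        \<le> ereal (2 * inverse (real (b choose 2))))"
proof (intro exI[of _ "1 / (18 * 10 ^ 12)"] conjI allI impI)
  fix b q n :: nat and A Ah :: "real mat" and x :: "real vec" and \<mu> :: real
  assume b: "b \<ge> 2" and q: "q \<ge> 3" and n: "n = b * q" and A: "A = ring_of_cliques b q"
    and Ah: "Ah = normalized_adjacency A" and x: "x \<in> carrier_vec n" "norm_2 x = 1" "x \<bullet> ones_vec n = 0"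
    and \<mu>: "\<mu> = x \<bullet> (Ah *\<^sub>v x)" "nth_largest_eigenvalue Ah q \<le> \<mu>"
    and res: "norm_2 (Ah *\<^sub>v x - \<mu> \<cdot>\<^sub>v x) < 1 / (18 * 10 ^ 12) / (real q * sqrt (real n))"
  define y where "y k i = x $ (k * b + i) / sqrt (degree_of A (k * b + i))" for k i
  interpret near_eigenvector b q \<mu> y "\<lambda>k i. (Ah *\<^sub>v x - \<mu> \<cdot>\<^sub>v x) $ (k * b + i)"
    unfolding y_def Ah A
    using near_eigenvector_of_small_residual[OF b q] x \<mu> res unfolding Ah A n by blast
  let ?y = "inv_sqrt_degree_mat A *\<^sub>v x"
  have Ac: "A \<in> carrier_mat n n" unfolding A n by (rule ring_of_cliques_carrier)
  have yu: "?y $ u = flat b y u" if "u < n" for u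
    unfolding inv_sqrt_degree_mat_mult[OF Ac x(1) that] by (simp add: flat_def y_def)
  from good_sweep obtain S where S: "S \<subseteq> {..<n}" "S \<noteq> {}" "S \<noteq> {..<n}"
    and up: "\<And>u v. u \<in> S \<Longrightarrow> v < n \<Longrightarrow> v \<notin> S \<Longrightarrow> flat b y v < flat b y u"
    and c: "conductance A S \<le> ereal (4 / (real b * (real b - 1)))"
    unfolding has_good_sweep_def n A by blast
  have "sweep_conductance A ?y \<le> conductance A S"
  proof (rule sweep_conductance_le_upper_set[OF _ _ S])
    show "dim_row A = n" "dim_vec ?y = n"
      using Ac by (simp_all add: inv_sqrt_degree_mat_def mat_diag_def)
    show "?y $ v < ?y $ u" if "u \<in> S" "v < n" "v \<notin> S" for u v
      using up[OF that] yu[of u] yu[of v] that S(1) by auto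
  qed
  also note c
  also have "4 / (real b * (real b - 1)) = 2 * inverse (real (b choose 2))"
    by (simp add: real_choose_two)
  finally show "sweep_conductance A ?y \<le> ereal (2 * inverse (real (b choose 2)))" .
qed simp

end
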